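(* Let $X$ be a complex Banach space, let $T\in C(X)$ be such that $0\in\rho_e(T)$, and let $X=X_0\oplus X_1$ be a fixed Kato decomposition with respect to $T$. Then $$\operatorname{dist}(0,\sigma_g(T)\setminus\{0\})=\sup\Big\{\frac{1}{r(S)} : S\in B(X),\ \operatorname{ran}(S)\subseteq D(T),\ TST=T \text{ on } D(T),\ SX_0\subseteq X_0\Big\},$$ where $r(S)$ denotes the spectral radius of $S$.
   Context: $X$ is a complex Banach space, $C(X)$ is the set of closed, densely defined linear operators $T: D(T)\subseteq X\to X$, and $B(X)$ is the algebra of bounded linear operators on $X$. $\ker(T)$, $\operatorname{ran}(T)$, $D(T)$ denote kernel, range and domain; $I$ is the identity. A generalized inverse of $T\in C(X)$ is an operator $S\in B(X)$ with $\operatorname{ran}(S)\subseteq D(T)$ such that $TST=T$ on $D(T)$, $STS=S$ on $X$, and $ST$ (defined on $D(T)$) is continuous. $T\in C(X)$ is called regular if $T$ possesses a generalized inverse and $\ker(T^n)\subset\operatorname{ran}(T)$ for all $n\ge 0$. $\operatorname{reg}(T)$ is the set of all $\lambda\in\mathbb{C}$ for which there exist a neighborhood $V$ of $\lambda$ and an analytic function $R:V\to B(X)$ such that $R(\mu)$ is a generalized inverse of $T-\mu I$ for every $\mu\in V$. The generalized spectrum is $\sigma_g(T)=\mathbb{C}\setminus\operatorname{reg}(T)$. $T\in C(X)$ is Fredholm if $\operatorname{ran}(T)$ is closed and both $\dim\ker(T)$ and $\operatorname{codim}\operatorname{ran}(T)$ are finite; $\rho_e(T)=\{\lambda\in\mathbb{C}: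 T-\lambda I \text{ is Fredholm}\}$. A Kato decomposition of $X$ with respect to a Fredholm operator $T$ is a decomposition $X=X_0\oplus X_1$ into two closed $T$-invariant subspaces such that, with $T_i$ the restriction of $T$ to $X_i$ (with domain $D(T)\cap X_i$), $i=0,1$: (1) $\dim X_1<\infty$; (2) $T=T_0\oplus T_1$ (in particular $D(T)=(D(T)\cap X_0)\oplus(D(T)\cap X_1)$); (3) $T_0$ is regular (as an operator in $X_0$); (4) $X_1\subset\ker(T^k)$ for some $k$. Such a decomposition exists for every Fredholm operator (known). Conventions: $1/0=\infty$ and $\operatorname{dist}(0,\emptyset)=\infty$; the common value may be $\infty$. *)

theory Defs
  imports "HOL-Analysis.Analysis"
begin

section \<open>Complex Banach spaces\<close>

class scaleC =
  fixes scaleC :: "complex \<Rightarrow> 'a \<Rightarrow> 'a"  (infixr "*\<^sub>C" 75)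

class complex_vector = real_vector + scaleC +
  assumes scaleC_add_right: "a *\<^sub>C (x + y) = a *\<^sub>C x + a *\<^sub>C y"
    and scaleC_add_left: "(a + b) *\<^sub>C x = a *\<^sub>C x + b *\<^sub>C x"
    and scaleC_scaleC: "a *\<^sub>C b *\<^sub>C x = (a * b) *\<^sub>C x"
    and scaleC_one: "1 *\<^sub>C x = x"
    and scaleR_scaleC: "r *\<^sub>R x = complex_of_real r *\<^sub>C x"

class complex_normed_vector = complex_vector + real_normed_vector +
  assumes norm_scaleC: "norm (a *\<^sub>C x) = cmod a * norm x"

class complex_banach = complex_normed_vector + banach

global_interpretation cvec: vector_space "scaleC :: complex \<Rightarrow> 'a \<Rightarrow> 'a::complex_vector"
  by unfold_locales (simp_all add: scaleC_add_right scaleC_add_left scaleC_scaleC scaleC_one)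

instantiation blinfun :: (real_normed_vector, complex_normed_vector) complex_normed_vector
begin

lift_definition scaleC_blinfun :: "complex \<Rightarrow> 'a \<Rightarrow>\<^sub>L 'b \<Rightarrow> 'a \<Rightarrow>\<^sub>L 'b"
  is "\<lambda>c f x. c *\<^sub>C f x"
proof -
  fix c :: complex and f :: "'a \<Rightarrow> 'b"
  assume "bounded_linear f"
  then interpret f: bounded_linear f .
  show "bounded_linear (\<lambda>x. c *\<^sub>C f x)"
  proof (rule bounded_linear_intro[where K = "cmod c * onorm f"])
    show "norm (c *\<^sub>C f x) \<le> norm x * (cmod c * onorm f)" for x
      using mult_left_mono[OF onorm[OF f.bounded_linear_axioms, of x], of "cmod c"]
      by (simp add: norm_scaleC mult_ac)
  qed (simp_all add: f.add f.scaleR scaleC_add_right scaleR_scaleC scaleC_scaleC mult.commute)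
qed

instance
proof
  fix a b :: complex and r :: real and f g :: "'a \<Rightarrow>\<^sub>L 'b"
  show "a *\<^sub>C (f + g) = a *\<^sub>C f + a *\<^sub>C g"
    by transfer (simp add: scaleC_add_right)
  show "(a + b) *\<^sub>C f = a *\<^sub>C f + b *\<^sub>C f"
    by transfer (simp add: scaleC_add_left)
  show "a *\<^sub>C b *\<^sub>C f = (a * b) *\<^sub>C f"
    by transfer (simp add: scaleC_scaleC)
  show "1 *\<^sub>C f = f"
    by transfer (simp add: scaleC_one)
  show "r *\<^sub>R f = complex_of_real r *\<^sub>C f"
    by transfer (simp add: scaleR_scaleC)
  have le: "norm (c *\<^sub>C h) \<le> cmod c * norm h" for c and h :: "'a \<Rightarrow>\<^sub>L 'b"
  proof (rule norm_blinfun_bound)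
    show "norm (blinfun_apply (c *\<^sub>C h) x) \<le> cmod c * norm h * norm x" for x
      using mult_left_mono[OF norm_blinfun[of h x], of "cmod c"]
      by (simp add: scaleC_blinfun.rep_eq norm_scaleC mult_ac)
  qed simp
  show "norm (a *\<^sub>C f) = cmod a * norm f"
  proof (cases "a = 0")
    case True
    then show ?thesis using le[of 0 f] by simp
  next
    case False
    have "f = inverse a *\<^sub>C a *\<^sub>C f"
      using False by transfer (simp add: scaleC_scaleC scaleC_one)
    then have "cmod a * norm f \<le> cmod a * (cmod (inverse a) * norm (a *\<^sub>C f))"
      using le[of "inverse a" "a *\<^sub>C f"] by (intro mult_left_mono) simp_all
    also have "\<dots> = norm (a *\<^sub>C f)"
      using False by (simp add: norm_inverse)
    finally have "cmod a * norm f \<le> norm (a *\<^sub>C f)" .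
    with le[of a f] show ?thesis by simp
  qed
qed

end

section \<open>Operators in a Banach space and in its closed subspaces\<close>

text \<open>
  An operator is given by its domain \<open>D\<close> and a function \<open>T\<close>; the values of \<open>T\<close> outside \<open>D\<close>
  are never used. The Banach space \<open>X\<close> in which it acts is a set, so that it can be
  a closed subspace of the ambient space as well as the whole space \<open>UNIV\<close>.
\<close>

definition clinear_on :: "'a set \<Rightarrow> ('a::complex_vector \<Rightarrow> 'a) \<Rightarrow> bool" where
  "clinear_on D T \<longleftrightarrow>
     (\<forall>x\<in>D. \<forall>y\<in>D. T (x + y) = T x + T y) \<and> (\<forall>c. \<forall>x\<in>D. T (c *\<^sub>C x) = c *\<^sub>C T x)"

definition closed_op :: "'a set \<Rightarrow> 'a set \<Rightarrow> ('a::complex_normed_vector \<Rightarrow> 'a) \<Rightarrow> bool" where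
  "closed_op X D T \<longleftrightarrow>
     cvec.subspace D \<and> D \<subseteq> X \<and> T ` D \<subseteq> X \<and> clinear_on D T \<and>
     closed ((\<lambda>x. (x, T x)) ` D) \<and> X \<subseteq> closure D"

definition bounded_op :: "'a set \<Rightarrow> ('a::complex_normed_vector \<Rightarrow> 'a) \<Rightarrow> bool" where
  "bounded_op X S \<longleftrightarrow>
     clinear_on X S \<and> S ` X \<subseteq> X \<and> (\<exists>K. \<forall>x\<in>X. norm (S x) \<le> K * norm x)"

definition op_shift :: "('a::complex_vector \<Rightarrow> 'a) \<Rightarrow> complex \<Rightarrow> 'a \<Rightarrow> 'a" where
  "op_shift T \<mu> = (\<lambda>x. T x - \<mu> *\<^sub>C x)"

definition ker_op :: "'a set \<Rightarrow> ('a::complex_vector \<Rightarrow> 'a) \<Rightarrow> 'a set" where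
  "ker_op D T = {x \<in> D. T x = 0}"

text \<open>The domain of the \<open>n\<close>-th power consists of the \<open>x \<in> X\<close> with \<open>x, T x, \<dots>, T\<^sup>n\<^sup>-\<^sup>1 x \<in> D\<close>;
  it is \<open>X\<close> for \<open>n = 0\<close>.\<close>

definition ker_pow :: "'a set \<Rightarrow> 'a set \<Rightarrow> ('a::complex_vector \<Rightarrow> 'a) \<Rightarrow> nat \<Rightarrow> 'a set" where
  "ker_pow X D T n = {x \<in> X. (\<forall>i<n. (T ^^ i) x \<in> D) \<and> (T ^^ n) x = 0}"

definition gen_inverse ::
  "'a set \<Rightarrow> 'a set \<Rightarrow> ('a::complex_normed_vector \<Rightarrow> 'a) \<Rightarrow> ('a \<Rightarrow> 'a) \<Rightarrow> bool" where
  "gen_inverse X D T S \<longleftrightarrow>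
     bounded_op X S \<and> S ` X \<subseteq> D \<and>
     (\<forall>x\<in>D. T (S (T x)) = T x) \<and> (\<forall>x\<in>X. S (T (S x)) = S x) \<and>
     continuous_on D (\<lambda>x. S (T x))"

definition regular_op :: "'a set \<Rightarrow> 'a set \<Rightarrow> ('a::complex_normed_vector \<Rightarrow> 'a) \<Rightarrow> bool" where
  "regular_op X D T \<longleftrightarrow>
     closed_op X D T \<and> (\<exists>S. gen_inverse X D T S) \<and> (\<forall>n. ker_pow X D T n \<subseteq> T ` D)"

section \<open>The generalized spectrum\<close>

text \<open>
  \<open>'a \<Rightarrow>\<^sub>L 'a\<close> is the space of bounded real-linear operators with the operator norm;
  \<open>B(X)\<close> is the closed complex subspace of its complex-linear members.
\<close>

definition cblinfuns :: "('a::complex_normed_vector \<Rightarrow>\<^sub>L 'a) set" where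
  "cblinfuns = {S. \<forall>c x. blinfun_apply S (c *\<^sub>C x) = c *\<^sub>C blinfun_apply S x}"

text \<open>For open \<open>V\<close>, as for \<^const>\<open>holomorphic_on\<close>: complex differentiability, in operator norm.\<close>

definition op_analytic_on ::
  "(complex \<Rightarrow> 'a::complex_normed_vector \<Rightarrow>\<^sub>L 'a) \<Rightarrow> complex set \<Rightarrow> bool" where
  "op_analytic_on R V \<longleftrightarrow>
     R ` V \<subseteq> cblinfuns \<and>
     (\<forall>\<mu>\<in>V. \<exists>R'\<in>cblinfuns. (R has_derivative (\<lambda>h. h *\<^sub>C R')) (at \<mu>))"

definition reg_set :: "'a set \<Rightarrow> ('a::complex_normed_vector \<Rightarrow> 'a) \<Rightarrow> complex set" where
  "reg_set D T =
     {z. \<exists>V R. open V \<and> z \<in> V \<and> op_analytic_on R V \<and>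
            (\<forall>\<mu>\<in>V. gen_inverse UNIV D (op_shift T \<mu>) (blinfun_apply (R \<mu>)))}"

definition gen_spectrum :: "'a set \<Rightarrow> ('a::complex_normed_vector \<Rightarrow> 'a) \<Rightarrow> complex set" where
  "gen_spectrum D T = - reg_set D T"

section \<open>Fredholm operators and Kato decompositions\<close>

definition finite_cdim :: "'a::complex_vector set \<Rightarrow> bool" where
  "finite_cdim M \<longleftrightarrow> (\<exists>B. finite B \<and> M \<subseteq> cvec.span B)"

text \<open>The classes of the members of \<open>B\<close> span the quotient by \<open>M\<close>.\<close>

definition finite_ccodim :: "'a::complex_vector set \<Rightarrow> bool" where
  "finite_ccodim M \<longleftrightarrow> (\<exists>B. finite B \<and> (\<forall>x. \<exists>y\<in>M. x - y \<in> cvec.span B))"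

definition fredholm_op :: "'a set \<Rightarrow> ('a::complex_normed_vector \<Rightarrow> 'a) \<Rightarrow> bool" where
  "fredholm_op D T \<longleftrightarrow>
     closed_op UNIV D T \<and> closed (T ` D) \<and> finite_cdim (ker_op D T) \<and> finite_ccodim (T ` D)"

definition rho_e :: "'a set \<Rightarrow> ('a::complex_normed_vector \<Rightarrow> 'a) \<Rightarrow> complex set" where
  "rho_e D T = {z. fredholm_op D (op_shift T z)}"

definition kato_decomposition ::
  "'a set \<Rightarrow> ('a::complex_normed_vector \<Rightarrow> 'a) \<Rightarrow> 'a set \<Rightarrow> 'a set \<Rightarrow> bool" where
  "kato_decomposition D T X\<^sub>0 X\<^sub>1 \<longleftrightarrow>
     cvec.subspace X\<^sub>0 \<and> closed X\<^sub>0 \<and> cvec.subspace X\<^sub>1 \<and> closed X\<^sub>1 \<and>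
     X\<^sub>0 \<inter> X\<^sub>1 = {0} \<and> (\<forall>x. \<exists>x\<^sub>0\<in>X\<^sub>0. \<exists>x\<^sub>1\<in>X\<^sub>1. x = x\<^sub>0 + x\<^sub>1) \<and>
     T ` (D \<inter> X\<^sub>0) \<subseteq> X\<^sub>0 \<and> T ` (D \<inter> X\<^sub>1) \<subseteq> X\<^sub>1 \<and>
     finite_cdim X\<^sub>1 \<and>
     (\<forall>x\<in>D. \<exists>x\<^sub>0\<in>D \<inter> X\<^sub>0. \<exists>x\<^sub>1\<in>D \<inter> X\<^sub>1. x = x\<^sub>0 + x\<^sub>1 \<and> T x = T x\<^sub>0 + T x\<^sub>1) \<and>
     regular_op X\<^sub>0 (D \<inter> X\<^sub>0) T \<and>
     (\<exists>k. X\<^sub>1 \<subseteq> ker_pow UNIV D T k)"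

section \<open>Spectral radius and distance\<close>

definition op_spectrum :: "('a::complex_normed_vector \<Rightarrow>\<^sub>L 'a) \<Rightarrow> complex set" where
  "op_spectrum S =
     {z. \<not> (\<exists>B\<in>cblinfuns. (S - z *\<^sub>C id_blinfun) o\<^sub>L B = id_blinfun \<and>
                     B o\<^sub>L (S - z *\<^sub>C id_blinfun) = id_blinfun)}"

text \<open>
  Values are in \<^typ>\<open>ennreal\<close>, where \<open>Sup {} = 0\<close> (so the spectral radius is \<open>0\<close> on the zero
  space), \<open>Inf {} = \<infinity>\<close> (so the distance to the empty set is \<open>\<infinity>\<close>) and \<open>1 / 0 = \<infinity>\<close>.
\<close>

definition op_spectral_radius :: "('a::complex_normed_vector \<Rightarrow>\<^sub>L 'a) \<Rightarrow> ennreal" where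
  "op_spectral_radius S = (SUP z\<in>op_spectrum S. ennreal (cmod z))"

definition dist_set :: "'a::metric_space \<Rightarrow> 'a set \<Rightarrow> ennreal" where
  "dist_set x A = (INF y\<in>A. ennreal (dist x y))"

end

theory Submission
  imports Defs "HOL-Computational_Algebra.Fundamental_Theorem_Algebra"
begin

text \<open>
  Call \<open>S\<close> valid if \<open>T S T = T\<close> and \<open>S X\<^sub>0 \<subseteq> X\<^sub>0\<close>. If \<open>\<bar>z\<bar> < 1/r(S)\<close> and \<open>S\<^sub>0\<close> is the generalized inverse of the
  regular part of \<open>T\<close>, then \<open>(1 - z S)\<^sup>-\<^sup>1 S\<^sub>0 T S\<close> is a generalized inverse of \<open>T - z\<close> on \<open>X\<^sub>0\<close>, because regularity gives
  \<open>(1 - z S)\<^sup>-\<^sup>1 ker T \<subseteq> ker (T - z)\<close>; on \<open>X\<^sub>1\<close> the nilpotent \<open>T\<close> gives an inverse for \<open>z \<noteq> 0\<close>. The factor \<open>S\<^sub>0 T\<close> is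
  there because \<open>S T\<close> need not be continuous. This proves \<open>\<ge>\<close>.

  Conversely let \<open>T - z\<close> have local generalized inverses \<open>R(z)\<close> for \<open>0 < \<bar>z\<bar> < d\<close>, and let \<open>r < d\<close>. For every valid \<open>S\<close>
  the operator \<open>1 + z R(z)\<close> inverts \<open>1 - z S\<close> up to finite rank, so by the spectral radius formula modulo
  finite rank and a Riesz argument there is an \<open>S\<close>-invariant subspace \<open>F\<close> of finite codimension in which \<open>1 - z S\<close> is
  bijective for all \<open>\<bar>z\<bar> \<le> r\<close>. Perturbations of rank one keep \<open>S\<close> valid if they have range in \<open>ker T\<close> or kernel
  containing \<open>ran T\<close>. The first kind enlarges \<open>F\<close> until it contains \<open>ker T \<inter> X\<^sub>0\<close>, and then \<open>ker (T - z) \<subseteq> F\<close> for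
  \<open>0 < \<bar>z\<bar> < d\<close>. A remaining eigenvector of \<open>S\<close> outside \<open>F\<close> with \<open>x = z S x\<close>, \<open>\<bar>z\<bar> \<le> r\<close>, cannot lie in \<open>ran T\<close>, since it would satisfy
  \<open>T x = z x\<close>; the second kind then moves its eigenvalue to \<open>0\<close>, until \<open>F\<close> is the whole space.
\<close>

section \<open>Bounded complex-linear operators\<close>

text \<open>The condition \<open>T S T = T\<close> is affine in \<open>S\<close>, which leaves room
  for rank-one changes; \<open>S T S = S\<close> would be quadratic. This freedom is spent on moving
  eigenvalues of modulus at least \<open>1/r\<close> to 0. Three obstacles shape the proof. The
  generalized inverses \<open>R(z)\<close> near different points are unrelated, so only their local
  boundedness is exploited. The Fredholm property is known at 0 only, a point that may itself be in
  the generalized spectrum; it has to be carried through the connected punctured disc before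
  \<open>1 + z R(z)\<close> is known to be an inverse up to finite rank. The third obstacle is the
  invariance of \<open>X\<^sub>0\<close>: an eigenvector outside \<open>X\<^sub>0\<close> may only
  be paired with a functional that vanishes on \<open>X\<^sub>0\<close>. Hence two passes, one
  inside \<open>X\<^sub>0\<close> with functionals vanishing on \<open>ran T\<close>, one on the
  whole space with functionals vanishing on \<open>ran T + X\<^sub>0\<close>. In the second pass a
  bad eigenvector in \<open>ran T + X\<^sub>0\<close> must lie in \<open>X\<^sub>0\<close>, because
  the nilpotent part of \<open>T\<close> has no nonzero eigenvalue.\<close>

lemma bounded_bilinear_scaleC:
  "bounded_bilinear (scaleC :: complex \<Rightarrow> 'a::complex_normed_vector \<Rightarrow> 'a)"
proof (rule bounded_bilinear.intro)
  show "\<exists>K. \<forall>a b. norm (a *\<^sub>C b :: 'a) \<le> norm a * norm b * K"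
    by (rule exI[of _ 1]) (simp add: norm_scaleC)
qed (simp_all add: scaleC_add_left scaleC_add_right scaleR_scaleC scaleC_scaleC
    scaleR_conv_of_real mult.commute)

lemmas tendsto_scaleC = bounded_bilinear.tendsto[OF bounded_bilinear_scaleC]

lemma cblinfuns_scaleC: "S \<in> cblinfuns \<Longrightarrow> blinfun_apply S (c *\<^sub>C x) = c *\<^sub>C blinfun_apply S x"
  by (simp add: cblinfuns_def)

lemma cblinfuns_id [intro, simp]: "id_blinfun \<in> cblinfuns"
  by (simp add: cblinfuns_def)

lemma cblinfuns_zero [intro, simp]: "0 \<in> cblinfuns"
  by (simp add: cblinfuns_def)

lemma cblinfuns_add [intro, simp]: "S \<in> cblinfuns \<Longrightarrow> U \<in> cblinfuns \<Longrightarrow> S + U \<in> cblinfuns"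
  by (simp add: cblinfuns_def plus_blinfun.rep_eq scaleC_add_right)

lemma cblinfuns_diff [intro, simp]: "S \<in> cblinfuns \<Longrightarrow> U \<in> cblinfuns \<Longrightarrow> S - U \<in> cblinfuns"
  by (simp add: cblinfuns_def minus_blinfun.rep_eq cvec.scale_right_diff_distrib)

lemma cblinfuns_comp [intro, simp]: "S \<in> cblinfuns \<Longrightarrow> U \<in> cblinfuns \<Longrightarrow> S o\<^sub>L U \<in> cblinfuns"
  by (simp add: cblinfuns_def)

lemma blinfun_apply_scaleC [simp]: "blinfun_apply (c *\<^sub>C S) x = c *\<^sub>C blinfun_apply S x"
  by (simp add: scaleC_blinfun.rep_eq)

lemma cblinfuns_scale [intro, simp]: "S \<in> cblinfuns \<Longrightarrow> c *\<^sub>C S \<in> cblinfuns"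
  by (simp add: cblinfuns_def scaleC_scaleC mult.commute)

lemma cblinfun_exists:
  fixes f :: "'a::complex_normed_vector \<Rightarrow> 'a"
  assumes "\<And>x y. f (x + y) = f x + f y" "\<And>c x. f (c *\<^sub>C x) = c *\<^sub>C f x"
    and "\<And>x. norm (f x) \<le> K * norm x"
  obtains F where "F \<in> cblinfuns" "blinfun_apply F = f"
proof -
  have "bounded_linear f"
    by (rule bounded_linear_intro[where K = K])
      (use assms in \<open>simp_all add: scaleR_scaleC mult.commute\<close>)
  then show thesis
    using assms by (intro that[of "Blinfun f"]) (simp_all add: cblinfuns_def bounded_linear_Blinfun_apply)
qed

definition cfunctional :: "('a::complex_normed_vector \<Rightarrow> complex) \<Rightarrow> bool" where
  "cfunctional \<phi> \<longleftrightarrow> (\<forall>x y. \<phi> (x + y) = \<phi> x + \<phi> y) \<and> (\<forall>c x. \<phi> (c *\<^sub>C x) = c * \<phi> x) \<and>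
     (\<exists>K. \<forall>x. cmod (\<phi> x) \<le> K * norm x)"

lemma rank_one_exists:
  fixes v :: "'a::complex_normed_vector"
  assumes "cfunctional \<phi>"
  obtains F where "F \<in> cblinfuns" "blinfun_apply F = (\<lambda>x. \<phi> x *\<^sub>C v)"
proof -
  obtain K where K: "\<And>x. cmod (\<phi> x) \<le> K * norm x"
    using assms unfolding cfunctional_def by blast
  show thesis
  proof (rule cblinfun_exists[where f = "\<lambda>x. \<phi> x *\<^sub>C v" and K = "K * norm v"])
    show "norm (\<phi> x *\<^sub>C v) \<le> K * norm v * norm x" for x
      using mult_right_mono[OF K[of x], of "norm v"] by (simp add: norm_scaleC mult_ac)
  qed (use assms that in \<open>auto simp: cfunctional_def scaleC_add_left scaleC_scaleC\<close>)
qed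

lemma cblinfuns_sum [intro]: "(\<And>i. i \<in> A \<Longrightarrow> F i \<in> cblinfuns) \<Longrightarrow> sum F A \<in> cblinfuns"
  by (induction A rule: infinite_finite_induct) auto

lemma blinfun_apply_sum: "blinfun_apply (sum F A) x = (\<Sum>i\<in>A. blinfun_apply (F i) x)"
  by (induction A rule: infinite_finite_induct) (auto simp: blinfun.add_left)

lemma subspace_image_cblinfun:
  "S \<in> cblinfuns \<Longrightarrow> cvec.subspace M \<Longrightarrow> cvec.subspace (blinfun_apply S ` M)"
  unfolding cvec.subspace_def
  by (auto simp: image_iff) (metis blinfun.zero_right, metis blinfun.add_right, metis cblinfuns_scaleC)

lemma cblinfun_span:
  assumes "S \<in> cblinfuns" "x \<in> cvec.span B"
  shows "blinfun_apply S x \<in> cvec.span (blinfun_apply S ` B)"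
  using assms(2)
proof (induction rule: cvec.span_induct_alt)
  case (step c b x)
  then show ?case
    using assms(1)
    by (simp add: blinfun.add_right cblinfuns_scaleC cvec.span_add cvec.span_scale cvec.span_base)
qed (simp add: cvec.span_zero)

section \<open>Subspaces of finite dimension and codimension\<close>

lemma cvec_subspace_scaleR: "cvec.subspace F \<Longrightarrow> x \<in> F \<Longrightarrow> r *\<^sub>R x \<in> F"
  by (simp add: scaleR_scaleC cvec.subspace_scale)

text \<open>Enlargement by one line is the induction step wherever a subspace of finite codimension
  has to grow.\<close>

definition add_line :: "'a::complex_vector set \<Rightarrow> 'a \<Rightarrow> 'a set" where
  "add_line F x = {f + c *\<^sub>C x | f c. f \<in> F}"

lemma subspace_add_line: "cvec.subspace F \<Longrightarrow> cvec.subspace (add_line F x)"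
proof -
  assume F: "cvec.subspace F"
  have "f + c *\<^sub>C x + (g + d *\<^sub>C x) = (f + g) + (c + d) *\<^sub>C x" for f g c d
    by (simp add: algebra_simps scaleC_add_left)
  moreover have "a *\<^sub>C (f + c *\<^sub>C x) = a *\<^sub>C f + (a * c) *\<^sub>C x" for a f c
    by (simp add: scaleC_add_right scaleC_scaleC)
  moreover have "0 = 0 + 0 *\<^sub>C x" by simp
  ultimately show ?thesis
    using F unfolding cvec.subspace_def add_line_def by blast
qed

lemma add_line_superset: "F \<subseteq> add_line F x"
proof
  fix f assume "f \<in> F"
  then show "f \<in> add_line F x"
    unfolding add_line_def using cvec.scale_zero_left[of x] by (metis (mono_tags, lifting) add.right_neutral mem_Collect_eq)
qed

lemma add_line_mem: "cvec.subspace F \<Longrightarrow> x \<in> add_line F x"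
  unfolding add_line_def using cvec.subspace_0 scaleC_one[of x]
  by (metis (mono_tags, lifting) add.left_neutral mem_Collect_eq)

lemma add_line_subset: "cvec.subspace G \<Longrightarrow> F \<subseteq> G \<Longrightarrow> x \<in> G \<Longrightarrow> add_line F x \<subseteq> G"
  unfolding add_line_def using cvec.subspace_add cvec.subspace_scale by blast

text \<open>The distance from \<open>x\<close> to the closed set \<open>F\<close> is positive, and
  division by \<open>c\<close> transfers it to \<open>f + c x\<close>. The coefficient of
  \<open>x\<close> is thus a continuous function of the vector; every bounded functional constructed
  below rests on this.\<close>

lemma add_line_bound:
  fixes F :: "'a::complex_normed_vector set"
  assumes F: "cvec.subspace F" "closed F" "x \<notin> F"
  shows "\<exists>\<delta>>0. \<forall>f\<in>F. \<forall>c. \<delta> * cmod c \<le> norm (f + c *\<^sub>C x)"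
proof -
  obtain e where e: "e > 0" "\<And>y. dist y x < e \<Longrightarrow> y \<notin> F"
    using F(2,3) by (metis Compl_iff open_Compl open_dist)
  have "e * cmod c \<le> norm (f + c *\<^sub>C x)" if f: "f \<in> F" for f c
  proof (cases "c = 0")
    case False
    define y where "y = (- inverse c) *\<^sub>C f"
    have "y \<in> F" using f F(1) by (simp add: y_def cvec.subspace_scale del: cvec.scale_minus_left)
    then have "e \<le> dist y x" using e(2) by force
    moreover have "f + c *\<^sub>C x = c *\<^sub>C (x - y)"
      using False by (simp add: y_def cvec.scale_right_diff_distrib scaleC_scaleC scaleC_one algebra_simps)
    ultimately show ?thesis
      by (metis dist_commute dist_norm mult.commute mult_right_mono norm_ge_zero norm_scaleC)
  qed simp
  with e(1) show ?thesis by blast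
qed

lemma closed_add_line:
  fixes F :: "'a::complex_banach set"
  assumes F: "cvec.subspace F" "closed F"
  shows "closed (add_line F x)"
proof (cases "x \<in> F")
  case True
  then have "add_line F x = F"
    using add_line_superset add_line_subset[OF F(1) order_refl] by blast
  then show ?thesis using F by simp
next
  case False
  obtain \<delta> where d: "\<delta> > 0" "\<And>f c. f \<in> F \<Longrightarrow> \<delta> * cmod c \<le> norm (f + c *\<^sub>C x)"
    using add_line_bound[OF F False] by blast
  show ?thesis
    unfolding closed_sequential_limits
  proof (intro allI impI, elim conjE)
    fix y l assume y: "\<forall>n. y n \<in> add_line F x" and l: "y \<longlonglongrightarrow> l"
    have "\<forall>n. \<exists>f c. f \<in> F \<and> y n = f + c *\<^sub>C x" using y unfolding add_line_def by blast
    then obtain f c where fc: "\<And>n. f n \<in> F" "\<And>n. y n = f n + c n *\<^sub>C x" by metis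
    have "Cauchy c"
    proof (rule metric_CauchyI)
      fix e :: real assume "e > 0"
      then obtain M where M: "\<And>m n. m \<ge> M \<Longrightarrow> n \<ge> M \<Longrightarrow> dist (y m) (y n) < \<delta> * e"
        using LIMSEQ_imp_Cauchy[OF l] d(1) unfolding Cauchy_def by (meson mult_pos_pos)
      have "dist (c m) (c n) < e" if "m \<ge> M" "n \<ge> M" for m n
      proof -
        have "y m - y n = (f m - f n) + (c m - c n) *\<^sub>C x"
          by (simp add: fc cvec.scale_left_diff_distrib)
        then have "\<delta> * cmod (c m - c n) \<le> dist (y m) (y n)"
          using d(2)[of "f m - f n" "c m - c n"] fc(1) F(1) by (simp add: cvec.subspace_diff dist_norm)
        also have "\<dots> < \<delta> * e" using M that by blast
        finally show ?thesis using d(1) by (simp add: dist_norm)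
      qed
      then show "\<exists>M. \<forall>m\<ge>M. \<forall>n\<ge>M. dist (c m) (c n) < e" by blast
    qed
    then obtain c0 where c0: "c \<longlonglongrightarrow> c0" using Cauchy_convergent_iff convergent_def by blast
    have "(\<lambda>n. y n - c n *\<^sub>C x) \<longlonglongrightarrow> l - c0 *\<^sub>C x"
      by (intro tendsto_intros tendsto_scaleC l c0)
    moreover have "y n - c n *\<^sub>C x \<in> F" for n using fc by simp
    ultimately have "l - c0 *\<^sub>C x \<in> F" by (rule closed_sequentially[OF F(2), rotated])
    then show "l \<in> add_line F x"
      unfolding add_line_def by (intro CollectI exI[of _ "l - c0 *\<^sub>C x"] exI[of _ c0]) simp
  qed
qed

lemma subspace_add_span:
  assumes "cvec.subspace F" shows "cvec.subspace {f + b | f b. f \<in> F \<and> b \<in> cvec.span B}"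
  using cvec.subspace_sums[OF assms cvec.subspace_span[of B]] .

lemma span_insert_add_line: "cvec.span (insert a B) = add_line (cvec.span B) a"
proof
  show "cvec.span (insert a B) \<subseteq> add_line (cvec.span B) a"
    by (rule cvec.span_minimal)
      (use add_line_superset[of "cvec.span B" a] cvec.span_superset[of B] in
        \<open>auto simp: subspace_add_line add_line_mem\<close>)
  show "add_line (cvec.span B) a \<subseteq> cvec.span (insert a B)"
    by (rule add_line_subset) (auto intro: cvec.span_base cvec.span_mono[THEN subsetD])
qed

lemma closed_span_finite:
  assumes "finite B" shows "closed (cvec.span B :: 'a::complex_banach set)"
  using assms by induction (simp_all add: span_insert_add_line closed_add_line)

text \<open>A closed subspace of finite codimension is enlarged to a closed complement of the line
  through \<open>x\<close>, which is then the kernel of a functional; Hahn-Banach is not needed.\<close>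

lemma complement_of_line:
  fixes F :: "'a::complex_banach set"
  assumes "finite B" "cvec.subspace F" "closed F" "x \<notin> F"
  shows "\<exists>G. cvec.subspace G \<and> closed G \<and> F \<subseteq> G \<and> x \<notin> G \<and> B \<subseteq> add_line G x"
  using assms
proof induction
  case (insert b B)
  then obtain G where G: "cvec.subspace G" "closed G" "F \<subseteq> G" "x \<notin> G" "B \<subseteq> add_line G x" by blast
  show ?case
  \<comment> \<open>If adjoining \<open>b\<close> to \<open>G\<close> would capture
    \<open>x\<close>, then \<open>b\<close> already lies in the sum of \<open>G\<close> and the
    line; otherwise \<open>b\<close> is absorbed into the complement.\<close>
  proof (cases "x \<in> add_line G b")
    case True
    then obtain g c where gc: "g \<in> G" "x = g + c *\<^sub>C b" by (auto simp: add_line_def)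
    with G have "c \<noteq> 0" by auto
    then have "b = (- inverse c) *\<^sub>C g + inverse c *\<^sub>C x"
      by (simp add: gc scaleC_add_right scaleC_scaleC scaleC_one)
    moreover have "(- inverse c) *\<^sub>C g \<in> G" using gc G cvec.subspace_scale by blast
    ultimately have "b \<in> add_line G x" unfolding add_line_def by blast
    with G show ?thesis by blast
  next
    case False
    have sub: "cvec.subspace (add_line G b)" by (rule subspace_add_line[OF G(1)])
    have "G \<subseteq> add_line G b" "b \<in> add_line G b"
      using add_line_superset add_line_mem G(1) by auto
    moreover have "add_line G x \<subseteq> add_line (add_line G b) x"
      using \<open>G \<subseteq> add_line G b\<close> unfolding add_line_def[of _ x] by blast
    ultimately show ?thesis
      using G False sub closed_add_line[OF G(1,2), of b] add_line_superset[of "add_line G b" x]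
      by (intro exI[of _ "add_line G b"]) auto
  qed
qed blast

text \<open>With a closed complement \<open>G\<close> of the line through \<open>x\<close>, the
  value \<open>\<phi> y\<close> is the unique \<open>c\<close> for which \<open>y - c x\<close> lies
  in \<open>G\<close>; uniqueness and continuity both come from
  \<open>add_line_bound\<close>.\<close>

lemma separating_functional:
  fixes F :: "'a::complex_banach set"
  assumes F: "cvec.subspace F" "closed F" "finite_ccodim F" "x \<notin> F"
  obtains \<phi> where "cfunctional \<phi>" "\<phi> x = 1" "\<And>f. f \<in> F \<Longrightarrow> \<phi> f = 0"
proof -
  obtain B where B: "finite B" "\<And>x. \<exists>y\<in>F. x - y \<in> cvec.span B"
    using F(3) unfolding finite_ccodim_def by blast
  obtain G where G: "cvec.subspace G" "closed G" "F \<subseteq> G" "x \<notin> G" "B \<subseteq> add_line G x"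
    using complement_of_line[OF B(1) F(1,2,4)] by blast
  have sub: "cvec.subspace (add_line G x)" by (rule subspace_add_line[OF G(1)])
  have all: "y \<in> add_line G x" for y
  proof -
    obtain f where f: "f \<in> F" "y - f \<in> cvec.span B" using B by blast
    have "y - f \<in> add_line G x" using f cvec.span_minimal[OF G(5) sub] by blast
    moreover have "f \<in> add_line G x" using f G(3) add_line_superset by blast
    ultimately have "y - f + f \<in> add_line G x" using cvec.subspace_add[OF sub] by blast
    then show ?thesis by simp
  qed
  obtain \<delta> where d: "\<delta> > 0" "\<And>f c. f \<in> G \<Longrightarrow> \<delta> * cmod c \<le> norm (f + c *\<^sub>C x)"
    using add_line_bound[OF G(1,2,4)] by blast
  have uniq: "c = c'" if "f \<in> G" "f' \<in> G" "f + c *\<^sub>C x = f' + c' *\<^sub>C x" for f f' c c'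
  proof -
    have "f - f' + (c - c') *\<^sub>C x = 0"
      using that(3) by (simp add: cvec.scale_left_diff_distrib algebra_simps)
    then have "\<delta> * cmod (c - c') \<le> 0" using d(2)[of "f - f'" "c - c'"] that G(1) cvec.subspace_diff by force
    then show ?thesis using d(1) by (simp add: mult_le_0_iff)
  qed
  have "\<forall>y. \<exists>c. y - c *\<^sub>C x \<in> G"
  proof
    fix y
    obtain f c where "f \<in> G" "y = f + c *\<^sub>C x" using all[of y] by (auto simp: add_line_def)
    then show "\<exists>c. y - c *\<^sub>C x \<in> G" by (intro exI[of _ c]) simp
  qed
  then obtain \<phi> where \<phi>: "\<And>y. y - \<phi> y *\<^sub>C x \<in> G" by metis
  have eq: "\<phi> y = c" if "y - c *\<^sub>C x \<in> G" for y c
    using uniq[of "y - \<phi> y *\<^sub>C x" "y - c *\<^sub>C x" "\<phi> y" c] \<phi> that by simp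
  show thesis
  proof (rule that)
    show "cfunctional \<phi>"
      unfolding cfunctional_def
    proof (intro conjI allI exI)
      show "\<phi> (y + z) = \<phi> y + \<phi> z" for y z
        using cvec.subspace_add[OF G(1) \<phi>[of y] \<phi>[of z]]
        by (intro eq) (simp add: scaleC_add_left algebra_simps)
      show "\<phi> (c *\<^sub>C y) = c * \<phi> y" for c y
        using cvec.subspace_scale[OF G(1) \<phi>[of y], of c]
        by (intro eq) (simp add: cvec.scale_right_diff_distrib scaleC_scaleC)
      show "cmod (\<phi> y) \<le> inverse \<delta> * norm y" for y
        using d(2)[OF \<phi>[of y], of "\<phi> y"] d(1) by (simp add: field_simps)
    qed
    show "\<phi> x = 1" using G(1) by (intro eq) (simp add: scaleC_one cvec.subspace_0)
    show "\<phi> f = 0" if "f \<in> F" for f using that G(3) by (intro eq) auto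
  qed
qed

lemma finite_ccodim_mono: "finite_ccodim F \<Longrightarrow> F \<subseteq> G \<Longrightarrow> finite_ccodim G"
  unfolding finite_ccodim_def by (meson subsetD)

text \<open>\<open>G\<close> is \<open>F\<close> plus the span of a finite set, namely a basis of
  \<open>G \<inter> span B\<close>, where \<open>B\<close> spans modulo \<open>F\<close>. Adding
  finitely many lines keeps a closed subspace closed.\<close>

lemma closed_supspace:
  fixes F G :: "'a::complex_banach set"
  assumes F: "cvec.subspace F" "closed F" "finite_ccodim F" and G: "cvec.subspace G" "F \<subseteq> G"
  shows "closed G"
proof -
  have "x \<notin> closure G" if "x \<notin> G" for x
  proof -
    obtain B where B: "finite B" "\<And>x. \<exists>y\<in>F. x - y \<in> cvec.span B"
      using F(3) unfolding finite_ccodim_def by blast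
    define H where "H C = {f + b | f b. f \<in> F \<and> b \<in> cvec.span C}" for C
    have cl: "closed (H C)" if "finite C" for C
      using that
    proof induction
      case empty
      then show ?case using F(2) by (simp add: H_def)
    next
      case (insert c C)
      have "H (insert c C) = add_line (H C) c"
        unfolding H_def span_insert_add_line add_line_def by (force simp: add.assoc)
      moreover have "cvec.subspace (H C)" unfolding H_def by (rule subspace_add_span[OF F(1)])
      ultimately show ?case using closed_add_line insert by metis
    qed
    have "\<exists>C. finite C \<and> C \<subseteq> G \<and> G \<inter> cvec.span B' \<subseteq> cvec.span C" if "finite B'" for B'
    proof -
      obtain C where C: "C \<subseteq> G \<inter> cvec.span B'" "cvec.independent C" "G \<inter> cvec.span B' \<subseteq> cvec.span C"
        using cvec.maximal_independent_subset by blast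
      then show ?thesis using cvec.independent_span_bound[OF that C(2)] by blast
    qed
    then obtain C where C: "finite C" "C \<subseteq> G" "G \<inter> cvec.span B \<subseteq> cvec.span C" using B(1) by blast
    have "G = H C"
    proof
      show "H C \<subseteq> G"
        unfolding H_def using G cvec.subspace_add[OF G(1)] cvec.span_minimal[OF C(2) G(1)] by blast
      show "G \<subseteq> H C"
      proof
        fix g assume g: "g \<in> G"
        obtain f where f: "f \<in> F" "g - f \<in> cvec.span B" using B by blast
        have "g - f \<in> G" using g f G cvec.subspace_diff by blast
        then have "g - f \<in> cvec.span C" using f C by blast
        then show "g \<in> H C" unfolding H_def using f(1) by (intro CollectI exI[of _ f] exI[of _ "g - f"]) simp
      qed
    qed
    then show ?thesis using cl[OF C(1)] that by simp
  qed
  then show ?thesis using closure_subset_eq by blast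
qed

lemma finite_ccodim_dependent:
  fixes x :: "nat \<Rightarrow> 'a::complex_vector"
  assumes F: "cvec.subspace F" "finite_ccodim F"
  obtains n c where "\<exists>i\<le>n. c i \<noteq> (0::complex)" "(\<Sum>i\<le>n. c i *\<^sub>C x i) \<in> F"
proof -
  obtain B where B: "finite B" "\<And>x. \<exists>y\<in>F. x - y \<in> cvec.span B"
    using F(2) unfolding finite_ccodim_def by blast
  have "\<forall>i. \<exists>y. y \<in> F \<and> x i - y \<in> cvec.span B" using B(2) by blast
  then obtain y where y: "\<And>i. y i \<in> F" "\<And>i. x i - y i \<in> cvec.span B" by metis
  define b where "b i = x i - y i" for i
  \<comment> \<open>The indices up to \<open>card B\<close> are one more than \<open>B\<close> has
    elements. Dependence is a property of sets, so a repeated vector is treated separately below,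
    with coefficients 1 and -1.\<close>
  define n where "n = card B"
  have "\<exists>c. (\<exists>i\<le>n. c i \<noteq> 0) \<and> (\<Sum>i\<le>n. c i *\<^sub>C b i) = 0"
  proof (cases "inj_on b {..n}")
    case True
    have "cvec.dependent (b ` {..n})"
    proof (rule ccontr)
      assume "\<not> ?thesis"
      moreover have "b ` {..n} \<subseteq> cvec.span B" using y(2) by (auto simp: b_def)
      ultimately have "card (b ` {..n}) \<le> card B"
        using cvec.independent_span_bound[OF B(1)] by blast
      then show False using card_image[OF True] by (simp add: n_def)
    qed
    then obtain u where u: "\<exists>v\<in>b ` {..n}. u v \<noteq> 0" "(\<Sum>v\<in>b ` {..n}. u v *\<^sub>C v) = 0"
      using cvec.dependent_finite by blast
    show ?thesis
      using u by (intro exI[of _ "u \<circ> b"]) (auto simp: sum.reindex[OF True])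
  next
    case False
    then obtain i j where ij: "i \<le> n" "j \<le> n" "i \<noteq> j" "b i = b j" by (auto simp: inj_on_def)
    have "(\<Sum>k\<le>n. (if k = i then 1 else if k = j then - 1 else 0) *\<^sub>C b k)
        = (\<Sum>k\<in>{i,j}. (if k = i then 1 else if k = j then - 1 else 0) *\<^sub>C b k)"
      by (rule sum.mono_neutral_right) (use ij in auto)
    also have "\<dots> = 0" using ij by (simp add: scaleC_one)
    finally show ?thesis using ij(1) by (intro exI conjI) auto
  qed
  then obtain c where c: "\<exists>i\<le>n. c i \<noteq> 0" "(\<Sum>i\<le>n. c i *\<^sub>C b i) = 0" by blast
  have "(\<Sum>i\<le>n. c i *\<^sub>C x i) = (\<Sum>i\<le>n. c i *\<^sub>C b i) + (\<Sum>i\<le>n. c i *\<^sub>C y i)"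
    by (simp add: b_def cvec.scale_right_diff_distrib sum_subtractf)
  also have "\<dots> \<in> F" using c(2) y(1) F(1) by (simp add: cvec.subspace_sum cvec.subspace_scale)
  finally show thesis using c(1) that by blast
qed

text \<open>Bolzano-Weierstrass by induction on the spanning set: \<open>add_line_bound\<close>
  bounds the coefficient of the new vector, and a subsequence is taken for it and another one for
  the remainder.\<close>

lemma finite_cdim_subseq:
  fixes y :: "nat \<Rightarrow> 'a::complex_banach"
  assumes "finite B" "\<And>n. y n \<in> cvec.span B" "\<And>n. norm (y n) \<le> M"
  shows "\<exists>r l. strict_mono (r :: nat \<Rightarrow> nat) \<and> (y \<circ> r) \<longlonglongrightarrow> l"
  using assms
proof (induction arbitrary: y M)
  case empty
  then have "(y \<circ> id) \<longlonglongrightarrow> 0" by (simp add: o_def)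
  then show ?case using strict_mono_id by blast
next
  case (insert b B)
  show ?case
  proof (cases "b \<in> cvec.span B")
    case True
    then show ?thesis using insert.IH[OF _ insert.prems(2)] insert.prems(1) by (simp add: cvec.span_redundant)
  next
    case False
    obtain \<delta> where d: "\<delta> > 0" "\<And>f c. f \<in> cvec.span B \<Longrightarrow> \<delta> * cmod c \<le> norm (f + c *\<^sub>C b)"
      using add_line_bound[OF cvec.subspace_span closed_span_finite[OF insert(1)] False] by blast
    have "\<forall>n. \<exists>f c. f \<in> cvec.span B \<and> y n = f + c *\<^sub>C b"
      using insert.prems(1) unfolding span_insert_add_line add_line_def by blast
    then obtain f c where fc: "\<And>n. f n \<in> cvec.span B" "\<And>n. y n = f n + c n *\<^sub>C b" by metis
    have cb: "cmod (c n) \<le> M / \<delta>" for n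
    proof -
      have "\<delta> * cmod (c n) \<le> norm (y n)" unfolding fc(2)[of n] using d(2) fc(1) by blast
      also have "\<dots> \<le> M" by (rule insert.prems(2))
      finally show ?thesis using d(1) by (simp add: pos_le_divide_eq mult.commute)
    qed
    then have "bounded (range c)" by (intro boundedI[of _ "M / \<delta>"]) blast
    then obtain c0 r where r: "strict_mono (r::nat\<Rightarrow>nat)" "(c \<circ> r) \<longlonglongrightarrow> c0"
      using bounded_imp_convergent_subsequence by blast
    have "norm (f (r n)) \<le> M + M / \<delta> * norm b" for n
    proof -
      have "norm (f (r n)) \<le> norm (y (r n)) + norm (c (r n) *\<^sub>C b)"
        using norm_triangle_ineq4[of "y (r n)" "c (r n) *\<^sub>C b"] fc(2)[of "r n"] by simp
      also have "\<dots> \<le> M + M / \<delta> * norm b"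
        unfolding norm_scaleC by (intro add_mono insert.prems(2) mult_right_mono cb norm_ge_zero)
      finally show ?thesis .
    qed
    then have "\<exists>r' l. strict_mono (r' :: nat \<Rightarrow> nat) \<and> ((f \<circ> r) \<circ> r') \<longlonglongrightarrow> l"
      by (intro insert.IH[where M = "M + M / \<delta> * norm b"]) (simp_all add: fc(1))
    then obtain r' l where r': "strict_mono (r'::nat\<Rightarrow>nat)" "((f \<circ> r) \<circ> r') \<longlonglongrightarrow> l"
      by blast
    have "(\<lambda>n. f (r (r' n)) + c (r (r' n)) *\<^sub>C b) \<longlonglongrightarrow> l + c0 *\<^sub>C b"
      using r'(2) LIMSEQ_subseq_LIMSEQ[OF r(2) r'(1)]
      by (intro tendsto_add tendsto_scaleC tendsto_const) (simp_all add: o_def)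
    then have "(y \<circ> (r \<circ> r')) \<longlonglongrightarrow> l + c0 *\<^sub>C b" by (simp add: o_def fc(2))
    then show ?thesis using strict_mono_o[OF r(1) r'(1)] by blast
  qed
qed

text \<open>Take a vector of \<open>E\<close> outside \<open>F\<close>, subtract a point of
  \<open>F\<close> at less than twice its distance to \<open>F\<close>, and normalise. The factor
  two is the origin of 1/2.\<close>

lemma riesz_vector:
  fixes F :: "'a::complex_normed_vector set"
  assumes F: "cvec.subspace F" "closed F" and E: "cvec.subspace E" "F \<subset> E"
  obtains x where "x \<in> E" "norm x = 1" "\<And>f. f \<in> F \<Longrightarrow> 1/2 \<le> norm (x - f)"
proof -
  obtain a where a: "a \<in> E" "a \<notin> F" using E(2) by blast
  have ne: "F \<noteq> {}" using F(1) cvec.subspace_0 by blast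
  define \<delta> where "\<delta> = infdist a F"
  have d: "\<delta> > 0" using infdist_pos_not_in_closed[OF F(2) ne a(2)] by (simp add: \<delta>_def)
  have le: "\<delta> \<le> norm (a - f)" if "f \<in> F" for f
    using infdist_le[OF that, of a] by (simp add: \<delta>_def dist_norm)
  have "\<exists>f\<in>F. dist a f < 2 * \<delta>"
    using d infdist_attains_inf cInf_lessD[of "(dist a) ` F" "2 * \<delta>"] ne
    unfolding \<delta>_def infdist_def by auto
  then obtain g where g: "g \<in> F" "norm (a - g) < 2 * \<delta>" by (auto simp: dist_norm)
  define t where "t = norm (a - g)"
  have t: "t > 0" using le[OF g(1)] d unfolding t_def by linarith
  show thesis
  proof (rule that[of "inverse t *\<^sub>R (a - g)"])
    show "inverse t *\<^sub>R (a - g) \<in> E"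
      using a g E cvec_subspace_scaleR[OF E(1)] cvec.subspace_diff by (metis psubsetD)
    show "norm (inverse t *\<^sub>R (a - g)) = 1" using t by (simp add: t_def)
    fix f assume f: "f \<in> F"
    have "g + t *\<^sub>R f \<in> F" using f g F(1) cvec_subspace_scaleR cvec.subspace_add by blast
    then have "\<delta> \<le> norm (a - (g + t *\<^sub>R f))" by (rule le)
    also have "a - (g + t *\<^sub>R f) = t *\<^sub>R (inverse t *\<^sub>R (a - g) - f)"
      using t by (simp add: scaleR_diff_right)
    finally have "\<delta> \<le> t * norm (inverse t *\<^sub>R (a - g) - f)" using t by simp
    moreover have "t < 2 * \<delta>" using g(2) by (simp add: t_def)
    ultimately have "t * (1/2) < t * norm (inverse t *\<^sub>R (a - g) - f)" using d t by linarith
    then show "1/2 \<le> norm (inverse t *\<^sub>R (a - g) - f)" using t by simp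
  qed
qed

lemma cblinfuns_uminus [intro, simp]: "S \<in> cblinfuns \<Longrightarrow> - S \<in> cblinfuns"
  using cblinfuns_diff[of 0 S] by simp

lemma scaleC_two: "(2::complex) *\<^sub>C x = x + (x :: 'a::complex_vector)"
  using scaleC_add_left[of 1 1 x] by (simp add: scaleC_one)

section \<open>A seminorm version of the spectral radius formula\<close>

text \<open>The map taking \<open>x\<close> to \<open>U x + y\<close> is a contraction, so the
  inverse comes from the fixed point theorem instead of a power series, and its linearity from
  uniqueness.\<close>

lemma neumann:
  fixes U :: "'a::complex_banach \<Rightarrow>\<^sub>L 'a"
  assumes U: "U \<in> cblinfuns" "norm U < 1"
  obtains B where "B \<in> cblinfuns" "(id_blinfun - U) o\<^sub>L B = id_blinfun" "B o\<^sub>L (id_blinfun - U) = id_blinfun"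
proof -
  have ex: "\<exists>!x. U x + y = x" for y
  proof -
    have "dist (U a + y) (U b + y) \<le> norm U * dist a b" for a b
      using norm_blinfun[of U "a - b"] by (simp add: dist_norm blinfun.diff_right)
    then show ?thesis using banach_fix_type[of "norm U" "\<lambda>x. U x + y"] U(2) by simp
  qed
  then obtain f where f: "\<And>y. U (f y) + y = f y" by metis
  have uniq: "x = f y" if "U x + y = x" for x y using ex f that by blast
  have bound: "norm (f y) \<le> inverse (1 - norm U) * norm y" for y
  proof -
    have "norm (f y) \<le> norm (U (f y)) + norm y"
      using norm_triangle_ineq[of "U (f y)" y] f by simp
    also have "\<dots> \<le> norm U * norm (f y) + norm y" by (simp add: norm_blinfun)
    finally have "(1 - norm U) * norm (f y) \<le> norm y" by (simp add: algebra_simps)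
    then show ?thesis using U(2) by (simp add: field_simps)
  qed
  have "f y + f z = f (y + z)" for y z
  proof (rule uniq)
    have "U (f y + f z) + (y + z) = (U (f y) + y) + (U (f z) + z)" by (simp add: blinfun.add_right)
    then show "U (f y + f z) + (y + z) = f y + f z" by (simp only: f)
  qed
  moreover have "c *\<^sub>C f y = f (c *\<^sub>C y)" for c y
  proof (rule uniq)
    have "U (c *\<^sub>C f y) + c *\<^sub>C y = c *\<^sub>C (U (f y) + y)"
      using U(1) by (simp add: cblinfuns_scaleC scaleC_add_right)
    then show "U (c *\<^sub>C f y) + c *\<^sub>C y = c *\<^sub>C f y" by (simp only: f)
  qed
  ultimately obtain B where B: "B \<in> cblinfuns" "blinfun_apply B = f"
    using cblinfun_exists[of f "inverse (1 - norm U)"] bound by metis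
  have "f (x - U x) = x" for x by (rule uniq[symmetric]) simp
  moreover have "f x - U (f x) = x" for x using f[of x] by (simp add: algebra_simps)
  ultimately show thesis
    by (intro that[OF B(1)] blinfun_eqI) (simp_all add: B(2) blinfun.diff_left)
qed

text \<open>The spectral radius formula is applied to two gauges, the operator norm and the norm
  modulo finite rank. The operators with \<open>p U = 0\<close> form an ideal, and the argument
  takes place in the quotient without forming or completing it.\<close>

locale op_seminorm =
  fixes p :: "('a::complex_normed_vector \<Rightarrow>\<^sub>L 'a) \<Rightarrow> real"
  assumes nonneg: "U \<in> cblinfuns \<Longrightarrow> 0 \<le> p U"
    and triangle: "U \<in> cblinfuns \<Longrightarrow> V \<in> cblinfuns \<Longrightarrow> p (U + V) \<le> p U + p V"
    and submult: "U \<in> cblinfuns \<Longrightarrow> V \<in> cblinfuns \<Longrightarrow> p (U o\<^sub>L V) \<le> p U * p V"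
    and scale_le: "U \<in> cblinfuns \<Longrightarrow> p (c *\<^sub>C U) \<le> cmod c * p U"
    and id_le: "p id_blinfun \<le> 1"
begin

lemma scale: "U \<in> cblinfuns \<Longrightarrow> p (c *\<^sub>C U) = cmod c * p U"
proof (cases "c = 0")
  case True
  assume "U \<in> cblinfuns"
  with scale_le[of U 0] nonneg[of "0 *\<^sub>C U"] True show ?thesis by simp
next
  case False
  assume U: "U \<in> cblinfuns"
  have "p (inverse c *\<^sub>C c *\<^sub>C U) \<le> cmod (inverse c) * p (c *\<^sub>C U)"
    using U by (intro scale_le) auto
  then have "p U \<le> p (c *\<^sub>C U) / cmod c"
    using False by (simp add: scaleC_scaleC scaleC_one norm_inverse norm_divide field_simps)
  then show ?thesis using scale_le[OF U, of c] False by (simp add: field_simps)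
qed

lemma triangle_diff: "U \<in> cblinfuns \<Longrightarrow> V \<in> cblinfuns \<Longrightarrow> p (U - V) \<le> p U + p V"
  using triangle[of U "- 1 *\<^sub>C V"] scale[of V "-1"] by (simp add: scaleC_one cblinfuns_scale)

lemma null_comp_left: "U \<in> cblinfuns \<Longrightarrow> V \<in> cblinfuns \<Longrightarrow> p V = 0 \<Longrightarrow> p (U o\<^sub>L V) = 0"
  using submult[of U V] nonneg[of "U o\<^sub>L V"] by (simp add: cblinfuns_comp)

lemma null_comp_right: "U \<in> cblinfuns \<Longrightarrow> V \<in> cblinfuns \<Longrightarrow> p U = 0 \<Longrightarrow> p (U o\<^sub>L V) = 0"
  using submult[of U V] nonneg[of "U o\<^sub>L V"] by (simp add: cblinfuns_comp)

text \<open>\<open>b\<close> represents an inverse of \<open>1 - z s\<close> in the quotient by the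
  null ideal of \<open>p\<close>; for the operator norm it is an actual inverse.\<close>

definition inv_mod :: "('a \<Rightarrow>\<^sub>L 'a) \<Rightarrow> complex \<Rightarrow> ('a \<Rightarrow>\<^sub>L 'a) \<Rightarrow> bool" where
  "inv_mod s z b \<longleftrightarrow> b \<in> cblinfuns \<and> p (((id_blinfun - z *\<^sub>C s) o\<^sub>L b) - id_blinfun) = 0 \<and>
     p ((b o\<^sub>L (id_blinfun - z *\<^sub>C s)) - id_blinfun) = 0"

text \<open>This is the resolvent identity \<open>b - c = (z - w) b s c\<close>, with error terms
  \<open>?n1\<close> and \<open>?n2\<close> in the null ideal.\<close>

lemma inv_mod_diff:
  assumes s: "s \<in> cblinfuns" and b: "inv_mod s z b" and c: "inv_mod s w c"
  shows "p (b - c) \<le> cmod (z - w) * p s * p b * p c"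
proof -
  have bc: "b \<in> cblinfuns" "c \<in> cblinfuns" using b c by (auto simp: inv_mod_def)
  let ?n1 = "b o\<^sub>L (((id_blinfun - w *\<^sub>C s) o\<^sub>L c) - id_blinfun)"
  let ?n2 = "((b o\<^sub>L (id_blinfun - z *\<^sub>C s)) - id_blinfun) o\<^sub>L c"
  let ?m = "(z - w) *\<^sub>C (b o\<^sub>L s o\<^sub>L c)"
  have cb: "?n1 \<in> cblinfuns" "?n2 \<in> cblinfuns" "?m \<in> cblinfuns" "b o\<^sub>L s \<in> cblinfuns"
    using s bc by auto
  have n1: "p ?n1 = 0" using c s bc unfolding inv_mod_def by (intro null_comp_left) auto
  have n2: "p ?n2 = 0" using b s bc unfolding inv_mod_def by (intro null_comp_right) auto
  have "b - c = (?m - ?n1) + ?n2"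
    by (rule blinfun_eqI)
      (simp add: blinfun.bilinear_simps cblinfuns_scaleC[OF bc(1)] cvec.scale_left_diff_distrib)
  then have "p (b - c) = p ((?m - ?n1) + ?n2)" by (rule arg_cong)
  also have "\<dots> \<le> p (?m - ?n1) + p ?n2" using cb by (intro triangle) auto
  also have "\<dots> \<le> p ?m" using triangle_diff[OF cb(3,1)] n1 n2 by simp
  also have "\<dots> = cmod (z - w) * p (b o\<^sub>L s o\<^sub>L c)" using cb bc by (intro scale) auto
  also have "\<dots> \<le> cmod (z - w) * (p b * p s * p c)"
    using submult[OF cb(4) bc(2)] submult[OF bc(1) s] nonneg[OF bc(2)]
    by (intro mult_left_mono) (auto intro: order_trans[OF _ mult_right_mono])
  finally show ?thesis by (simp add: mult_ac)
qed

text \<open>Near a centre \<open>z\<close> the resolvent identity compares every inverse with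
  \<open>b z\<close>, and by compactness finitely many centres serve the whole disc.\<close>

lemma inv_mod_bounded:
  assumes s: "s \<in> cblinfuns" and ex: "\<And>z. cmod z \<le> r \<Longrightarrow> \<exists>b. inv_mod s z b"
  obtains M where "M \<ge> 0" "\<And>z b. cmod z \<le> r \<Longrightarrow> inv_mod s z b \<Longrightarrow> p b \<le> M"
proof -
  obtain b where b: "\<And>z. cmod z \<le> r \<Longrightarrow> inv_mod s z (b z)" using ex by metis
  have bc: "b z \<in> cblinfuns" if "cmod z \<le> r" for z using b[OF that] by (simp add: inv_mod_def)
  \<comment> \<open>With this radius \<open>e z * (p s * p (b z))\<close> is at most 1/2, so the
    difference from \<open>b z\<close> can be absorbed, giving
    \<open>p c \<le> 2 * p (b z)\<close>.\<close>
  define e where "e z = inverse (2 * (p s * p (b z) + 1))" for z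
  have sb: "0 \<le> p s * p (b z)" if "cmod z \<le> r" for z using nonneg[OF s] nonneg[OF bc[OF that]] by simp
  have e: "e z > 0" if "cmod z \<le> r" for z
    using sb[OF that] by (auto simp: e_def intro!: mult_pos_pos)
  have "cball 0 r \<subseteq> (\<Union>z\<in>cball 0 r. ball z (e z))" using e by auto
  then obtain C where C: "C \<subseteq> cball 0 r" "finite C" "cball 0 r \<subseteq> (\<Union>z\<in>C. ball z (e z))"
    using compactE_image[OF compact_cball[of "0::complex" r], of "cball 0 r" "\<lambda>z. ball z (e z)"] by auto
  have nn: "0 \<le> 2 * p (b z)" if "z \<in> C" for z using bc C(1) that nonneg by auto
  show thesis
  proof (rule that[of "\<Sum>z\<in>C. 2 * p (b z)"])
    show "0 \<le> (\<Sum>z\<in>C. 2 * p (b z))" by (rule sum_nonneg) (rule nn)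
    fix w c assume w: "cmod w \<le> r" and c: "inv_mod s w c"
    have cc: "c \<in> cblinfuns" using c by (simp add: inv_mod_def)
    obtain z where z: "z \<in> C" "dist z w < e z" using C(3) w by (auto simp: subset_iff)
    have zr: "cmod z \<le> r" using z C(1) by auto
    have "p (b z - c) \<le> cmod (z - w) * (p s * p (b z)) * p c"
      using inv_mod_diff[OF s b[OF zr] c] by (simp add: mult_ac)
    also have "\<dots> \<le> e z * (p s * p (b z)) * p c"
      using z(2) sb[OF zr] nonneg[OF cc] by (intro mult_right_mono) (auto simp: dist_norm)
    also have "\<dots> \<le> 1/2 * p c"
      using sb[OF zr] nonneg[OF cc] by (intro mult_right_mono) (auto simp: e_def field_simps)
    finally have "p (b z - c) \<le> 1/2 * p c" .
    moreover have "p c \<le> p (b z) + p (b z - c)"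
      using triangle_diff[of "b z" "b z - c"] bc[OF zr] cc by (simp add: cblinfuns_diff)
    ultimately have "p c \<le> 2 * p (b z)" by linarith
    also have "\<dots> \<le> (\<Sum>z\<in>C. 2 * p (b z))" using z(1) C(2) nn by (intro member_le_sum) auto
    finally show "p c \<le> (\<Sum>z\<in>C. 2 * p (b z))" .
  qed
qed

text \<open>Partial fractions: the inverse of
  \<open>1 - z\<^sup>2 s\<^sup>2 = (1 - z s) (1 + z s)\<close> is the mean of the inverses of the
  two factors.\<close>

lemma inv_mod_square:
  assumes s: "s \<in> cblinfuns" and b: "inv_mod s z b" and c: "inv_mod s (- z) c"
  shows "inv_mod (s o\<^sub>L s) (z\<^sup>2) ((1/2) *\<^sub>C (b + c))"
proof -
  have bc: "b \<in> cblinfuns" "c \<in> cblinfuns" using b c by (auto simp: inv_mod_def)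
  let ?A = "id_blinfun - z *\<^sub>C s" and ?B = "id_blinfun + z *\<^sub>C s"
  have AB: "?A \<in> cblinfuns" "?B \<in> cblinfuns" using s by auto
  let ?m1 = "?B o\<^sub>L ((?A o\<^sub>L b) - id_blinfun)" and ?m2 = "?A o\<^sub>L ((?B o\<^sub>L c) - id_blinfun)"
  let ?n1 = "((b o\<^sub>L ?A) - id_blinfun) o\<^sub>L ?B" and ?n2 = "((c o\<^sub>L ?B) - id_blinfun) o\<^sub>L ?A"
  have cb: "?m1 \<in> cblinfuns" "?m2 \<in> cblinfuns" "?n1 \<in> cblinfuns" "?n2 \<in> cblinfuns"
    using s bc AB by auto
  have "p ?m1 = 0" "p ?m2 = 0"
    using b c s bc AB unfolding inv_mod_def
    by (auto intro!: null_comp_left)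
  moreover have "p ?n1 = 0" "p ?n2 = 0"
    using b c s bc AB unfolding inv_mod_def
    by (auto intro!: null_comp_right)
  ultimately have mn: "p (?m1 + ?m2) = 0" "p (?n1 + ?n2) = 0"
    using triangle[OF cb(1,2)] triangle[OF cb(3,4)] nonneg[of "?m1 + ?m2"] nonneg[of "?n1 + ?n2"] cb
    by simp_all
  define b1 c1 where bc1: "b1 = (1/2) *\<^sub>C b" "c1 = (1/2) *\<^sub>C c"
  have half: "b = b1 + b1" "c = c1 + c1"
    by (simp_all add: bc1 scaleC_add_left[symmetric] scaleC_one)
  have bc1_in: "b1 \<in> cblinfuns" "c1 \<in> cblinfuns" using bc by (auto simp: bc1)
  define E1 where "E1 = ((id_blinfun - z\<^sup>2 *\<^sub>C (s o\<^sub>L s)) o\<^sub>L (b1 + c1)) - id_blinfun"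
  define E2 where "E2 = ((b1 + c1) o\<^sub>L (id_blinfun - z\<^sup>2 *\<^sub>C (s o\<^sub>L s))) - id_blinfun"
  have E: "E1 \<in> cblinfuns" "E2 \<in> cblinfuns" using bc1_in s by (auto simp: E1_def E2_def)
  have "2 *\<^sub>C E1 = ?m1 + ?m2"
    unfolding E1_def half
    by (rule blinfun_eqI)
      (simp add: blinfun.bilinear_simps cblinfuns_scaleC[OF s] cblinfuns_scaleC[OF bc1_in(1)]
        cblinfuns_scaleC[OF bc1_in(2)] scaleC_scaleC scaleC_two power2_eq_square
        scaleC_add_right cvec.scale_right_diff_distrib)
  moreover have "2 *\<^sub>C E2 = ?n1 + ?n2"
    unfolding E2_def half
    by (rule blinfun_eqI)
      (simp add: blinfun.bilinear_simps cblinfuns_scaleC[OF s] cblinfuns_scaleC[OF bc1_in(1)]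
        cblinfuns_scaleC[OF bc1_in(2)] scaleC_scaleC scaleC_two power2_eq_square
        scaleC_add_right cvec.scale_right_diff_distrib)
  ultimately have "p E1 = 0" "p E2 = 0"
    using scale[OF E(1), of 2] scale[OF E(2), of 2] mn by simp_all
  moreover have "(1/2) *\<^sub>C (b + c) = b1 + c1" by (simp add: bc1 scaleC_add_right)
  ultimately show ?thesis
    unfolding inv_mod_def E1_def E2_def using bc1_in by simp
qed

text \<open>For the exponents \<open>2 ^ m\<close> an average over all roots of unity is a repeated
  average over two signs, so partial fractions with two terms suffice.\<close>

primrec iter_sq :: "('a \<Rightarrow>\<^sub>L 'a) \<Rightarrow> nat \<Rightarrow> 'a \<Rightarrow>\<^sub>L 'a" where
  "iter_sq s 0 = s"
| "iter_sq s (Suc m) = iter_sq s m o\<^sub>L iter_sq s m"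

lemma iter_sq_cblinfuns: "s \<in> cblinfuns \<Longrightarrow> iter_sq s m \<in> cblinfuns"
  by (induction m) auto

lemma iter_sq_apply: "blinfun_apply (iter_sq s m) = (blinfun_apply s ^^ (2 ^ m))"
  by (induction m) (auto simp: fun_eq_iff funpow_add mult_2)

text \<open>Averaging does not increase the distance between the inverses at two radii, so
  \<open>e\<close> is the same for all \<open>m\<close>. A point \<open>u\<close> of the unit circle
  is reached from its two square roots.\<close>

lemma inv_mod_pair_iter_sq:
  assumes s: "s \<in> cblinfuns"
    and pair: "\<And>u. cmod u = 1 \<Longrightarrow>
      \<exists>b c. inv_mod s (of_real r1 * u) b \<and> inv_mod s (of_real r2 * u) c \<and> p (b - c) \<le> e"
  shows "cmod u = 1 \<Longrightarrow> \<exists>b c. inv_mod (iter_sq s m) (of_real (r1 ^ 2 ^ m) * u) b \<and>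
      inv_mod (iter_sq s m) (of_real (r2 ^ 2 ^ m) * u) c \<and> p (b - c) \<le> e"
proof (induction m arbitrary: u)
  case 0
  then show ?case using pair by simp
next
  case (Suc m)
  let ?s = "iter_sq s m" and ?v = "csqrt u"
  have sc: "?s \<in> cblinfuns" by (rule iter_sq_cblinfuns[OF s])
  have sq: "of_real (r ^ 2 ^ Suc m) * u = (of_real (r ^ 2 ^ m) * ?v)\<^sup>2" for r :: real
    by (simp add: power_mult_distrib power_mult[symmetric] mult.commute)
  have "cmod (?v\<^sup>2) = 1" using Suc.prems by simp
  then have v: "cmod ?v = 1" by (simp add: norm_power power2_eq_1_iff)
  then obtain b c where bc: "inv_mod ?s (of_real (r1 ^ 2 ^ m) * ?v) b"
      "inv_mod ?s (of_real (r2 ^ 2 ^ m) * ?v) c" "p (b - c) \<le> e"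
    using Suc.IH by blast
  obtain b' c' where bc': "inv_mod ?s (of_real (r1 ^ 2 ^ m) * - ?v) b'"
      "inv_mod ?s (of_real (r2 ^ 2 ^ m) * - ?v) c'" "p (b' - c') \<le> e"
    using Suc.IH[of "- ?v"] v by auto
  have cb: "b \<in> cblinfuns" "c \<in> cblinfuns" "b' \<in> cblinfuns" "c' \<in> cblinfuns"
    using bc bc' by (auto simp: inv_mod_def)
  have "p ((1/2) *\<^sub>C (b + b') - (1/2) *\<^sub>C (c + c')) = p ((1/2) *\<^sub>C ((b - c) + (b' - c')))"
    by (simp add: cvec.scale_right_diff_distrib[symmetric] algebra_simps)
  also have "\<dots> = 1/2 * p ((b - c) + (b' - c'))"
    using cb by (subst scale) (auto intro!: cblinfuns_add cblinfuns_diff)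
  also have "\<dots> \<le> e" using triangle[of "b - c" "b' - c'"] cb bc(3) bc'(3) by (simp add: cblinfuns_diff)
  finally have "p ((1/2) *\<^sub>C (b + b') - (1/2) *\<^sub>C (c + c')) \<le> e" .
  moreover have "inv_mod (iter_sq s (Suc m)) (of_real (r1 ^ 2 ^ Suc m) * u) ((1/2) *\<^sub>C (b + b'))"
    using inv_mod_square[OF sc bc(1)] bc'(1) unfolding sq by simp
  moreover have "inv_mod (iter_sq s (Suc m)) (of_real (r2 ^ 2 ^ Suc m) * u) ((1/2) *\<^sub>C (c + c'))"
    using inv_mod_square[OF sc bc(2)] bc'(2) unfolding sq by simp
  ultimately show ?case by blast
qed

text \<open>Smallness of \<open>t x\<close> puts \<open>b\<close> within 1/3 of the identity, hence
  \<open>c\<close> within 1/3 + 1/2 = 5/6. Then \<open>1 - t' x\<close> has seminorm at most 6 and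
  \<open>t' x\<close> at most 7. So smallness at \<open>t\<close> yields at \<open>t'\<close> a
  bound that is independent of \<open>x\<close>.\<close>

lemma inv_mod_close:
  assumes x: "x \<in> cblinfuns" and b: "inv_mod x t b" and c: "inv_mod x t' c"
    and close: "p (b - c) \<le> 1/2" and small: "cmod t * p x \<le> 1/4"
  shows "cmod t' * p x \<le> 7"
proof -
  have cb: "b \<in> cblinfuns" "c \<in> cblinfuns" using b c by (auto simp: inv_mod_def)
  let ?n = "((id_blinfun - t *\<^sub>C x) o\<^sub>L b) - id_blinfun"
  have "b - id_blinfun = ((t *\<^sub>C x) o\<^sub>L b) + ?n"
    by (rule blinfun_eqI) (simp add: blinfun.bilinear_simps)
  then have "p (b - id_blinfun) = p (((t *\<^sub>C x) o\<^sub>L b) + ?n)" by (rule arg_cong)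
  also have "\<dots> \<le> p ((t *\<^sub>C x) o\<^sub>L b) + p ?n" using x cb by (intro triangle) auto
  also have "\<dots> \<le> (cmod t * p x) * p b"
    using submult[of "t *\<^sub>C x" b] x cb b by (simp add: inv_mod_def scale cblinfuns_scale)
  also have "\<dots> \<le> 1/4 * p b" using small nonneg[OF cb(1)] by (rule mult_right_mono)
  also have "\<dots> \<le> 1/4 * (p (b - id_blinfun) + 1)"
    using triangle[of "b - id_blinfun" id_blinfun] cb id_le by (simp add: cblinfuns_diff)
  finally have b1: "p (b - id_blinfun) \<le> 1/3" by simp
  have "p (id_blinfun - c) = p ((b - c) - (b - id_blinfun))" by simp
  also have "\<dots> \<le> p (b - c) + p (b - id_blinfun)" using cb by (intro triangle_diff) auto
  finally have c1: "p (id_blinfun - c) \<le> 5/6" using b1 close by simp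
  define y where "y = id_blinfun - t' *\<^sub>C x"
  have y: "y \<in> cblinfuns" using x by (auto simp: y_def)
  let ?m = "(y o\<^sub>L c) - id_blinfun" and ?l = "y o\<^sub>L (id_blinfun - c)"
  have "y = (id_blinfun + ?l) + ?m"
    by (rule blinfun_eqI) (simp add: blinfun.bilinear_simps)
  then have "p y = p ((id_blinfun + ?l) + ?m)" by (rule arg_cong)
  also have "\<dots> \<le> p (id_blinfun + ?l) + p ?m" using y cb by (intro triangle) auto
  also have "\<dots> \<le> (1 + p y * p (id_blinfun - c)) + 0"
  proof (rule add_mono)
    have "p (id_blinfun + ?l) \<le> p id_blinfun + p ?l" using y cb by (intro triangle) auto
    also have "\<dots> \<le> 1 + p y * p (id_blinfun - c)" using y cb by (intro add_mono id_le submult) auto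
    finally show "p (id_blinfun + ?l) \<le> 1 + p y * p (id_blinfun - c)" .
    show "p ?m \<le> 0" using c by (simp add: inv_mod_def y_def)
  qed
  also have "\<dots> \<le> (1 + p y * (5/6)) + 0"
    using c1 nonneg[OF y] by (intro add_mono mult_left_mono) auto
  finally have "p y \<le> 6" by simp
  moreover have "p (t' *\<^sub>C x) \<le> p id_blinfun + p y"
    using triangle_diff[of id_blinfun y] y by (simp add: y_def)
  ultimately show ?thesis using id_le x by (simp add: scale)
qed

text \<open>The set of radii \<open>\<rho>\<close> for which the conclusion holds grows by steps of a fixed length, because
  the inverses of \<open>1 - (\<rho> s)\<^sup>k\<close> are averages of inverses of \<open>1 - \<omega> \<rho> s\<close> and hence depend on
  \<open>\<rho>\<close> uniformly in \<open>k\<close>.\<close>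

theorem spectral_radius_formula:
  assumes s: "s \<in> cblinfuns" and ex: "\<And>z. cmod z \<le> r \<Longrightarrow> \<exists>b. inv_mod s z b"
    and \<rho>: "0 \<le> \<rho>" "\<rho> < r"
  shows "(\<lambda>m. \<rho> ^ 2 ^ m * p (iter_sq s m)) \<longlonglongrightarrow> 0"
proof -
  define G where "G \<rho> \<longleftrightarrow> (\<lambda>m. \<rho> ^ 2 ^ m * p (iter_sq s m)) \<longlonglongrightarrow> 0" for \<rho>
  obtain M where M: "M \<ge> 0" "\<And>z b. cmod z \<le> r \<Longrightarrow> inv_mod s z b \<Longrightarrow> p b \<le> M"
    using inv_mod_bounded[OF s ex] by blast
  \<comment> \<open>Inverses at radii that differ by at most \<open>\<delta>\<close>, in a common
    direction \<open>u\<close>, are at distance at most \<open>\<delta> * p s * M * M\<close>, which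
    is at most 1/2.\<close>
  define \<delta> where "\<delta> = inverse (2 * (p s * M * M + 1))"
  have sM: "0 \<le> p s * M * M" using nonneg[OF s] M(1) by simp
  then have \<delta>: "\<delta> > 0" "\<delta> * (p s * M * M) \<le> 1/2" by (auto simp: \<delta>_def field_simps intro!: mult_pos_pos)
  have step: "G \<rho>" if h: "0 \<le> \<rho>1" "\<rho>1 \<le> \<rho>2" "\<rho>2 \<le> r" "\<rho>2 \<le> \<rho>1 + \<delta>" "G \<rho>1" "0 \<le> \<rho>" "\<rho> < \<rho>2" for \<rho>1 \<rho>2 \<rho>
  proof -
    have pair: "\<exists>b c. inv_mod s (of_real \<rho>1 * u) b \<and> inv_mod s (of_real \<rho>2 * u) c \<and> p (b - c) \<le> 1/2"
      if u: "cmod u = 1" for u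
    proof -
      have le: "cmod (of_real \<rho>1 * u) \<le> r" "cmod (of_real \<rho>2 * u) \<le> r" using h u by (auto simp: norm_mult)
      then obtain b c where bc: "inv_mod s (of_real \<rho>1 * u) b" "inv_mod s (of_real \<rho>2 * u) c"
        using ex by blast
      have cb: "b \<in> cblinfuns" "c \<in> cblinfuns" using bc by (auto simp: inv_mod_def)
      have "cmod (of_real \<rho>1 * u - of_real \<rho>2 * u) = cmod (of_real (\<rho>1 - \<rho>2) * u)"
        by (simp add: left_diff_distrib)
      also have "\<dots> \<le> \<delta>" using h u by (simp add: norm_mult del: of_real_diff)
      finally have d: "cmod (of_real \<rho>1 * u - of_real \<rho>2 * u) \<le> \<delta>" .
      have "p (b - c) \<le> cmod (of_real \<rho>1 * u - of_real \<rho>2 * u) * p s * p b * p c"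
        by (rule inv_mod_diff[OF s bc])
      also have "\<dots> \<le> \<delta> * p s * M * M"
        using d M(2)[OF le(1) bc(1)] M(2)[OF le(2) bc(2)] M(1) nonneg s cb \<delta>(1)
        by (intro mult_mono) auto
      also have "\<dots> \<le> 1/2" using \<delta>(2) by (simp add: mult.assoc)
      finally show ?thesis using bc by blast
    qed
    have "\<forall>\<^sub>F m in sequentially. \<rho>1 ^ 2 ^ m * p (iter_sq s m) < 1/4"
      using h(5) unfolding G_def by (rule order_tendstoD) simp
    then have "\<forall>\<^sub>F m in sequentially. \<rho>2 ^ 2 ^ m * p (iter_sq s m) \<le> 7"
    proof eventually_elim
      case (elim m)
      obtain b c where bc: "inv_mod (iter_sq s m) (of_real (\<rho>1 ^ 2 ^ m)) b"
          "inv_mod (iter_sq s m) (of_real (\<rho>2 ^ 2 ^ m)) c" "p (b - c) \<le> 1/2"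
        using inv_mod_pair_iter_sq[OF s pair, of 1 m] by (metis mult.right_neutral norm_one)
      have "cmod (of_real (\<rho>1 ^ 2 ^ m)) = \<rho>1 ^ 2 ^ m" "cmod (of_real (\<rho>2 ^ 2 ^ m)) = \<rho>2 ^ 2 ^ m"
        using h(1,2) by (simp_all add: norm_power)
      then show ?case
        using inv_mod_close[OF iter_sq_cblinfuns[OF s] bc] elim by simp
    qed
    \<comment> \<open>A bound at \<open>\<rho>2\<close> becomes decay at a smaller
      \<open>\<rho>\<close>, because the quotient of the powers is
      \<open>(\<rho> / \<rho>2) ^ 2 ^ m\<close>.\<close>
    then have ev: "\<forall>\<^sub>F m in sequentially. \<rho> ^ 2 ^ m * p (iter_sq s m) \<le> 7 * (\<rho> / \<rho>2) ^ m"
    proof eventually_elim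
      case (elim m)
      have "\<rho> ^ 2 ^ m * p (iter_sq s m) = (\<rho> / \<rho>2) ^ 2 ^ m * (\<rho>2 ^ 2 ^ m * p (iter_sq s m))"
        using h by (simp add: power_divide)
      also have "\<dots> \<le> (\<rho> / \<rho>2) ^ 2 ^ m * 7" using elim h by (intro mult_left_mono) auto
      also have "\<dots> \<le> (\<rho> / \<rho>2) ^ m * 7"
        using h by (intro mult_right_mono power_decreasing less_imp_le[OF less_exp]) auto
      finally show ?case by simp
    qed
    have "(\<lambda>m. 7 * (\<rho> / \<rho>2) ^ m) \<longlonglongrightarrow> 7 * 0"
      using h by (intro tendsto_mult tendsto_const LIMSEQ_power_zero) auto
    then show ?thesis
      unfolding G_def
      by (intro tendsto_sandwich[OF _ ev tendsto_const])
        (use h nonneg[OF iter_sq_cblinfuns[OF s]] in auto)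
  qed
  have G: "\<rho> \<le> of_nat j * (\<delta> / 2) \<Longrightarrow> 0 \<le> \<rho> \<Longrightarrow> \<rho> < r \<Longrightarrow> G \<rho>" for j :: nat and \<rho>
  proof (induction j arbitrary: \<rho>)
    case 0
    then show ?case by (simp add: G_def power_0_left)
  next
    case (Suc j)
    \<comment> \<open>A step concludes only strictly below its right end, so \<open>b\<close> has to
      exceed \<open>\<rho>\<close>; going \<open>\<delta> / 2\<close> to either side keeps
      \<open>b - a \<le> \<delta>\<close>.\<close>
    define a b where "a = max 0 (\<rho> - \<delta> / 2)" and "b = min r (\<rho> + \<delta> / 2)"
    have "\<rho> \<le> of_nat j * (\<delta> / 2) + \<delta> / 2"
      using Suc.prems(1) by (simp add: distrib_right)
    moreover have "0 \<le> of_nat j * (\<delta> / 2)" using \<delta>(1) by simp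
    ultimately have "a \<le> of_nat j * (\<delta> / 2)" unfolding a_def by linarith
    moreover have a: "0 \<le> a" "a < r" "\<rho> - \<delta> / 2 \<le> a" "a \<le> \<rho>"
      using Suc.prems \<delta>(1) unfolding a_def by linarith+
    ultimately have "G a" by (intro Suc.IH)
    moreover have "\<rho> < b" "b \<le> r" "b \<le> \<rho> + \<delta> / 2"
      using Suc.prems \<delta>(1) unfolding b_def by linarith+
    ultimately show ?case using a Suc.prems by (intro step[of a b \<rho>]) linarith+
  qed
  obtain j :: nat where "\<rho> / (\<delta> / 2) \<le> of_nat j" using real_arch_simple by blast
  then have "\<rho> \<le> of_nat j * (\<delta> / 2)" using \<delta>(1) by (simp add: field_simps)
  then show ?thesis using G \<rho> unfolding G_def by blast
qed

end

lemma op_seminorm_norm: "op_seminorm (norm :: ('a::complex_normed_vector \<Rightarrow>\<^sub>L 'a) \<Rightarrow> real)"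
proof
  show "norm (id_blinfun :: 'a \<Rightarrow>\<^sub>L 'a) \<le> 1" by (rule norm_blinfun_id_le)
qed (simp_all add: norm_scaleC norm_blinfun_compose norm_triangle_ineq)

section \<open>Operators of finite rank and the essential seminorm\<close>

lemma finite_cdim_subset: "finite_cdim N \<Longrightarrow> M \<subseteq> N \<Longrightarrow> finite_cdim M"
  unfolding finite_cdim_def by blast

lemma finite_cdim_image:
  assumes "S \<in> cblinfuns" "finite_cdim M" shows "finite_cdim (blinfun_apply S ` M)"
proof -
  obtain B where "finite B" "M \<subseteq> cvec.span B" using assms(2) unfolding finite_cdim_def by blast
  then show ?thesis
    unfolding finite_cdim_def using cblinfun_span[OF assms(1)]
    by (intro exI[of _ "blinfun_apply S ` B"]) auto
qed

lemma finite_cdim_sums: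
  assumes "finite_cdim M" "finite_cdim N" shows "finite_cdim {x + y | x y. x \<in> M \<and> y \<in> N}"
proof -
  obtain B C where BC: "finite B" "M \<subseteq> cvec.span B" "finite C" "N \<subseteq> cvec.span C"
    using assms unfolding finite_cdim_def by blast
  have "cvec.span B \<subseteq> cvec.span (B \<union> C)" "cvec.span C \<subseteq> cvec.span (B \<union> C)"
    by (simp_all add: cvec.span_mono)
  then have "{x + y | x y. x \<in> M \<and> y \<in> N} \<subseteq> cvec.span (B \<union> C)"
    using BC by (auto intro!: cvec.span_add)
  then show ?thesis unfolding finite_cdim_def using BC by blast
qed

definition finite_rank :: "('a::complex_normed_vector \<Rightarrow>\<^sub>L 'a) \<Rightarrow> bool" where
  "finite_rank K \<longleftrightarrow> K \<in> cblinfuns \<and> finite_cdim (range (blinfun_apply K))"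

lemma finite_rankI:
  assumes "K \<in> cblinfuns" "finite_cdim M" "finite_cdim N"
    and "\<And>x. \<exists>m\<in>M. \<exists>n\<in>N. blinfun_apply K x = m + n"
  shows "finite_rank K"
proof -
  have "range (blinfun_apply K) \<subseteq> {m + n | m n. m \<in> M \<and> n \<in> N}"
    using assms(4) by (force simp: image_subset_iff)
  then show ?thesis
    using assms(1) finite_cdim_subset[OF finite_cdim_sums[OF assms(2,3)]] by (simp add: finite_rank_def)
qed

lemma finite_rank_zero: "finite_rank 0"
proof -
  have "finite_cdim {0 :: 'a}"
    unfolding finite_cdim_def by (intro exI[of _ "{}"]) simp
  then show ?thesis by (simp add: finite_rank_def image_constant_conv)
qed

lemma finite_rank_add:
  assumes "finite_rank K" "finite_rank L" shows "finite_rank (K + L)"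
proof (rule finite_rankI)
  show "finite_cdim (range (blinfun_apply K))" "finite_cdim (range (blinfun_apply L))"
    using assms by (simp_all add: finite_rank_def)
  show "K + L \<in> cblinfuns" using assms by (simp add: finite_rank_def)
  show "\<exists>m\<in>range (blinfun_apply K). \<exists>n\<in>range (blinfun_apply L). blinfun_apply (K + L) x = m + n" for x
    by (intro bexI[of _ "blinfun_apply K x"] bexI[of _ "blinfun_apply L x"]) (simp_all add: blinfun.add_left)
qed

lemma finite_rank_comp_left:
  assumes "finite_rank K" "S \<in> cblinfuns" shows "finite_rank (S o\<^sub>L K)"
proof -
  have "finite_cdim (blinfun_apply S ` range (blinfun_apply K))"
    using finite_cdim_image[OF assms(2)] assms(1) unfolding finite_rank_def by blast
  moreover have "range (blinfun_apply (S o\<^sub>L K)) = blinfun_apply S ` range (blinfun_apply K)"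
    by (simp add: image_image)
  ultimately show ?thesis using assms by (simp add: finite_rank_def)
qed

lemma finite_rank_comp_right:
  assumes "finite_rank K" "S \<in> cblinfuns" shows "finite_rank (K o\<^sub>L S)"
proof -
  have "range (blinfun_apply (K o\<^sub>L S)) \<subseteq> range (blinfun_apply K)" by auto
  then show ?thesis using assms finite_cdim_subset unfolding finite_rank_def by blast
qed

lemma finite_rank_scale: "finite_rank K \<Longrightarrow> finite_rank (c *\<^sub>C K)"
proof -
  assume K: "finite_rank K"
  have "c *\<^sub>C K = (c *\<^sub>C id_blinfun) o\<^sub>L K" by (rule blinfun_eqI) simp
  then show ?thesis using finite_rank_comp_left[OF K, of "c *\<^sub>C id_blinfun"] by auto
qed

lemma finite_rank_diff: "finite_rank K \<Longrightarrow> finite_rank L \<Longrightarrow> finite_rank (K - L)"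
  using finite_rank_add[of K "(-1) *\<^sub>C L"] finite_rank_scale[of L "-1"] by (simp add: scaleC_one)

lemma finite_rank_cblinfuns: "finite_rank K \<Longrightarrow> K \<in> cblinfuns"
  by (simp add: finite_rank_def)

text \<open>The quotient norm modulo finite rank, in the manner of the Calkin algebra. It also
  vanishes on norm limits of finite-rank operators, so what is extracted from it is always an
  approximation by finite rank.\<close>

definition ess_norm :: "('a::complex_normed_vector \<Rightarrow>\<^sub>L 'a) \<Rightarrow> real" where
  "ess_norm U = (INF K\<in>Collect finite_rank. norm (U - K))"

lemma ess_norm_le: "finite_rank K \<Longrightarrow> ess_norm U \<le> norm (U - K)"
  unfolding ess_norm_def by (rule cINF_lower) (auto intro!: bdd_belowI[of _ 0])

lemma ess_norm_less: "ess_norm U < e \<Longrightarrow> \<exists>K. finite_rank K \<and> norm (U - K) < e"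
  unfolding ess_norm_def using finite_rank_zero
  by (subst (asm) cINF_less_iff) (auto intro!: bdd_belowI[of _ 0])

lemma ess_norm_nonneg: "0 \<le> ess_norm U"
  unfolding ess_norm_def using finite_rank_zero by (intro cINF_greatest) auto

lemma ess_norm_finite_rank: "finite_rank K \<Longrightarrow> ess_norm K = 0"
  using ess_norm_le[of K K] ess_norm_nonneg[of K] by simp

lemma op_seminorm_ess: "op_seminorm (ess_norm :: ('a::complex_normed_vector \<Rightarrow>\<^sub>L 'a) \<Rightarrow> real)"
proof
  fix U V :: "'a \<Rightarrow>\<^sub>L 'a" and c :: complex
  assume U: "U \<in> cblinfuns"
  show "0 \<le> ess_norm U" by (rule ess_norm_nonneg)
  show "ess_norm (c *\<^sub>C U) \<le> cmod c * ess_norm U"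
  proof (cases "c = 0")
    case True
    then show ?thesis using ess_norm_finite_rank[OF finite_rank_zero, where 'a='a] by simp
  next
    case False
    have "ess_norm (c *\<^sub>C U) \<le> cmod c * norm (U - K)" if "finite_rank K" for K
      using ess_norm_le[OF finite_rank_scale[OF that, of c], of "c *\<^sub>C U"]
      by (simp add: cvec.scale_right_diff_distrib[symmetric] norm_scaleC)
    then have "ess_norm (c *\<^sub>C U) / cmod c \<le> ess_norm U"
      unfolding ess_norm_def[of U] using finite_rank_zero False
      by (intro cINF_greatest) (auto simp: field_simps)
    then show ?thesis using False by (simp add: field_simps)
  qed
  assume V: "V \<in> cblinfuns"
  show "ess_norm (U + V) \<le> ess_norm U + ess_norm V"
  proof (rule field_le_epsilon)
    fix e :: real assume e: "e > 0"
    obtain K L where K: "finite_rank K" "norm (U - K) < ess_norm U + e/2"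
      and L: "finite_rank L" "norm (V - L) < ess_norm V + e/2"
      using ess_norm_less[of U "ess_norm U + e/2"] ess_norm_less[of V "ess_norm V + e/2"] e by auto
    have "ess_norm (U + V) \<le> norm ((U - K) + (V - L))"
      using ess_norm_le[OF finite_rank_add[OF K(1) L(1)], of "U + V"] by (simp add: algebra_simps)
    also have "\<dots> \<le> norm (U - K) + norm (V - L)" by (rule norm_triangle_ineq)
    finally show "ess_norm (U + V) \<le> ess_norm U + ess_norm V + e" using K L by simp
  qed
  have *: "ess_norm (U o\<^sub>L V) \<le> norm (U - K) * norm (V - L)" if K: "finite_rank K" and L: "finite_rank L" for K L
  proof -
    let ?C = "((K o\<^sub>L V) + (U o\<^sub>L L)) - (K o\<^sub>L L)"
    have "finite_rank ?C"
      using K L U V finite_rank_cblinfuns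
      by (intro finite_rank_add finite_rank_diff finite_rank_comp_left finite_rank_comp_right) auto
    then have "ess_norm (U o\<^sub>L V) \<le> norm ((U o\<^sub>L V) - ?C)" by (rule ess_norm_le)
    also have "(U o\<^sub>L V) - ?C = (U - K) o\<^sub>L (V - L)"
      by (rule blinfun_eqI) (simp add: blinfun.bilinear_simps)
    also have "norm \<dots> \<le> norm (U - K) * norm (V - L)" by (rule norm_blinfun_compose)
    finally show ?thesis .
  qed
  have lim: "(\<lambda>n. a + inverse (real (Suc n))) \<longlonglongrightarrow> a" for a
    using tendsto_add[OF tendsto_const LIMSEQ_inverse_real_of_nat, of a] by simp
  have "ess_norm (U o\<^sub>L V) \<le> (ess_norm U + inverse (real (Suc n))) * (ess_norm V + inverse (real (Suc n)))" for n
  proof -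
    let ?e = "inverse (real (Suc n))"
    obtain K L where K: "finite_rank K" "norm (U - K) < ess_norm U + ?e"
      and L: "finite_rank L" "norm (V - L) < ess_norm V + ?e"
      using ess_norm_less[of U "ess_norm U + ?e"] ess_norm_less[of V "ess_norm V + ?e"] by auto
    have "ess_norm (U o\<^sub>L V) \<le> norm (U - K) * norm (V - L)" by (rule *[OF K(1) L(1)])
    also have "\<dots> \<le> (ess_norm U + ?e) * (ess_norm V + ?e)"
      using K L ess_norm_nonneg[of U] by (intro mult_mono) (auto simp: add_nonneg_nonneg)
    finally show ?thesis .
  qed
  then show "ess_norm (U o\<^sub>L V) \<le> ess_norm U * ess_norm V"
    by (intro LIMSEQ_le_const[OF tendsto_mult[OF lim lim]]) blast
next
  show "ess_norm (id_blinfun :: 'a \<Rightarrow>\<^sub>L 'a) \<le> 1"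
    using ess_norm_le[OF finite_rank_zero, of "id_blinfun :: 'a \<Rightarrow>\<^sub>L 'a"] norm_blinfun_id_le[where 'a='a] by simp
qed

section \<open>Invariant subspaces of finite codimension\<close>

lemma finite_ccodim_UNIV: "finite_ccodim UNIV"
  unfolding finite_ccodim_def by (auto intro!: exI[of _ "{}"])

text \<open>Choose preimages \<open>u c\<close> in \<open>F\<close> for a maximal independent set
  \<open>C\<close> of values that \<open>S\<close> takes on \<open>F\<close> modulo
  \<open>G\<close>. Subtracting their combinations moves any vector of \<open>F\<close> into the
  preimage of \<open>G\<close>.\<close>

lemma finite_ccodim_vimage:
  fixes S :: "'a::complex_normed_vector \<Rightarrow>\<^sub>L 'a"
  assumes S: "S \<in> cblinfuns" and F: "cvec.subspace F" "finite_ccodim F"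
    and G: "cvec.subspace G" "finite B" "\<And>x. x \<in> F \<Longrightarrow> \<exists>y\<in>G. S x - y \<in> cvec.span B"
  shows "finite_ccodim {x \<in> F. S x \<in> G}"
proof -
  obtain B1 where B1: "finite B1" "\<And>x. \<exists>y\<in>F. x - y \<in> cvec.span B1"
    using F(2) unfolding finite_ccodim_def by blast
  define Q where "Q = {w \<in> cvec.span B. \<exists>x\<in>F. S x - w \<in> G}"
  obtain C where C: "C \<subseteq> Q" "cvec.independent C" "Q \<subseteq> cvec.span C"
    using cvec.maximal_independent_subset by blast
  have "C \<subseteq> cvec.span B" using C(1) by (auto simp: Q_def)
  then have fin: "finite C" using cvec.independent_span_bound[OF G(2) C(2)] by blast
  have "\<forall>c\<in>C. \<exists>x. x \<in> F \<and> S x - c \<in> G" using C(1) by (auto simp: Q_def)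
  then obtain u where u: "\<And>c. c \<in> C \<Longrightarrow> u c \<in> F" "\<And>c. c \<in> C \<Longrightarrow> S (u c) - c \<in> G" by metis
  have "\<exists>y\<in>{x \<in> F. S x \<in> G}. x - y \<in> cvec.span (B1 \<union> u ` C)" for x
  proof -
    obtain f where f: "f \<in> F" "x - f \<in> cvec.span B1" using B1 by blast
    obtain y where y: "y \<in> G" "S f - y \<in> cvec.span B" using G(3)[OF f(1)] by blast
    then have "S f - y \<in> Q" using f by (auto simp: Q_def intro!: bexI[of _ f])
    then obtain a where a: "S f - y = (\<Sum>c\<in>C. a c *\<^sub>C c)"
      using C(3) cvec.span_finite[OF fin] by auto
    define v where "v = (\<Sum>c\<in>C. a c *\<^sub>C u c)"
    have vF: "v \<in> F" unfolding v_def using u(1) F(1) by (intro cvec.subspace_sum cvec.subspace_scale)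
    have "S (f - v) = S f - (\<Sum>c\<in>C. a c *\<^sub>C S (u c))"
      by (simp add: v_def blinfun.diff_right blinfun.sum_right cblinfuns_scaleC[OF S])
    also have "\<dots> = y - (\<Sum>c\<in>C. a c *\<^sub>C (S (u c) - c))"
      using a by (simp add: cvec.scale_right_diff_distrib sum_subtractf algebra_simps)
    also have "\<dots> \<in> G"
      using y(1) cvec.subspace_sum[OF G(1), of C "\<lambda>c. a c *\<^sub>C (S (u c) - c)"] u(2)
        cvec.subspace_scale[OF G(1)] cvec.subspace_diff[OF G(1)] by blast
    finally have "f - v \<in> {x \<in> F. S x \<in> G}" using f(1) vF F(1) by (simp add: cvec.subspace_diff)
    moreover have "v \<in> cvec.span (u ` C)"
      unfolding v_def by (intro cvec.span_sum cvec.span_scale cvec.span_base imageI)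
    then have "(x - f) + v \<in> cvec.span (B1 \<union> u ` C)"
      using f(2) cvec.span_mono[of B1 "B1 \<union> u ` C"] cvec.span_mono[of "u ` C" "B1 \<union> u ` C"]
      by (intro cvec.span_add) auto
    then have "x - (f - v) \<in> cvec.span (B1 \<union> u ` C)" by (simp add: algebra_simps)
    ultimately show ?thesis by blast
  qed
  then show ?thesis unfolding finite_ccodim_def using B1(1) fin by blast
qed

lemma finite_ccodim_kernel:
  assumes K: "finite_rank K" and B: "B \<in> cblinfuns" and F: "cvec.subspace F" "finite_ccodim F"
  shows "finite_ccodim {x. blinfun_apply K x = 0 \<and> blinfun_apply B x \<in> F}"
proof -
  obtain C where C: "finite C" "range (blinfun_apply K) \<subseteq> cvec.span C"
    using K unfolding finite_rank_def finite_cdim_def by blast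
  have 1: "finite_ccodim {x \<in> UNIV. blinfun_apply K x \<in> {0}}"
    by (rule finite_ccodim_vimage[OF _ _ finite_ccodim_UNIV _ C(1)])
      (use K C(2) in \<open>auto simp: finite_rank_def cvec.subspace_def\<close>)
  have sub: "cvec.subspace {x \<in> UNIV. blinfun_apply K x \<in> {0}}"
    using finite_rank_cblinfuns[OF K]
    by (auto simp: cvec.subspace_def blinfun.zero_right blinfun.add_right cblinfuns_scaleC)
  obtain C' where C': "finite C'" "\<And>x. \<exists>y\<in>F. x - y \<in> cvec.span C'"
    using F(2) unfolding finite_ccodim_def by blast
  have "finite_ccodim {x \<in> {x \<in> UNIV. blinfun_apply K x \<in> {0}}. blinfun_apply B x \<in> F}"
    by (rule finite_ccodim_vimage[OF B sub 1 F(1) C'])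
  then show ?thesis by simp
qed

text \<open>Where the error \<open>S B - 1\<close> vanishes and \<open>B x\<close> lies in
  \<open>F\<close>, one has \<open>x = S (B x)\<close>. So the image contains a closed subspace of
  finite codimension, and every larger subspace is closed as well.\<close>

lemma image_closed_finite_ccodim:
  fixes S :: "'a::complex_banach \<Rightarrow>\<^sub>L 'a"
  assumes S: "S \<in> cblinfuns" and B: "B \<in> cblinfuns" "finite_rank ((S o\<^sub>L B) - id_blinfun)"
    and F: "cvec.subspace F" "closed F" "finite_ccodim F"
  shows "closed (S ` F)" "finite_ccodim (S ` F)" "cvec.subspace (S ` F)"
proof -
  let ?K = "(S o\<^sub>L B) - id_blinfun"
  let ?H = "{x. blinfun_apply ?K x = 0 \<and> blinfun_apply B x \<in> F}"
  have K: "?K \<in> cblinfuns" using S B by auto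
  have H1: "finite_ccodim ?H" by (rule finite_ccodim_kernel[OF B(2,1) F(1,3)])
  have "closed (blinfun_apply ?K -` {0})" "closed (blinfun_apply B -` F)"
    by (intro closed_vimage F(2) closed_singleton blinfun.continuous_on continuous_on_id
        linear_continuous_on blinfun.bounded_linear_right)+
  moreover have "?H = blinfun_apply ?K -` {0} \<inter> blinfun_apply B -` F" by auto
  ultimately have H2: "closed ?H" by auto
  have H3: "cvec.subspace ?H"
    using K B F(1)
    unfolding cvec.subspace_def by (simp add: blinfun.zero_right blinfun.add_right cblinfuns_scaleC)
  have "x = S (B x)" if "blinfun_apply ?K x = 0" for x
    using that by (simp add: blinfun.diff_left)
  then have H: "?H \<subseteq> S ` F" by blast
  show sub: "cvec.subspace (S ` F)" by (rule subspace_image_cblinfun[OF S F(1)])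
  show "closed (S ` F)" by (rule closed_supspace[OF H3 H2 H1 sub H])
  show "finite_ccodim (S ` F)" by (rule finite_ccodim_mono[OF H1 H])
qed

lemma funpow_congruence:
  fixes S :: "'a::complex_normed_vector \<Rightarrow>\<^sub>L 'a"
  assumes S: "S \<in> cblinfuns" and G: "cvec.subspace G" "S ` G \<subseteq> G" and x: "x - z *\<^sub>C S x \<in> G"
  shows "x - z ^ k *\<^sub>C (blinfun_apply S ^^ k) x \<in> G"
proof (induction k)
  case 0
  then show ?case using G(1) by (simp add: scaleC_one cvec.subspace_0)
next
  case (Suc k)
  then have "z *\<^sub>C S (x - z ^ k *\<^sub>C (blinfun_apply S ^^ k) x) \<in> G"
    using G by (intro cvec.subspace_scale) auto
  then have "(x - z *\<^sub>C S x) + z *\<^sub>C S (x - z ^ k *\<^sub>C (blinfun_apply S ^^ k) x) \<in> G"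
    using G(1) x by (intro cvec.subspace_add)
  then show ?case
    by (simp add: blinfun.diff_right cblinfuns_scaleC[OF S] cvec.scale_right_diff_distrib scaleC_scaleC)
qed

lemma funpow_invariant: "f ` G \<subseteq> G \<Longrightarrow> x \<in> G \<Longrightarrow> (f ^^ k) x \<in> G"
  by (induction k) auto

text \<open>As in the Riesz theory of compact operators, \<open>\<parallel>P - K\<parallel> r\<^sup>k < 1/4\<close> with \<open>P = S\<^sup>k\<close> and \<open>K\<close> of finite
  rank rules out infinite chains of images or of kernels of \<open>1 - z S\<close> with \<open>\<bar>z\<bar> \<le> r\<close>.\<close>

locale riesz_operator =
  fixes S P K :: "'a::complex_banach \<Rightarrow>\<^sub>L 'a" and k :: nat and r :: real
  assumes S: "S \<in> cblinfuns" and P: "blinfun_apply P = (blinfun_apply S ^^ k)"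
    and K: "finite_rank K" and r: "0 \<le> r" and small: "r ^ k * norm (P - K) < 1/4"
    and parametrix: "\<And>z. cmod z \<le> r \<Longrightarrow>
      \<exists>B\<in>cblinfuns. finite_rank (((id_blinfun - z *\<^sub>C S) o\<^sub>L B) - id_blinfun)"
begin

text \<open>Finite rank makes \<open>K (x n)\<close> converge along a subsequence. For two late
  indices only \<open>P - K\<close> matters, and it acts on a vector of norm at most 2.\<close>

lemma close_pair:
  fixes x :: "nat \<Rightarrow> 'a"
  assumes x: "\<And>n. norm (x n) \<le> 1"
  obtains i j where "i < j" "r ^ k * norm (P (x i - x j)) < 1/2"
proof -
  obtain B where B: "finite B" "range (blinfun_apply K) \<subseteq> cvec.span B"
    using K unfolding finite_rank_def finite_cdim_def by blast
  have "norm (K (x n)) \<le> norm K" for n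
    using norm_blinfun[of K "x n"] mult_left_mono[OF x[of n], of "norm K"] by simp
  then obtain s l where s: "strict_mono (s :: nat \<Rightarrow> nat)" "((\<lambda>n. K (x n)) \<circ> s) \<longlonglongrightarrow> l"
    using finite_cdim_subseq[OF B(1), of "\<lambda>n. K (x n)" "norm K"] B(2) by blast
  \<comment> \<open>This is what the contribution of \<open>P - K\<close> leaves of 1/2, divided by
    \<open>r ^ k + 1\<close> rather than \<open>r ^ k\<close> because \<open>r\<close> may be
    0.\<close>
  define e where "e = (1/2 - 2 * (r ^ k * norm (P - K))) / (r ^ k + 1)"
  have rk: "0 \<le> r ^ k" using r by simp
  have e: "e > 0" using small rk unfolding e_def by (intro divide_pos_pos) linarith+
  obtain N where N: "\<And>m n. m \<ge> N \<Longrightarrow> n \<ge> N \<Longrightarrow> dist (K (x (s m))) (K (x (s n))) < e"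
    using LIMSEQ_imp_Cauchy[OF s(2)] e unfolding Cauchy_def o_def by blast
  define i j where "i = s N" and "j = s (Suc N)"
  have "i < j" using s(1) by (simp add: i_def j_def strict_mono_less)
  have d: "norm (K (x i - x j)) < e"
    using N[of N "Suc N"] by (simp add: dist_norm i_def j_def blinfun.diff_right)
  have "P (x i - x j) = (P - K) (x i - x j) + K (x i - x j)" by (simp add: blinfun.diff_left)
  then have "norm (P (x i - x j)) \<le> norm ((P - K) (x i - x j)) + norm (K (x i - x j))"
    by (metis norm_triangle_ineq)
  also have "norm ((P - K) (x i - x j)) \<le> norm (P - K) * norm (x i - x j)" by (rule norm_blinfun)
  also have "\<dots> \<le> norm (P - K) * 2"
    using norm_triangle_ineq4[of "x i" "x j"] x[of i] x[of j] by (intro mult_left_mono) auto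
  finally have "norm (P (x i - x j)) \<le> norm (P - K) * 2 + e" using d by simp
  then have "r ^ k * norm (P (x i - x j)) \<le> r ^ k * (norm (P - K) * 2 + e)"
    using rk by (rule mult_left_mono)
  also have "\<dots> < 2 * (r ^ k * norm (P - K)) + (r ^ k + 1) * e"
    using e by (simp add: algebra_simps)
  also have "\<dots> = 1/2" using rk by (simp add: e_def)
  finally show thesis using that \<open>i < j\<close> by blast
qed

text \<open>Modulo \<open>G\<close> the vector \<open>x\<close> equals \<open>z^k P x\<close>, while
  \<open>z^k P y\<close> vanishes; so \<open>z^k P (x - y)\<close> is at least as large as the
  distance from \<open>x\<close> to \<open>G\<close>. This is what contradicts
  \<open>close_pair\<close> in both chain arguments.\<close>

lemma separated_pair:
  assumes G: "cvec.subspace G" and x: "x - z ^ k *\<^sub>C P x \<in> G" and y: "z ^ k *\<^sub>C P y \<in> G"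
    and z: "cmod z \<le> r" and far: "\<And>g. g \<in> G \<Longrightarrow> 1/2 \<le> norm (x - g)"
  shows "1/2 \<le> r ^ k * norm (P (x - y))"
proof -
  have "(x - z ^ k *\<^sub>C P x) + z ^ k *\<^sub>C P y \<in> G" using G x y by (rule cvec.subspace_add)
  then have "1/2 \<le> norm (x - ((x - z ^ k *\<^sub>C P x) + z ^ k *\<^sub>C P y))" by (rule far)
  also have "x - ((x - z ^ k *\<^sub>C P x) + z ^ k *\<^sub>C P y) = z ^ k *\<^sub>C P (x - y)"
    by (simp add: blinfun.diff_right cvec.scale_right_diff_distrib)
  also have "norm \<dots> = cmod z ^ k * norm (P (x - y))" by (simp add: norm_scaleC norm_power)
  also have "\<dots> \<le> r ^ k * norm (P (x - y))"
    using z by (intro mult_right_mono power_mono) auto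
  finally show ?thesis .
qed

definition admissible :: "'a set \<Rightarrow> bool" where
  "admissible F \<longleftrightarrow> cvec.subspace F \<and> closed F \<and> finite_ccodim F \<and> S ` F \<subseteq> F"

lemma admissible_image:
  assumes F: "admissible F" and z: "cmod z \<le> r"
  shows "admissible ((id_blinfun - z *\<^sub>C S) ` F)" "(id_blinfun - z *\<^sub>C S) ` F \<subseteq> F"
proof -
  let ?A = "id_blinfun - z *\<^sub>C S"
  have A: "?A \<in> cblinfuns" using S by auto
  have comm: "S (?A x) = ?A (S x)" for x
    by (simp add: blinfun.bilinear_simps cblinfuns_scaleC[OF S])
  obtain B where B: "B \<in> cblinfuns" "finite_rank ((?A o\<^sub>L B) - id_blinfun)" using parametrix[OF z] by blast
  have "S ` (?A ` F) \<subseteq> ?A ` F"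
  proof
    fix y assume "y \<in> S ` (?A ` F)"
    then obtain x where x: "x \<in> F" "y = ?A (S x)" using comm by auto
    then show "y \<in> ?A ` F" using F unfolding admissible_def by blast
  qed
  then show "admissible (?A ` F)"
    using F image_closed_finite_ccodim[OF A B] unfolding admissible_def by blast
  show "?A ` F \<subseteq> F"
  proof
    fix y assume "y \<in> ?A ` F"
    then obtain x where x: "x \<in> F" "y = x - z *\<^sub>C S x" by (auto simp: blinfun.diff_left)
    moreover have "z *\<^sub>C S x \<in> F" using x F cvec.subspace_scale unfolding admissible_def by blast
    ultimately show "y \<in> F" using F cvec.subspace_diff unfolding admissible_def by blast
  qed
qed

text \<open>Otherwise each stage has a parameter \<open>z n\<close> for which the image of
  \<open>1 - z n S\<close> is strictly smaller, and unit vectors far from the next stage violate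
  \<open>close_pair\<close>. The parameters may change along the chain, since all stages are
  \<open>S\<close>-invariant.\<close>

lemma admissible_surjective:
  assumes F0: "admissible F0"
  obtains F where "admissible F" "F \<subseteq> F0" "\<And>z. cmod z \<le> r \<Longrightarrow> (id_blinfun - z *\<^sub>C S) ` F = F"
proof (rule ccontr)
  note conclusion = that
  assume "\<not> thesis"
  then have ex: "\<exists>z. cmod z \<le> r \<and> (id_blinfun - z *\<^sub>C S) ` F \<noteq> F" if "admissible F" "F \<subseteq> F0" for F
    using that conclusion by blast
  define Q where "Q F G \<longleftrightarrow> (\<exists>z. cmod z \<le> r \<and> G = (id_blinfun - z *\<^sub>C S) ` F \<and> G \<noteq> F)" for F G
  have "\<exists>Fs. \<forall>n::nat. (admissible (Fs n) \<and> Fs n \<subseteq> F0) \<and> Q (Fs n) (Fs (Suc n))"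
  proof (rule dependent_nat_choice)
    show "\<exists>F. admissible F \<and> F \<subseteq> F0" using F0 by blast
    fix F assume F: "admissible F \<and> F \<subseteq> F0"
    then obtain z where z: "cmod z \<le> r" "(id_blinfun - z *\<^sub>C S) ` F \<noteq> F" using ex by blast
    then show "\<exists>G. (admissible G \<and> G \<subseteq> F0) \<and> Q F G"
      using admissible_image[OF _ z(1), of F] F unfolding Q_def by blast
  qed
  then obtain Fs where Fs: "\<And>n. admissible (Fs n)" "\<And>n. Q (Fs n) (Fs (Suc n))" by blast
  obtain z where z: "\<And>n. cmod (z n) \<le> r" "\<And>n. Fs (Suc n) = (id_blinfun - z n *\<^sub>C S) ` Fs n"
      "\<And>n. Fs (Suc n) \<noteq> Fs n"
    using Fs(2) unfolding Q_def by metis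
  have less: "Fs (Suc n) \<subset> Fs n" for n
    using admissible_image(2)[OF Fs(1) z(1), of n n] z(2,3)[of n] by auto
  have anti: "i \<le> j \<Longrightarrow> Fs j \<subseteq> Fs i" for i j
    by (rule lift_Suc_antimono_le[of Fs]) (use less in auto)
  have "\<exists>x. x \<in> Fs n \<and> norm x = 1 \<and> (\<forall>f\<in>Fs (Suc n). 1/2 \<le> norm (x - f))" for n
    using riesz_vector[OF _ _ _ less[of n]] Fs(1) unfolding admissible_def by metis
  then obtain x where x: "\<And>n. x n \<in> Fs n" "\<And>n. norm (x n) = 1"
      "\<And>n f. f \<in> Fs (Suc n) \<Longrightarrow> 1/2 \<le> norm (x n - f)" by metis
  obtain i j where ij: "i < j" "r ^ k * norm (P (x i - x j)) < 1/2"
    using close_pair[of x] x(2) by (metis order_refl)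
  have sub: "cvec.subspace (Fs (Suc i))" "S ` Fs (Suc i) \<subseteq> Fs (Suc i)"
    using Fs(1)[of "Suc i"] by (auto simp: admissible_def)
  have "x i - z i *\<^sub>C S (x i) \<in> Fs (Suc i)"
    unfolding z(2) using x(1)[of i] by (auto simp: blinfun.diff_left intro!: image_eqI[of _ _ "x i"])
  then have 1: "x i - z i ^ k *\<^sub>C P (x i) \<in> Fs (Suc i)"
    unfolding P by (rule funpow_congruence[OF S sub])
  have "x j \<in> Fs (Suc i)" using x(1)[of j] anti[of "Suc i" j] ij(1) by auto
  then have "z i ^ k *\<^sub>C P (x j) \<in> Fs (Suc i)"
    unfolding P using funpow_invariant[OF sub(2)] cvec.subspace_scale[OF sub(1)] by blast
  then show False using separated_pair[OF sub(1) 1 _ z(1) x(3)] ij(2) by fastforce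
qed

text \<open>A nonzero kernel vector lifted \<open>n\<close> times through the surjection lies in the
  kernel of the power \<open>Suc n\<close> but not of the power \<open>n\<close>. The kernels thus
  increase for ever, and unit vectors far from the preceding kernel violate
  \<open>close_pair\<close>.\<close>

lemma surjective_imp_injective:
  assumes F: "admissible F" and z: "cmod z \<le> r" and surj: "(id_blinfun - z *\<^sub>C S) ` F = F"
  shows "inj_on (id_blinfun - z *\<^sub>C S) F"
proof (rule ccontr)
  let ?A = "id_blinfun - z *\<^sub>C S"
  have A: "?A \<in> cblinfuns" using S by auto
  have sF: "cvec.subspace F" "closed F" "S ` F \<subseteq> F" using F by (auto simp: admissible_def)
  assume "\<not> ?thesis"
  then obtain a b where ab: "a \<in> F" "b \<in> F" "?A a = ?A b" "a \<noteq> b" by (auto simp: inj_on_def)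
  then have w: "a - b \<in> F" "?A (a - b) = 0" "a - b \<noteq> 0"
    using sF(1) by (auto simp: cvec.subspace_diff blinfun.diff_right)
  define G where "G n = {x \<in> F. (blinfun_apply ?A ^^ n) x = 0}" for n
  have pow: "\<exists>U\<in>cblinfuns. blinfun_apply U = (blinfun_apply ?A ^^ n)" for n
  proof (induction n)
    case 0
    then show ?case by (intro bexI[of _ id_blinfun]) auto
  next
    case (Suc n)
    then obtain U where "U \<in> cblinfuns" "blinfun_apply U = (blinfun_apply ?A ^^ n)" by blast
    then show ?case using A by (intro bexI[of _ "?A o\<^sub>L U"]) (auto simp: fun_eq_iff)
  qed
  have G: "cvec.subspace (G n) \<and> closed (G n)" for n
  proof -
    obtain U where U: "U \<in> cblinfuns" "blinfun_apply U = (blinfun_apply ?A ^^ n)" using pow by blast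
    have "G n = F \<inter> blinfun_apply U -` {0}" by (auto simp: G_def U(2))
    moreover have "closed (blinfun_apply U -` {0})"
      by (intro closed_vimage closed_singleton linear_continuous_on blinfun.bounded_linear_right)
    moreover have "cvec.subspace (F \<inter> blinfun_apply U -` {0})"
      using sF(1) U(1) by (auto simp: cvec.subspace_def blinfun.zero_right blinfun.add_right cblinfuns_scaleC)
    ultimately show ?thesis using sF(2) by auto
  qed
  have commS: "S (?A x) = ?A (S x)" for x
    by (simp add: blinfun.bilinear_simps cblinfuns_scaleC[OF S])
  then have comm: "(blinfun_apply ?A ^^ n) (S x) = S ((blinfun_apply ?A ^^ n) x)" for n x
    by (induction n) auto
  have inv: "S ` G n \<subseteq> G n" for n
    using sF(3) by (auto simp: G_def comm blinfun.zero_right)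
  have "\<exists>y\<in>F. (blinfun_apply ?A ^^ n) y = a - b" for n
  proof (induction n)
    case 0
    then show ?case using w(1) by auto
  next
    case (Suc n)
    then obtain y where y: "y \<in> F" "(blinfun_apply ?A ^^ n) y = a - b" by blast
    then obtain y' where "y' \<in> F" "y = ?A y'" using surj by blast
    then show ?case using y by (intro bexI[of _ y']) (auto simp: funpow_swap1)
  qed
  then obtain y where y: "\<And>n. y n \<in> F" "\<And>n. (blinfun_apply ?A ^^ n) (y n) = a - b" by metis
  have sub: "G n \<subseteq> G (Suc n)" for n by (auto simp: G_def blinfun.zero_right)
  have "y n \<in> G (Suc n)" "y n \<notin> G n" for n
    using y[of n] w by (auto simp: G_def)
  then have less: "G n \<subset> G (Suc n)" for n using sub by blast
  have mono: "i \<le> j \<Longrightarrow> G i \<subseteq> G j" for i j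
    by (rule lift_Suc_mono_le[of G]) (use sub in auto)
  have "\<exists>x. x \<in> G (Suc n) \<and> norm x = 1 \<and> (\<forall>f\<in>G n. 1/2 \<le> norm (x - f))" for n
    using riesz_vector[OF _ _ _ less[of n]] G by metis
  then obtain x where x: "\<And>n. x n \<in> G (Suc n)" "\<And>n. norm (x n) = 1"
      "\<And>n f. f \<in> G n \<Longrightarrow> 1/2 \<le> norm (x n - f)" by metis
  obtain i j where ij: "i < j" "r ^ k * norm (P (x i - x j)) < 1/2"
    using close_pair[of x] x(2) by (metis order_refl)
  have "x j \<in> F" "(blinfun_apply ?A ^^ j) (?A (x j)) = 0" using x(1)[of j] by (auto simp: G_def funpow_swap1)
  moreover have "?A (x j) \<in> F" using \<open>x j \<in> F\<close> surj by blast
  ultimately have "x j - z *\<^sub>C S (x j) \<in> G j" by (simp add: G_def blinfun.diff_left)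
  then have 1: "x j - z ^ k *\<^sub>C P (x j) \<in> G j"
    unfolding P using G inv by (intro funpow_congruence[OF S]) auto
  have "x i \<in> G j" using x(1)[of i] mono[of "Suc i" j] ij(1) by auto
  then have "z ^ k *\<^sub>C P (x i) \<in> G j"
    unfolding P using funpow_invariant[OF inv] cvec.subspace_scale G by blast
  then have "1/2 \<le> r ^ k * norm (P (x j - x i))" using separated_pair[OF _ 1 _ z x(3)] G by blast
  moreover have "norm (P (x j - x i)) = norm (P (x i - x j))"
    by (simp add: blinfun.diff_right norm_minus_commute)
  ultimately show False using ij(2) by simp
qed

end

section \<open>Eigenvectors modulo a subspace of finite codimension\<close>

text \<open>An upper bound serves as induction variable; the exact codimension is never
  computed.\<close>

definition codim_le :: "'a::complex_vector set \<Rightarrow> nat \<Rightarrow> bool" where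
  "codim_le F n \<longleftrightarrow> (\<exists>B. finite B \<and> card B \<le> n \<and> (\<forall>x. \<exists>y\<in>F. x - y \<in> cvec.span B))"

lemma finite_ccodim_iff: "finite_ccodim F \<longleftrightarrow> (\<exists>n. codim_le F n)"
  unfolding finite_ccodim_def codim_le_def by blast

lemma codim_le_0: "codim_le F 0 \<Longrightarrow> F = UNIV"
proof -
  assume "codim_le F 0"
  then have "\<exists>y\<in>F. x - y \<in> cvec.span {}" for x unfolding codim_le_def by (metis card_0_eq le_zero_eq)
  then show ?thesis by auto
qed

lemma codim_le_add_line:
  assumes F: "cvec.subspace F" "codim_le F (Suc n)" "u \<notin> F"
  shows "codim_le (add_line F u) n"
proof -
  obtain B where B: "finite B" "card B \<le> Suc n" "\<And>x. \<exists>y\<in>F. x - y \<in> cvec.span B"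
    using F(2) unfolding codim_le_def by blast
  obtain y where y: "y \<in> F" "u - y \<in> cvec.span B" using B(3) by blast
  then obtain a where a: "u - y = (\<Sum>v\<in>B. a v *\<^sub>C v)" using cvec.span_finite[OF B(1)] by auto
  have "\<exists>b\<in>B. a b \<noteq> 0"
  proof (rule ccontr)
    assume "\<not> ?thesis"
    then have "u - y = 0" using a by simp
    then show False using y(1) F(3) by simp
  qed
  then obtain b where b: "b \<in> B" "a b \<noteq> 0" by blast
  have "\<exists>w\<in>add_line F u. x - w \<in> cvec.span (B - {b})" for x
  proof -
    obtain y' where y': "y' \<in> F" "x - y' \<in> cvec.span B" using B(3) by blast
    then obtain c where c: "x - y' = (\<Sum>v\<in>B. c v *\<^sub>C v)" using cvec.span_finite[OF B(1)] by auto
    define t where "t = c b / a b"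
    have "x - (y' + t *\<^sub>C (u - y)) = (\<Sum>v\<in>B. (c v - t * a v) *\<^sub>C v)"
      using c unfolding a
      by (simp add: cvec.scale_left_diff_distrib sum_subtractf cvec.scale_sum_right scaleC_scaleC algebra_simps)
    also have "\<dots> = (\<Sum>v\<in>B - {b}. (c v - t * a v) *\<^sub>C v)"
      by (rule sum.mono_neutral_right) (use B(1) b(2) in \<open>auto simp: t_def\<close>)
    also have "\<dots> \<in> cvec.span (B - {b})"
      by (intro cvec.span_sum cvec.span_scale cvec.span_base)
    finally have "x - (y' + t *\<^sub>C (u - y)) \<in> cvec.span (B - {b})" .
    moreover have "y' + t *\<^sub>C (u - y) = (y' - t *\<^sub>C y) + t *\<^sub>C u"
      by (simp add: cvec.scale_right_diff_distrib)
    moreover have "y' - t *\<^sub>C y \<in> F" using y y' F(1) by (simp add: cvec.subspace_diff cvec.subspace_scale)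
    ultimately show ?thesis unfolding add_line_def by blast
  qed
  then show ?thesis
    unfolding codim_le_def using B(1,2) b(1)
    by (intro exI[of _ "B - {b}"]) (auto simp: card_Diff_singleton)
qed

text \<open>This is \<open>p(S) y\<close>, evaluated by Horner's scheme.\<close>

definition poly_apply :: "('a::complex_vector \<Rightarrow> 'a) \<Rightarrow> complex poly \<Rightarrow> 'a \<Rightarrow> 'a" where
  "poly_apply S p y = fold_coeffs (\<lambda>a w. a *\<^sub>C y + S w) p 0"

context
  fixes S :: "'a::complex_normed_vector \<Rightarrow>\<^sub>L 'a" and y :: 'a
  assumes S: "S \<in> cblinfuns"
begin

lemma poly_apply_0 [simp]: "poly_apply S 0 y = 0"
  by (simp add: poly_apply_def)

lemma poly_apply_pCons: "poly_apply S (pCons a p) y = a *\<^sub>C y + S (poly_apply S p y)"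
  by (cases "a = 0 \<and> p = 0") (auto simp: poly_apply_def blinfun.zero_right)

lemma poly_apply_add: "poly_apply S (p + q) y = poly_apply S p y + poly_apply S q y"
  by (induction p q rule: poly_induct2)
    (simp_all add: poly_apply_pCons scaleC_add_left blinfun.add_right)

lemma poly_apply_smult: "poly_apply S (smult c p) y = c *\<^sub>C poly_apply S p y"
  by (induction p)
    (simp_all add: poly_apply_pCons scaleC_add_right scaleC_scaleC cblinfuns_scaleC[OF S])

lemma poly_apply_monom: "poly_apply S (monom c i) y = c *\<^sub>C (blinfun_apply S ^^ i) y"
  by (induction i)
    (simp_all add: monom_0 monom_Suc poly_apply_pCons blinfun.zero_right cblinfuns_scaleC[OF S])

lemma poly_apply_sum: "poly_apply S (sum f A) y = (\<Sum>i\<in>A. poly_apply S (f i) y)"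
  by (induction A rule: infinite_finite_induct) (simp_all add: poly_apply_add)

lemma poly_apply_linear_factor:
  "poly_apply S ([:- a, 1:] * q) y = S (poly_apply S q y) - a *\<^sub>C poly_apply S q y"
proof -
  have "[:- a, 1:] * q = smult (- a) q + pCons 0 q" by simp
  then show ?thesis by (simp only: poly_apply_add poly_apply_smult poly_apply_pCons) simp
qed

lemma poly_apply_mem:
  assumes "cvec.subspace E" "blinfun_apply S ` E \<subseteq> E" "y \<in> E" shows "poly_apply S p y \<in> E"
  by (induction p)
    (use assms in \<open>auto simp: poly_apply_pCons cvec.subspace_0 intro!: cvec.subspace_add cvec.subspace_scale\<close>)

text \<open>Linear factors of \<open>p\<close> are split off until the remaining \<open>q\<close> no
  longer sends \<open>y\<close> into \<open>F\<close>; the last factor removed supplies the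
  eigenvalue.\<close>

lemma eigenvector_of_poly:
  assumes F: "cvec.subspace F" "y \<notin> F"
  shows "p \<noteq> 0 \<Longrightarrow> poly_apply S p y \<in> F \<Longrightarrow>
    \<exists>q a. poly_apply S q y \<notin> F \<and> S (poly_apply S q y) - a *\<^sub>C poly_apply S q y \<in> F"
proof (induction "degree p" arbitrary: p rule: less_induct)
  case less
  show ?case
  proof (cases "degree p = 0")
    case True
    then obtain c where c: "p = [:c:]" by (rule degree_eq_zeroE)
    with less.prems have "c \<noteq> 0" "c *\<^sub>C y \<in> F" by (auto simp: poly_apply_pCons blinfun.zero_right)
    then have "inverse c *\<^sub>C c *\<^sub>C y \<in> F" using F(1) cvec.subspace_scale by blast
    then show ?thesis using \<open>c \<noteq> 0\<close> F(2) by (simp add: scaleC_scaleC scaleC_one)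
  next
    case False
    then have "\<not> constant (poly p)" by (simp add: constant_degree)
    then obtain a where "poly p a = 0" using fundamental_theorem_of_algebra by blast
    then obtain q where q: "p = [:- a, 1:] * q" by (auto simp: poly_eq_0_iff_dvd)
    with less.prems have q0: "q \<noteq> 0" by auto
    show ?thesis
    proof (cases "poly_apply S q y \<in> F")
      case True
      have "degree q < degree p" unfolding q using q0 by (subst degree_mult_eq) auto
      then show ?thesis using less.hyps q0 True by blast
    next
      case False
      then show ?thesis using less.prems(2) unfolding q poly_apply_linear_factor by blast
    qed
  qed
qed

lemma eigenvector_mod:
  assumes F: "cvec.subspace F" "finite_ccodim F" and y: "y \<notin> F"
    and E: "cvec.subspace E" "blinfun_apply S ` E \<subseteq> E" "y \<in> E"
  obtains x a where "x \<in> E" "x \<notin> F" "S x - a *\<^sub>C x \<in> F"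
proof -
  obtain n c where c: "\<exists>i\<le>n. c i \<noteq> 0" "(\<Sum>i\<le>n. c i *\<^sub>C (blinfun_apply S ^^ i) y) \<in> F"
    using finite_ccodim_dependent[OF F, of "\<lambda>i. (blinfun_apply S ^^ i) y"] by blast
  define p where "p = (\<Sum>i\<le>n. monom (c i) i)"
  obtain i where i: "i \<le> n" "c i \<noteq> 0" using c(1) by blast
  have "coeff p i = c i" using i(1) by (simp add: p_def coeff_sum)
  then have "p \<noteq> 0" using i(2) by auto
  moreover have "poly_apply S p y \<in> F" using c(2) by (simp add: p_def poly_apply_sum poly_apply_monom)
  ultimately show thesis using eigenvector_of_poly[OF F(1) y] poly_apply_mem[OF E] that by blast
qed

text \<open>The lowest nonzero coefficient of a linear relation between the vectors \<open>S\<^sup>i y\<close> modulo \<open>F\<close>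
  decides which alternative holds.\<close>

lemma preimage_mod:
  assumes F: "cvec.subspace F" "finite_ccodim F" and y: "y \<notin> F"
    and E: "cvec.subspace E" "blinfun_apply S ` E \<subseteq> E" "y \<in> E"
  shows "(\<exists>x\<in>E. x \<notin> F \<and> S x \<in> F) \<or> (\<exists>u\<in>E. y - S u \<in> F)"
proof -
  obtain n c where c: "\<exists>i\<le>n. c i \<noteq> 0" "(\<Sum>i\<le>n. c i *\<^sub>C (blinfun_apply S ^^ i) y) \<in> F"
    using finite_ccodim_dependent[OF F, of "\<lambda>i. (blinfun_apply S ^^ i) y"] by blast
  have mem: "(\<Sum>i<n. c i *\<^sub>C (blinfun_apply S ^^ i) y) \<in> E" for n c
    using E funpow_invariant[OF E(2,3)] by (intro cvec.subspace_sum cvec.subspace_scale) auto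
  have shift: "(\<Sum>i\<le>n. c i *\<^sub>C (blinfun_apply S ^^ i) y) =
      c 0 *\<^sub>C y + S (\<Sum>i<n. c (Suc i) *\<^sub>C (blinfun_apply S ^^ i) y)" for n c
    by (simp add: lessThan_Suc_atMost[symmetric] sum.lessThan_Suc_shift blinfun.sum_right
        cblinfuns_scaleC[OF S] del: sum.lessThan_Suc)
  show ?thesis
    using c
  proof (induction n arbitrary: c)
    case 0
    then have c0: "c 0 \<noteq> 0" "c 0 *\<^sub>C y \<in> F" by auto
    have "inverse (c 0) *\<^sub>C c 0 *\<^sub>C y \<in> F" by (rule cvec.subspace_scale[OF F(1) c0(2)])
    with c0(1) show ?case using y by (simp add: scaleC_scaleC scaleC_one)
  next
    case (Suc n)
    define w where "w = (\<Sum>i<Suc n. c (Suc i) *\<^sub>C (blinfun_apply S ^^ i) y)"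
    have w: "w \<in> E" "c 0 *\<^sub>C y + S w \<in> F"
      using mem[of "\<lambda>i. c (Suc i)" "Suc n"] Suc.prems(2) unfolding shift w_def .
    show ?case
    proof (cases "c 0 = 0")
      case True
      show ?thesis
      proof (cases "w \<in> F")
        case True
        have "\<exists>i\<le>n. c (Suc i) \<noteq> 0"
          using Suc.prems(1) \<open>c 0 = 0\<close> by (metis Suc_le_mono not0_implies_Suc)
        moreover have "(\<Sum>i\<le>n. c (Suc i) *\<^sub>C (blinfun_apply S ^^ i) y) \<in> F"
          using True unfolding w_def lessThan_Suc_atMost .
        ultimately show ?thesis using Suc.IH[of "\<lambda>i. c (Suc i)"] by blast
      next
        case False
        then show ?thesis using w True by auto
      qed
    next
      case False
      have "inverse (c 0) *\<^sub>C (c 0 *\<^sub>C y + S w) \<in> F" using w(2) F(1) cvec.subspace_scale by blast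
      then have "y - S ((- inverse (c 0)) *\<^sub>C w) \<in> F"
        using False by (simp add: scaleC_add_right scaleC_scaleC scaleC_one cblinfuns_scaleC[OF S] blinfun.minus_right)
      moreover have "(- inverse (c 0)) *\<^sub>C w \<in> E" using w(1) E(1) cvec.subspace_scale by blast
      ultimately show ?thesis by blast
    qed
  qed
qed

end

text \<open>Eigenvectors modulo \<open>F\<close> for different parameters are linearly independent
  modulo \<open>F\<close>, and finite codimension excludes an infinite independent family.\<close>

lemma eigenvalues_mod_finite:
  fixes S :: "'a::complex_normed_vector \<Rightarrow>\<^sub>L 'a"
  assumes S: "S \<in> cblinfuns" and F: "cvec.subspace F" "finite_ccodim F" "S ` F \<subseteq> F"
  shows "finite {z. z \<noteq> 0 \<and> (\<exists>w. w \<notin> F \<and> w - z *\<^sub>C S w \<in> F)}" (is "finite ?\<Lambda>")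
proof (rule ccontr)
  assume "infinite ?\<Lambda>"
  then obtain z :: "nat \<Rightarrow> complex" where z: "inj z" "range z \<subseteq> ?\<Lambda>"
    using infinite_countable_subset by blast
  then have "\<forall>i. \<exists>w. w \<notin> F \<and> w - z i *\<^sub>C S w \<in> F" by blast
  then obtain w where w: "\<And>i. w i \<notin> F" "\<And>i. w i - z i *\<^sub>C S (w i) \<in> F" by metis
  have z0: "z i \<noteq> 0" for i using z(2) by blast
  have indep: "finite I \<Longrightarrow> (\<Sum>i\<in>I. c i *\<^sub>C w i) \<in> F \<Longrightarrow> \<forall>i\<in>I. c i = 0" for I c
  proof (induction I arbitrary: c rule: finite_induct)
    case (insert j I)
    let ?v = "\<Sum>i\<in>insert j I. c i *\<^sub>C w i"
    \<comment> \<open>Applying \<open>1 - z j S\<close> multiplies \<open>w i\<close> by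
      \<open>1 - z j / z i\<close> modulo \<open>F\<close>, and hence annihilates the term with
      index \<open>j\<close>.\<close>
    let ?c = "\<lambda>i. c i * (1 - z j / z i)"
    have v: "?v \<in> F" using insert.prems .
    have eq: "w i - z j *\<^sub>C S (w i) = (1 - z j / z i) *\<^sub>C w i + (z j / z i) *\<^sub>C (w i - z i *\<^sub>C S (w i))" for i
      using z0[of i] by (simp add: cvec.scale_left_diff_distrib cvec.scale_right_diff_distrib scaleC_scaleC scaleC_one)
    have "?v - z j *\<^sub>C S ?v = (\<Sum>i\<in>insert j I. c i *\<^sub>C (w i - z j *\<^sub>C S (w i)))"
      by (simp add: blinfun.sum_right cblinfuns_scaleC[OF S] cvec.scale_sum_right sum_subtractf
          cvec.scale_right_diff_distrib scaleC_scaleC mult.commute del: sum.insert)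
    also have "\<dots> = (\<Sum>i\<in>insert j I. ?c i *\<^sub>C w i) +
        (\<Sum>i\<in>insert j I. (c i * (z j / z i)) *\<^sub>C (w i - z i *\<^sub>C S (w i)))"
      unfolding eq by (simp add: scaleC_add_right scaleC_scaleC sum.distrib del: sum.insert)
    also have "(\<Sum>i\<in>insert j I. ?c i *\<^sub>C w i) = (\<Sum>i\<in>I. ?c i *\<^sub>C w i)"
      using insert.hyps z0[of j] by simp
    finally have "(\<Sum>i\<in>I. ?c i *\<^sub>C w i) =
        (?v - z j *\<^sub>C S ?v) - (\<Sum>i\<in>insert j I. (c i * (z j / z i)) *\<^sub>C (w i - z i *\<^sub>C S (w i)))"
      by (simp only: add_diff_cancel_right')
    moreover have "?v - z j *\<^sub>C S ?v \<in> F"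
      using v F(1,3) by (blast intro: cvec.subspace_diff cvec.subspace_scale)
    moreover have "(\<Sum>i\<in>insert j I. (c i * (z j / z i)) *\<^sub>C (w i - z i *\<^sub>C S (w i))) \<in> F"
      using w(2) F(1) by (intro cvec.subspace_sum cvec.subspace_scale) auto
    ultimately have "(\<Sum>i\<in>I. ?c i *\<^sub>C w i) \<in> F" using F(1) by (simp only: cvec.subspace_diff)
    then have "\<forall>i\<in>I. ?c i = 0" by (rule insert.IH)
    moreover have "z j / z i \<noteq> 1" if "i \<in> I" for i
      using that insert.hyps(2) z0[of i] z(1) by (auto simp: inj_def)
    ultimately have I: "\<forall>i\<in>I. c i = 0" by auto
    then have "c j *\<^sub>C w j \<in> F" using v insert.hyps by simp
    then have "inverse (c j) *\<^sub>C c j *\<^sub>C w j \<in> F" using F(1) cvec.subspace_scale by blast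
    then have "c j = 0" using w(1)[of j] by (cases "c j = 0") (auto simp: scaleC_scaleC scaleC_one)
    then show ?case using I by simp
  qed simp
  obtain n c where "\<exists>i\<le>n. c i \<noteq> 0" "(\<Sum>i\<le>n. c i *\<^sub>C w i) \<in> F"
    using finite_ccodim_dependent[OF F(1,2), of w] by blast
  then show False using indep[of "{..n}" c] by auto
qed

section \<open>Enlarging a subspace without small characteristic values\<close>

text \<open>Characteristic values are reciprocals of eigenvalues. The condition is algebraic
  bijectivity of \<open>1 - z S\<close> on \<open>F\<close>; boundedness of the inverse is recovered
  at the end from a parametrix.\<close>

definition no_char_values :: "real \<Rightarrow> ('a::complex_normed_vector \<Rightarrow>\<^sub>L 'a) \<Rightarrow> 'a set \<Rightarrow> bool" where
  "no_char_values r S F \<longleftrightarrow> S ` F \<subseteq> F \<and>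
     (\<forall>z. cmod z \<le> r \<longrightarrow> (\<forall>f\<in>F. f - z *\<^sub>C S f = 0 \<longrightarrow> f = 0) \<and> (\<forall>g\<in>F. \<exists>f\<in>F. f - z *\<^sub>C S f = g))"

lemma add_line_coeff_0:
  assumes "cvec.subspace F" "x \<notin> F" "f \<in> F" "f + c *\<^sub>C x \<in> F" shows "c = 0"
proof (rule ccontr)
  assume c: "c \<noteq> 0"
  have "inverse c *\<^sub>C ((f + c *\<^sub>C x) - f) \<in> F" using assms cvec.subspace_diff cvec.subspace_scale by blast
  then show False using c assms(2) by (simp add: scaleC_scaleC scaleC_one)
qed

text \<open>Modulo \<open>F\<close> the operator multiplies the new line by \<open>a\<close>, so
  \<open>1 - z S\<close> is block triangular with the extra diagonal entry
  \<open>1 - z a\<close>.\<close>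

lemma no_char_values_add_line:
  assumes S: "S \<in> cblinfuns" and F: "cvec.subspace F" "no_char_values r S F"
    and x: "x \<notin> F" "S x - a *\<^sub>C x \<in> F" and a: "\<And>z. cmod z \<le> r \<Longrightarrow> 1 - z * a \<noteq> 0"
  shows "no_char_values r S (add_line F x)"
proof -
  let ?k = "S x - a *\<^sub>C x"
  have inv: "S ` F \<subseteq> F" using F(2) by (simp add: no_char_values_def)
  have Sfx: "S (f + c *\<^sub>C x) = (S f + c *\<^sub>C ?k) + (c * a) *\<^sub>C x" for f c
    by (simp add: blinfun.add_right cblinfuns_scaleC[OF S] cvec.scale_right_diff_distrib scaleC_scaleC)
  have A: "(f + c *\<^sub>C x) - z *\<^sub>C S (f + c *\<^sub>C x) = ((f - z *\<^sub>C S f) - (z * c) *\<^sub>C ?k) + (c * (1 - z * a)) *\<^sub>C x" for f c z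
    unfolding Sfx
    by (simp add: scaleC_add_right cvec.scale_right_diff_distrib cvec.scale_left_diff_distrib scaleC_scaleC algebra_simps)
  show ?thesis
    unfolding no_char_values_def
  proof (intro conjI allI impI ballI)
    show "S ` add_line F x \<subseteq> add_line F x"
    proof
      fix y assume "y \<in> S ` add_line F x"
      then obtain f c where f: "f \<in> F" "y = S (f + c *\<^sub>C x)" by (auto simp: add_line_def)
      have "S f + c *\<^sub>C ?k \<in> F"
        using f(1) inv x(2) F(1) by (blast intro: cvec.subspace_add cvec.subspace_scale)
      then show "y \<in> add_line F x" unfolding f(2) Sfx add_line_def by blast
    qed
  next
    fix z :: complex and y assume z: "cmod z \<le> r" and y: "y \<in> add_line F x" "y - z *\<^sub>C S y = 0"
    obtain f c where f: "f \<in> F" "y = f + c *\<^sub>C x" using y(1) by (auto simp: add_line_def)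
    have k: "(f - z *\<^sub>C S f) - (z * c) *\<^sub>C ?k \<in> F"
      using f(1) inv x(2) F(1) by (blast intro: cvec.subspace_diff cvec.subspace_scale)
    have "((f - z *\<^sub>C S f) - (z * c) *\<^sub>C ?k) + (c * (1 - z * a)) *\<^sub>C x \<in> F"
      using y(2) A[of f c z] F(1) by (simp add: f(2) cvec.subspace_0)
    then have "c * (1 - z * a) = 0" by (rule add_line_coeff_0[OF F(1) x(1) k])
    then have c: "c = 0" using a[OF z] by simp
    then have "f - z *\<^sub>C S f = 0" using y(2) f(2) by simp
    then show "y = 0" using F(2) z f c unfolding no_char_values_def by simp
  next
    fix z :: complex and y assume z: "cmod z \<le> r" and y: "y \<in> add_line F x"
    obtain g b where g: "g \<in> F" "y = g + b *\<^sub>C x" using y by (auto simp: add_line_def)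
    define c where "c = b / (1 - z * a)"
    have "g + (z * c) *\<^sub>C ?k \<in> F" using g(1) x(2) F(1) by (intro cvec.subspace_add cvec.subspace_scale)
    then obtain f where f: "f \<in> F" "f - z *\<^sub>C S f = g + (z * c) *\<^sub>C ?k"
      using F(2) z unfolding no_char_values_def by blast
    have "(f + c *\<^sub>C x) - z *\<^sub>C S (f + c *\<^sub>C x) = y"
      unfolding A f(2) g(2) using a[OF z] by (simp add: c_def)
    moreover have "f + c *\<^sub>C x \<in> add_line F x" using f(1) by (auto simp: add_line_def)
    ultimately show "\<exists>h\<in>add_line F x. h - z *\<^sub>C S h = y" by blast
  qed
qed

text \<open>Here the triangular structure is reversed: the line through \<open>x\<close> is the
  invariant part, \<open>1 - z S'\<close> is the identity on it, and on the quotient it acts as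
  \<open>1 - z S\<close> does on \<open>F\<close>.\<close>

lemma no_char_values_add_kernel:
  assumes S: "S' \<in> cblinfuns" and F: "cvec.subspace F" "no_char_values r S F"
    and x: "x \<notin> F" "S' x = 0" and S': "\<And>f. f \<in> F \<Longrightarrow> S' f = S f + \<psi> f *\<^sub>C x"
  shows "no_char_values r S' (add_line F x)"
proof -
  have inv: "S ` F \<subseteq> F" using F(2) by (simp add: no_char_values_def)
  have Sfx: "S' (f + c *\<^sub>C x) = S f + \<psi> f *\<^sub>C x" if "f \<in> F" for f c
    using that S' x(2) by (simp add: blinfun.add_right cblinfuns_scaleC[OF S])
  have A: "(f + c *\<^sub>C x) - z *\<^sub>C S' (f + c *\<^sub>C x) = (f - z *\<^sub>C S f) + (c - z * \<psi> f) *\<^sub>C x"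
    if "f \<in> F" for f c z
    unfolding Sfx[OF that]
    by (simp add: scaleC_add_right cvec.scale_left_diff_distrib scaleC_scaleC algebra_simps)
  have mem: "f - z *\<^sub>C S f \<in> F" if "f \<in> F" for f z
    using that inv F(1) by (blast intro: cvec.subspace_diff cvec.subspace_scale)
  show ?thesis
    unfolding no_char_values_def
  proof (intro conjI allI impI ballI)
    show "S' ` add_line F x \<subseteq> add_line F x"
    proof
      fix y assume "y \<in> S' ` add_line F x"
      then obtain f c where f: "f \<in> F" "y = S' (f + c *\<^sub>C x)" by (auto simp: add_line_def)
      have "S f \<in> F" using f(1) inv by blast
      then show "y \<in> add_line F x" unfolding f(2) Sfx[OF f(1)] add_line_def by blast
    qed
  next
    fix z :: complex and y assume z: "cmod z \<le> r" and y: "y \<in> add_line F x" "y - z *\<^sub>C S' y = 0"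
    obtain f c where f: "f \<in> F" "y = f + c *\<^sub>C x" using y(1) by (auto simp: add_line_def)
    have "(f - z *\<^sub>C S f) + (c - z * \<psi> f) *\<^sub>C x \<in> F"
      using y(2) A[OF f(1), where c = c and z = z] F(1) by (simp add: f(2) cvec.subspace_0)
    then have "c - z * \<psi> f = 0" by (rule add_line_coeff_0[OF F(1) x(1) mem[OF f(1)]])
    then have "f - z *\<^sub>C S f = 0" using y(2) A[OF f(1), where c = c and z = z] f(2) by simp
    then have "f = 0" using F(2) z f(1) unfolding no_char_values_def by blast
    then show "y = 0" using y(2) f(2) x(2) by (simp add: cblinfuns_scaleC[OF S])
  next
    fix z :: complex and y assume z: "cmod z \<le> r" and y: "y \<in> add_line F x"
    obtain g b where g: "g \<in> F" "y = g + b *\<^sub>C x" using y by (auto simp: add_line_def)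
    obtain f where f: "f \<in> F" "f - z *\<^sub>C S f = g"
      using F(2) z g(1) unfolding no_char_values_def by blast
    have "(f + (b + z * \<psi> f) *\<^sub>C x) - z *\<^sub>C S' (f + (b + z * \<psi> f) *\<^sub>C x) = y"
      unfolding A[OF f(1)] f(2) g(2) by simp
    moreover have "f + (b + z * \<psi> f) *\<^sub>C x \<in> add_line F x" using f(1) by (auto simp: add_line_def)
    ultimately show "\<exists>h\<in>add_line F x. h - z *\<^sub>C S' h = y" by blast
  qed
qed

lemma no_char_values_cong:
  fixes S S' :: "'a::complex_normed_vector \<Rightarrow>\<^sub>L 'a"
  shows "(\<And>f. f \<in> F \<Longrightarrow> S f = S' f) \<Longrightarrow> no_char_values r S F \<longleftrightarrow> no_char_values r S' F"
  unfolding no_char_values_def by (simp add: image_subset_iff cong: ball_cong bex_cong)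

text \<open>If \<open>A\<close> were not bounded below, there would be unit vectors with
  \<open>A (x n)\<close> tending to 0 and, along a subsequence, \<open>?K (x n)\<close> convergent.
  Then \<open>x n = B (A (x n)) - ?K (x n)\<close> would tend to a unit vector in the kernel of
  \<open>A\<close>.\<close>

lemma bounded_inverse_of_parametrix:
  fixes A B :: "'a::complex_banach \<Rightarrow>\<^sub>L 'a"
  assumes A: "A \<in> cblinfuns" and B: "B \<in> cblinfuns" "finite_rank ((B o\<^sub>L A) - id_blinfun)"
    and inj: "\<And>x. A x = 0 \<Longrightarrow> x = 0" and surj: "\<And>y. \<exists>x. A x = y"
  shows "\<exists>C\<in>cblinfuns. A o\<^sub>L C = id_blinfun \<and> C o\<^sub>L A = id_blinfun"
proof -
  let ?K = "(B o\<^sub>L A) - id_blinfun"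
  have "\<exists>c>0. \<forall>x. c * norm x \<le> norm (A x)"
  proof (rule ccontr)
    assume *: "\<not> ?thesis"
    have "\<exists>x. norm x = 1 \<and> norm (A x) < inverse (real (Suc n))" for n
    proof -
      obtain x where x: "norm (A x) < inverse (real (Suc n)) * norm x"
        using * by (metis inverse_positive_iff_positive not_le of_nat_0_less_iff zero_less_Suc)
      then have "x \<noteq> 0" by (auto simp: blinfun.zero_right)
      then show ?thesis
        using x by (intro exI[of _ "inverse (norm x) *\<^sub>R x"])
          (simp add: blinfun.scaleR_right field_simps)
    qed
    then obtain x where x: "\<And>n. norm (x n) = 1" "\<And>n. norm (A (x n)) < inverse (real (Suc n))" by metis
    obtain C where C: "finite C" "range (blinfun_apply ?K) \<subseteq> cvec.span C"
      using B(2) unfolding finite_rank_def finite_cdim_def by blast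
    have "norm (?K (x n)) \<le> norm ?K" for n using norm_blinfun[of ?K "x n"] x(1)[of n] by simp
    then obtain s l where s: "strict_mono (s :: nat \<Rightarrow> nat)" "((\<lambda>n. ?K (x n)) \<circ> s) \<longlonglongrightarrow> l"
      using finite_cdim_subseq[OF C(1), of "\<lambda>n. ?K (x n)" "norm ?K"] C(2) by blast
    have "(\<lambda>n. norm (A (x n))) \<longlonglongrightarrow> 0"
      by (rule tendsto_sandwich[OF _ _ tendsto_const LIMSEQ_inverse_real_of_nat])
        (use x(2) in \<open>auto intro!: always_eventually less_imp_le\<close>)
    then have Ax: "(\<lambda>n. A (x (s n))) \<longlonglongrightarrow> 0"
      using LIMSEQ_subseq_LIMSEQ[OF _ s(1)] tendsto_norm_zero_cancel by (fastforce simp: o_def)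
    then have "(\<lambda>n. B (A (x (s n))) - ?K (x (s n))) \<longlonglongrightarrow> B 0 - l"
      using s(2) by (intro tendsto_diff blinfun.tendsto tendsto_const) (auto simp: o_def)
    then have lim: "(\<lambda>n. x (s n)) \<longlonglongrightarrow> - l" by (simp add: blinfun.diff_left blinfun.zero_right)
    then have "(\<lambda>n. A (x (s n))) \<longlonglongrightarrow> A (- l)" by (intro blinfun.tendsto tendsto_const)
    then have "A (- l) = 0" using Ax LIMSEQ_unique by blast
    then have "- l = 0" by (rule inj)
    moreover have "norm (- l) = 1"
      using LIMSEQ_unique[OF tendsto_norm[OF lim]] x(1) by simp
    ultimately show False by simp
  qed
  then obtain c where c: "c > 0" "\<And>x. c * norm x \<le> norm (A x)" by blast
  obtain f where f: "\<And>y. A (f y) = y" using surj by metis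
  have inj': "x = y" if "A x = A y" for x y using inj[of "x - y"] that by (simp add: blinfun.diff_right)
  have "norm (f y) \<le> inverse c * norm y" for y using c(2)[of "f y"] c(1) by (simp add: f field_simps)
  moreover have "f (x + y) = f x + f y" "f (a *\<^sub>C x) = a *\<^sub>C f x" for x y a
    by (rule inj', simp add: f blinfun.add_right cblinfuns_scaleC[OF A])+
  ultimately obtain C where C: "C \<in> cblinfuns" "blinfun_apply C = f" using cblinfun_exists by metis
  have "A o\<^sub>L C = id_blinfun" by (rule blinfun_eqI) (simp add: C(2) f)
  moreover have "C o\<^sub>L A = id_blinfun" by (rule blinfun_eqI, rule inj') (simp add: C(2) f)
  ultimately show ?thesis using C(1) by blast
qed

section \<open>Fredholm operators with a Kato decomposition\<close>

locale kato_operator =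
  fixes T :: "'a::complex_banach \<Rightarrow> 'a" and D X\<^sub>0 X\<^sub>1 :: "'a set"
  assumes closed_T: "closed_op UNIV D T" and fredholm_T: "fredholm_op D T"
    and kato: "kato_decomposition D T X\<^sub>0 X\<^sub>1"
begin

lemma D_sub: "cvec.subspace D" and T_add: "x \<in> D \<Longrightarrow> y \<in> D \<Longrightarrow> T (x + y) = T x + T y"
  and T_scale: "x \<in> D \<Longrightarrow> T (c *\<^sub>C x) = c *\<^sub>C T x"
  using closed_T unfolding closed_op_def clinear_on_def by auto

lemma T_zero [simp]: "T 0 = 0"
  using T_scale[of 0 0] cvec.subspace_0[OF D_sub] by simp

lemma T_diff: "x \<in> D \<Longrightarrow> y \<in> D \<Longrightarrow> T (x - y) = T x - T y"
  using T_add[of "x - y" y] cvec.subspace_diff[OF D_sub] by simp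

lemma T_closed:
  assumes "\<And>n. x n \<in> D" "x \<longlonglongrightarrow> l" "(\<lambda>n. T (x n)) \<longlonglongrightarrow> y"
  shows "l \<in> D \<and> T l = y"
proof -
  have "closed ((\<lambda>x. (x, T x)) ` D)" using closed_T by (simp add: closed_op_def)
  moreover have "(\<lambda>n. (x n, T (x n))) \<longlonglongrightarrow> (l, y)" using assms by (intro tendsto_Pair)
  ultimately have "(l, y) \<in> (\<lambda>x. (x, T x)) ` D"
    using assms(1) closed_sequentially[of "(\<lambda>x. (x, T x)) ` D" "\<lambda>n. (x n, T (x n))"] by blast
  then show ?thesis by auto
qed

lemma X0: "cvec.subspace X\<^sub>0" "closed X\<^sub>0" and X1: "cvec.subspace X\<^sub>1" "finite_cdim X\<^sub>1"
  and X_Int: "X\<^sub>0 \<inter> X\<^sub>1 = {0}"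
  and T_X0: "x \<in> D \<Longrightarrow> x \<in> X\<^sub>0 \<Longrightarrow> T x \<in> X\<^sub>0" and T_X1: "x \<in> D \<Longrightarrow> x \<in> X\<^sub>1 \<Longrightarrow> T x \<in> X\<^sub>1"
  and regular_T: "regular_op X\<^sub>0 (D \<inter> X\<^sub>0) T"
  and sum_X: "\<forall>x. \<exists>x0\<in>X\<^sub>0. \<exists>x1\<in>X\<^sub>1. x = x0 + x1"
  and sum_D: "\<forall>x\<in>D. \<exists>x0\<in>D \<inter> X\<^sub>0. \<exists>x1\<in>D \<inter> X\<^sub>1. x = x0 + x1 \<and> T x = T x0 + T x1"
  and nilpotent: "\<exists>k. X\<^sub>1 \<subseteq> ker_pow UNIV D T k"
  using kato unfolding kato_decomposition_def by auto

lemma decompose: obtains x0 x1 where "x0 \<in> X\<^sub>0" "x1 \<in> X\<^sub>1" "x = x0 + x1"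
  using sum_X by blast

lemma decompose_D:
  assumes "x \<in> D" obtains x0 x1 where "x0 \<in> D" "x0 \<in> X\<^sub>0" "x1 \<in> D" "x1 \<in> X\<^sub>1" "x = x0 + x1" "T x = T x0 + T x1"
  using bspec[OF sum_D assms] by blast

lemma decompose_unique:
  assumes "a \<in> X\<^sub>0" "b \<in> X\<^sub>1" "c \<in> X\<^sub>0" "d \<in> X\<^sub>1" "a + b = c + d" shows "a = c" "b = d"
proof -
  have eq: "a - c = d - b" using assms(5) by (simp add: algebra_simps)
  have "a - c \<in> X\<^sub>0" "d - b \<in> X\<^sub>1" using assms X0(1) X1(1) by (simp_all add: cvec.subspace_diff)
  then have "a - c \<in> X\<^sub>0 \<inter> X\<^sub>1" unfolding eq by blast
  then have "a - c = 0" unfolding X_Int by blast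
  then show "a = c" "b = d" using eq by auto
qed

lemma X0_ccodim: "finite_ccodim X\<^sub>0"
proof -
  obtain B where B: "finite B" "X\<^sub>1 \<subseteq> cvec.span B" using X1(2) unfolding finite_cdim_def by blast
  have "\<exists>y\<in>X\<^sub>0. x - y \<in> cvec.span B" for x
  proof -
    obtain x0 x1 where "x0 \<in> X\<^sub>0" "x1 \<in> X\<^sub>1" "x = x0 + x1" by (rule decompose)
    then show ?thesis using B(2) by (intro bexI[of _ x0]) auto
  qed
  then show ?thesis unfolding finite_ccodim_def using B(1) by blast
qed

lemma X1_nilpotent: obtains k where "\<And>x. x \<in> X\<^sub>1 \<Longrightarrow> x \<in> D \<and> (T ^^ k) x = 0"
proof -
  obtain k where k: "X\<^sub>1 \<subseteq> ker_pow UNIV D T k" using nilpotent by blast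
  have "x \<in> D \<and> (T ^^ k) x = 0" if "x \<in> X\<^sub>1" for x
  proof (cases k)
    case 0
    then have "x = 0" using k that by (auto simp: ker_pow_def)
    then show ?thesis using cvec.subspace_0[OF D_sub] 0 by simp
  next
    case (Suc n)
    have "\<forall>i<k. (T ^^ i) x \<in> D" "(T ^^ k) x = 0" using k that unfolding ker_pow_def by blast+
    then have "(T ^^ 0) x \<in> D" "(T ^^ k) x = 0" using Suc by blast+
    then show ?thesis by simp
  qed
  then show thesis by (rule that)
qed

lemma X1_D: "X\<^sub>1 \<subseteq> D"
  using X1_nilpotent by blast

text \<open>The \<open>X\<^sub>1\<close> component satisfies the same eigenvalue equation, and the
  nilpotent part of \<open>T\<close> has no nonzero eigenvalue.\<close>

lemma eigenvector_X0:
  assumes x: "x \<in> D" "T x = z *\<^sub>C x" and z: "z \<noteq> 0" shows "x \<in> X\<^sub>0"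
proof -
  obtain x0 x1 where d: "x0 \<in> D" "x0 \<in> X\<^sub>0" "x1 \<in> D" "x1 \<in> X\<^sub>1" "x = x0 + x1" "T x = T x0 + T x1"
    using decompose_D[OF x(1)] .
  have "T x0 + T x1 = z *\<^sub>C x0 + z *\<^sub>C x1" using d x(2) by (simp add: scaleC_add_right)
  then have T1: "T x1 = z *\<^sub>C x1"
    using d X0 X1 by (intro decompose_unique[of "T x0" "T x1" "z *\<^sub>C x0" "z *\<^sub>C x1"])
      (auto intro: T_X0 T_X1 cvec.subspace_scale)
  have pow: "(T ^^ n) x1 = z ^ n *\<^sub>C x1" for n
    by (induction n) (use d(3) T1 in \<open>simp_all add: T_scale scaleC_scaleC scaleC_one mult.commute\<close>)
  obtain k where k: "\<And>x. x \<in> X\<^sub>1 \<Longrightarrow> x \<in> D \<and> (T ^^ k) x = 0" using X1_nilpotent by blast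
  then have "z ^ k *\<^sub>C x1 = 0" using pow[of k] d(4) by simp
  then have "x1 = 0" using z by simp
  then show ?thesis using d by simp
qed

lemma ran_sub: "cvec.subspace (T ` D)"
  unfolding cvec.subspace_def
proof (intro conjI ballI allI)
  show "0 \<in> T ` D" using cvec.subspace_0[OF D_sub] by (metis T_zero image_eqI)
  fix x y c assume "x \<in> T ` D" "y \<in> T ` D"
  then obtain u v where "u \<in> D" "v \<in> D" "x = T u" "y = T v" by blast
  then show "x + y \<in> T ` D" "c *\<^sub>C x \<in> T ` D"
    using T_add[of u v] T_scale[of u c] D_sub cvec.subspace_add cvec.subspace_scale by (metis image_eqI)+
qed

lemma ran_closed: "closed (T ` D)" and ran_ccodim: "finite_ccodim (T ` D)"
  and ker_cdim: "finite_cdim (ker_op D T)"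
  using fredholm_T unfolding fredholm_op_def by auto

definition valid :: "('a \<Rightarrow>\<^sub>L 'a) \<Rightarrow> bool" where
  "valid S \<longleftrightarrow> S \<in> cblinfuns \<and> range (blinfun_apply S) \<subseteq> D \<and>
     (\<forall>x\<in>D. T (S (T x)) = T x) \<and> S ` X\<^sub>0 \<subseteq> X\<^sub>0"

lemma validD:
  assumes "valid S"
  shows "S \<in> cblinfuns" "S x \<in> D" "x \<in> D \<Longrightarrow> T (S (T x)) = T x" "x \<in> X\<^sub>0 \<Longrightarrow> S x \<in> X\<^sub>0"
  using assms unfolding valid_def by auto

text \<open>The perturbation changes \<open>T (S (T x))\<close> by \<open>\<phi> (T x)\<close> times
  \<open>T v\<close>, and either alternative makes this vanish. The alternative in \<open>v\<close>
  does the same service for the invariance of \<open>X\<^sub>0\<close>.\<close>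

lemma valid_perturb:
  assumes S: "valid S" and \<phi>: "cfunctional \<phi>" and v: "v \<in> D" "v \<in> X\<^sub>0 \<or> (\<forall>x\<in>X\<^sub>0. \<phi> x = 0)"
    and Tv: "T v = 0 \<or> (\<forall>x\<in>D. \<phi> (T x) = 0)"
  obtains S' where "valid S'" "\<And>x. S' x = S x - \<phi> x *\<^sub>C v"
proof -
  obtain V where V: "V \<in> cblinfuns" "blinfun_apply V = (\<lambda>x. \<phi> x *\<^sub>C v)"
    using rank_one_exists[OF \<phi>] by blast
  have eq: "(S - V) x = S x - \<phi> x *\<^sub>C v" for x by (simp add: blinfun.diff_left V(2))
  have "valid (S - V)"
    unfolding valid_def
  proof (intro conjI ballI subsetI)
    show "S - V \<in> cblinfuns" using validD(1)[OF S] V(1) by auto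
    show "y \<in> D" if "y \<in> range (blinfun_apply (S - V))" for y
      using that validD(2)[OF S] v(1) D_sub by (auto simp: eq intro!: cvec.subspace_diff cvec.subspace_scale)
    show "T ((S - V) (T x)) = T x" if "x \<in> D" for x
    proof -
      have "T ((S - V) (T x)) = T (S (T x)) - \<phi> (T x) *\<^sub>C T v"
        using validD(2)[OF S] v(1) D_sub by (simp add: eq T_diff T_scale cvec.subspace_scale)
      then show ?thesis using validD(3)[OF S that] Tv that by auto
    qed
    show "y \<in> X\<^sub>0" if "y \<in> (S - V) ` X\<^sub>0" for y
    proof -
      have "\<exists>u\<in>X\<^sub>0. y = S u - \<phi> u *\<^sub>C v" using that unfolding image_iff eq .
      then obtain u where u: "u \<in> X\<^sub>0" "y = S u - \<phi> u *\<^sub>C v" by blast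
      have "\<phi> u *\<^sub>C v \<in> X\<^sub>0" using v(2) u(1) X0(1) by (auto simp: cvec.subspace_scale cvec.subspace_0)
      then show ?thesis using u validD(4)[OF S u(1)] X0(1) by (simp add: cvec.subspace_diff)
    qed
  qed
  then show thesis using that eq by blast
qed

text \<open>A dual basis is built by separating each \<open>b\<close> from the closed subspace
  \<open>X\<^sub>0 + span (B - {b})\<close>. The projection, a right inverse of \<open>T\<close> on
  \<open>T X\<^sub>1\<close> and the restriction of \<open>T\<close> to \<open>X\<^sub>1\<close> all
  arise in this way.\<close>

lemma operator_on_X1_basis:
  assumes B: "finite B" "B \<subseteq> X\<^sub>1" "cvec.independent B"
  obtains U where "U \<in> cblinfuns" "range (blinfun_apply U) \<subseteq> cvec.span (u ` B)"
    "\<And>x. x \<in> X\<^sub>0 \<Longrightarrow> blinfun_apply U x = 0" "\<And>b. b \<in> B \<Longrightarrow> blinfun_apply U b = u b"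
proof -
  have "\<exists>\<phi>. cfunctional \<phi> \<and> \<phi> b = 1 \<and> (\<forall>x\<in>X\<^sub>0. \<phi> x = 0) \<and> (\<forall>b'\<in>B - {b}. \<phi> b' = 0)" if b: "b \<in> B" for b
  proof -
    define F where "F = {f + s | f s. f \<in> X\<^sub>0 \<and> s \<in> cvec.span (B - {b})}"
    have F: "cvec.subspace F" unfolding F_def by (rule subspace_add_span[OF X0(1)])
    have X0F: "X\<^sub>0 \<subseteq> F"
    proof
      fix x assume "x \<in> X\<^sub>0"
      then show "x \<in> F" unfolding F_def using cvec.span_zero[of "B - {b}"]
        by (intro CollectI exI[of _ x] exI[of _ 0]) simp
    qed
    have BF: "B - {b} \<subseteq> F"
    proof
      fix x assume "x \<in> B - {b}"
      then show "x \<in> F" unfolding F_def using cvec.span_base[of x "B - {b}"] cvec.subspace_0[OF X0(1)]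
        by (intro CollectI exI[of _ 0] exI[of _ x]) simp
    qed
    have "b \<notin> F"
    proof
      assume "b \<in> F"
      then obtain f s where fs: "f \<in> X\<^sub>0" "s \<in> cvec.span (B - {b})" "b = f + s" unfolding F_def by blast
      have "s \<in> X\<^sub>1" using fs(2) cvec.span_minimal[OF _ X1(1), of "B - {b}"] B(2) by blast
      moreover have "b \<in> X\<^sub>1" using b B(2) by blast
      ultimately have "b = s"
        using decompose_unique(2)[of 0 b f s] fs cvec.subspace_0[OF X0(1)] by simp
      then show False using fs(2) B(3) b cvec.dependent_def by blast
    qed
    moreover have "closed F" by (rule closed_supspace[OF X0 X0_ccodim F X0F])
    moreover have "finite_ccodim F" by (rule finite_ccodim_mono[OF X0_ccodim X0F])
    ultimately obtain \<phi> where "cfunctional \<phi>" "\<phi> b = 1" "\<And>f. f \<in> F \<Longrightarrow> \<phi> f = 0"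
      using separating_functional[OF F, of b] by blast
    then show ?thesis using X0F BF by blast
  qed
  then obtain \<phi> where \<phi>: "\<And>b. b \<in> B \<Longrightarrow> cfunctional (\<phi> b)" "\<And>b. b \<in> B \<Longrightarrow> \<phi> b b = 1"
      "\<And>b x. b \<in> B \<Longrightarrow> x \<in> X\<^sub>0 \<Longrightarrow> \<phi> b x = 0"
      "\<And>b b'. b \<in> B \<Longrightarrow> b' \<in> B - {b} \<Longrightarrow> \<phi> b b' = 0" by metis
  have "\<exists>V. V \<in> cblinfuns \<and> blinfun_apply V = (\<lambda>x. \<phi> b x *\<^sub>C u b)" if "b \<in> B" for b
    using rank_one_exists[OF \<phi>(1)[OF that]] by metis
  then obtain V where V: "\<And>b. b \<in> B \<Longrightarrow> V b \<in> cblinfuns"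
      "\<And>b. b \<in> B \<Longrightarrow> blinfun_apply (V b) = (\<lambda>x. \<phi> b x *\<^sub>C u b)" by metis
  have eq: "blinfun_apply (sum V B) x = (\<Sum>b\<in>B. \<phi> b x *\<^sub>C u b)" for x
    unfolding blinfun_apply_sum by (rule sum.cong) (simp_all add: V(2))
  show thesis
  proof (rule that[of "sum V B"])
    show "sum V B \<in> cblinfuns" using V(1) by (rule cblinfuns_sum)
    show "range (blinfun_apply (sum V B)) \<subseteq> cvec.span (u ` B)"
      unfolding image_subset_iff eq by (intro ballI cvec.span_sum cvec.span_scale cvec.span_base imageI)
    show "blinfun_apply (sum V B) x = 0" if "x \<in> X\<^sub>0" for x
      unfolding eq using \<phi>(3) that by (intro sum.neutral) simp
    show "blinfun_apply (sum V B) b = u b" if b: "b \<in> B" for b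
    proof -
      have "(\<Sum>b'\<in>B. \<phi> b' b *\<^sub>C u b') = (\<Sum>b'\<in>{b}. \<phi> b' b *\<^sub>C u b')"
        by (rule sum.mono_neutral_right) (use B(1) b \<phi>(4) in auto)
      then show ?thesis using \<phi>(2)[OF b] by (simp add: eq scaleC_one)
    qed
  qed
qed

lemma X1_basis:
  assumes M: "cvec.subspace M" "M \<subseteq> X\<^sub>1"
  obtains B where "finite B" "B \<subseteq> M" "cvec.independent B" "M = cvec.span B"
proof -
  obtain B' where B': "finite B'" "X\<^sub>1 \<subseteq> cvec.span B'" using X1(2) unfolding finite_cdim_def by blast
  obtain B where B: "B \<subseteq> M" "cvec.independent B" "M \<subseteq> cvec.span B"
    using cvec.maximal_independent_subset by blast
  have "finite B" using cvec.independent_span_bound[OF B'(1) B(2)] B(1) M(2) B'(2) by blast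
  moreover have "M = cvec.span B" using B cvec.span_minimal[OF B(1) M(1)] by blast
  ultimately show thesis using that B by blast
qed

lemma projection:
  obtains P where "P \<in> cblinfuns" "\<And>x0 x1. x0 \<in> X\<^sub>0 \<Longrightarrow> x1 \<in> X\<^sub>1 \<Longrightarrow> blinfun_apply P (x0 + x1) = x0"
proof -
  obtain B where B: "finite B" "B \<subseteq> X\<^sub>1" "cvec.independent B" "X\<^sub>1 = cvec.span B"
    using X1_basis[OF X1(1) order_refl] by blast
  obtain U where U: "U \<in> cblinfuns" "range (blinfun_apply U) \<subseteq> cvec.span ((\<lambda>x. x) ` B)"
    "\<And>x. x \<in> X\<^sub>0 \<Longrightarrow> blinfun_apply U x = 0" "\<And>b. b \<in> B \<Longrightarrow> blinfun_apply U b = b"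
    using operator_on_X1_basis[OF B(1-3), of "\<lambda>x. x"] by blast
  have "U x = x" if "x \<in> cvec.span B" for x
    using that
    by (induction rule: cvec.span_induct_alt)
      (simp_all add: blinfun.zero_right blinfun.add_right cblinfuns_scaleC[OF U(1)] U(4))
  then show thesis
    using U B(4)
    by (intro that[of "id_blinfun - U"]) (auto simp: blinfun.diff_left blinfun.add_right)
qed

text \<open>On \<open>X\<^sub>0\<close> the generalized inverse of the regular part is used, on
  \<open>X\<^sub>1\<close> an operator choosing preimages for a basis of \<open>T X\<^sub>1\<close>;
  the projection glues them together.\<close>

lemma valid_exists: "\<exists>S. valid S"
proof -
  obtain S0 where S0: "gen_inverse X\<^sub>0 (D \<inter> X\<^sub>0) T S0" using regular_T unfolding regular_op_def by blast
  have "\<exists>K. \<forall>x\<in>X\<^sub>0. norm (S0 x) \<le> K * norm x"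
    using S0 by (simp add: gen_inverse_def bounded_op_def)
  then obtain K where K: "\<And>x. x \<in> X\<^sub>0 \<Longrightarrow> norm (S0 x) \<le> K * norm x" by blast
  have lin0: "\<And>x y. x \<in> X\<^sub>0 \<Longrightarrow> y \<in> X\<^sub>0 \<Longrightarrow> S0 (x + y) = S0 x + S0 y" "\<And>c x. x \<in> X\<^sub>0 \<Longrightarrow> S0 (c *\<^sub>C x) = c *\<^sub>C S0 x"
    and ran0: "\<And>x. x \<in> X\<^sub>0 \<Longrightarrow> S0 x \<in> D \<and> S0 x \<in> X\<^sub>0"
    and inv0: "\<And>x. x \<in> D \<Longrightarrow> x \<in> X\<^sub>0 \<Longrightarrow> T (S0 (T x)) = T x"
    using S0 unfolding gen_inverse_def bounded_op_def clinear_on_def by auto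
  obtain P where P: "P \<in> cblinfuns" "\<And>x0 x1. x0 \<in> X\<^sub>0 \<Longrightarrow> x1 \<in> X\<^sub>1 \<Longrightarrow> blinfun_apply P (x0 + x1) = x0"
    using projection by blast
  have PX: "P x \<in> X\<^sub>0" for x using P(2) decompose[of x] by metis
  have "T ` X\<^sub>1 \<subseteq> X\<^sub>1" using X1_D T_X1 by blast
  moreover have "cvec.subspace (T ` X\<^sub>1)"
    unfolding cvec.subspace_def
  proof (intro conjI ballI allI)
    show "0 \<in> T ` X\<^sub>1" using cvec.subspace_0[OF X1(1)] by (metis T_zero image_eqI)
    fix x y c assume "x \<in> T ` X\<^sub>1" "y \<in> T ` X\<^sub>1"
    then obtain u v where "u \<in> X\<^sub>1" "v \<in> X\<^sub>1" "x = T u" "y = T v" by blast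
    then show "x + y \<in> T ` X\<^sub>1" "c *\<^sub>C x \<in> T ` X\<^sub>1"
      using T_add[of u v] T_scale[of u c] X1_D X1(1) cvec.subspace_add cvec.subspace_scale
      by (metis image_eqI subsetD)+
  qed
  ultimately obtain B where B: "finite B" "B \<subseteq> T ` X\<^sub>1" "cvec.independent B" "T ` X\<^sub>1 = cvec.span B"
    using X1_basis by metis
  have "\<forall>b\<in>B. \<exists>u. u \<in> X\<^sub>1 \<and> T u = b" using B(2) by blast
  then obtain u where u: "\<And>b. b \<in> B \<Longrightarrow> u b \<in> X\<^sub>1 \<and> T (u b) = b" by metis
  have "B \<subseteq> X\<^sub>1" using B(2) \<open>T ` X\<^sub>1 \<subseteq> X\<^sub>1\<close> by blast
  then obtain U where U: "U \<in> cblinfuns" "range (blinfun_apply U) \<subseteq> cvec.span (u ` B)"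
    "\<And>x. x \<in> X\<^sub>0 \<Longrightarrow> blinfun_apply U x = 0" "\<And>b. b \<in> B \<Longrightarrow> blinfun_apply U b = u b"
    using operator_on_X1_basis[OF B(1) _ B(3), of u] by blast
  have "cvec.span (u ` B) \<subseteq> X\<^sub>1" using u by (intro cvec.span_minimal X1(1)) blast
  then have UX: "U x \<in> X\<^sub>1" for x using U(2) by blast
  then have UD: "U x \<in> D" for x using X1_D by blast
  have TU: "T (U y) = y" if "y \<in> cvec.span B" for y
    using that
  proof (induction rule: cvec.span_induct_alt)
    case (step c b y)
    then show ?case
      using u U(4) UD X1_D cvec.subspace_scale[OF D_sub]
      by (simp add: blinfun.add_right cblinfuns_scaleC[OF U(1)] T_add T_scale subsetD)
  qed (simp add: blinfun.zero_right)
  obtain S where S: "S \<in> cblinfuns" "blinfun_apply S = (\<lambda>x. S0 (P x) + U x)"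
  proof (rule cblinfun_exists[where f = "\<lambda>x. S0 (P x) + U x" and K = "\<bar>K\<bar> * norm P + norm U"])
    show "S0 (P (x + y)) + U (x + y) = S0 (P x) + U x + (S0 (P y) + U y)" for x y
      by (simp add: blinfun.add_right lin0 PX)
    show "S0 (P (c *\<^sub>C x)) + U (c *\<^sub>C x) = c *\<^sub>C (S0 (P x) + U x)" for c x
      by (simp add: cblinfuns_scaleC[OF P(1)] cblinfuns_scaleC[OF U(1)] lin0 PX scaleC_add_right)
    show "norm (S0 (P x) + U x) \<le> (\<bar>K\<bar> * norm P + norm U) * norm x" for x
    proof -
      have "norm (S0 (P x)) \<le> \<bar>K\<bar> * norm (P x)"
        by (rule order_trans[OF K[OF PX]]) (simp add: mult_right_mono)
      also have "\<dots> \<le> \<bar>K\<bar> * (norm P * norm x)" by (intro mult_left_mono norm_blinfun) simp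
      finally show ?thesis
        using norm_triangle_ineq[of "S0 (P x)" "U x"] norm_blinfun[of U x] by (simp add: algebra_simps)
    qed
  qed (rule that)
  have "valid S"
    unfolding valid_def
  proof (intro conjI ballI subsetI)
    show "y \<in> D" if "y \<in> range (blinfun_apply S)" for y
      using that ran0[OF PX] UD D_sub by (auto simp: S(2) intro!: cvec.subspace_add)
    show "y \<in> X\<^sub>0" if "y \<in> S ` X\<^sub>0" for y
      using that ran0[OF PX] U(3) by (auto simp: S(2))
    show "T (S (T x)) = T x" if x: "x \<in> D" for x
    proof -
      obtain x0 x1 where d: "x0 \<in> D" "x0 \<in> X\<^sub>0" "x1 \<in> D" "x1 \<in> X\<^sub>1" "x = x0 + x1" "T x = T x0 + T x1"
        using decompose_D[OF x] .
      have "P (T x) = T x0" unfolding d(6) using d by (intro P(2) T_X0 T_X1)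
      moreover have "U (T x) = U (T x1)" using U(3)[OF T_X0[OF d(1,2)]] by (simp add: d(6) blinfun.add_right)
      moreover have "T (U (T x1)) = T x1" using TU B(4) d(4) by blast
      ultimately show ?thesis
        using inv0[OF d(1,2)] ran0[OF T_X0[OF d(1,2)]] UD by (simp add: S(2) T_add d(6))
    qed
  qed (rule S(1))
  then show ?thesis by blast
qed

text \<open>For \<open>v\<close> in \<open>ker T \<inter> X\<^sub>0\<close> outside \<open>F\<close>
  there are two ways to grow \<open>F\<close>. Either some \<open>x\<close> of
  \<open>X\<^sub>0\<close> outside \<open>F\<close> has \<open>S x\<close> in \<open>F\<close> and
  is added with eigenvalue 0. Or \<open>v\<close> agrees with \<open>S u\<close> modulo
  \<open>F\<close>; then subtracting \<open>\<phi> x\<close> times \<open>v\<close>, with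
  \<open>\<phi> u = 1\<close> and \<open>\<phi> = 0\<close> on \<open>F\<close>, sends
  \<open>u\<close> into \<open>F\<close> and leaves \<open>S\<close> unchanged on \<open>F\<close>.
  Either way the codimension drops, though \<open>v\<close> itself may enter only later.\<close>

lemma absorb_kernel:
  assumes "codim_le F n" "valid S" "cvec.subspace F" "closed F" "F \<subseteq> X\<^sub>0" "no_char_values r S F"
  shows "\<exists>S' F'. valid S' \<and> cvec.subspace F' \<and> closed F' \<and> finite_ccodim F' \<and> F' \<subseteq> X\<^sub>0 \<and>
    no_char_values r S' F' \<and> ker_op D T \<inter> X\<^sub>0 \<subseteq> F'"
  using assms
proof (induction n arbitrary: S F)
  case 0
  then have "F = UNIV" using codim_le_0 by blast
  then show ?case using 0 finite_ccodim_UNIV by blast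
next
  case (Suc n)
  have fin: "finite_ccodim F" using Suc.prems(1) finite_ccodim_iff by blast
  have S: "S \<in> cblinfuns" "S ` X\<^sub>0 \<subseteq> X\<^sub>0" using validD[OF Suc.prems(2)] by auto
  have inv: "S ` F \<subseteq> F" using Suc.prems(6) by (simp add: no_char_values_def)
  have next_step: ?case if h: "valid S'" "u \<in> X\<^sub>0" "u \<notin> F" "S' u \<in> F" "no_char_values r S' F" for S' u
  proof (rule Suc.IH[of "add_line F u" S'])
    show "codim_le (add_line F u) n" using codim_le_add_line Suc.prems h by blast
    show "valid S'" by fact
    show "cvec.subspace (add_line F u)" "closed (add_line F u)"
      using Suc.prems by (auto intro: subspace_add_line closed_add_line)
    show "add_line F u \<subseteq> X\<^sub>0" using add_line_subset[OF X0(1)] Suc.prems h by blast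
    show "no_char_values r S' (add_line F u)"
      by (rule no_char_values_add_line[OF validD(1)[OF h(1)] Suc.prems(3) h(5,3), of 0])
        (use h(4) in auto)
  qed
  show ?case
  proof (cases "ker_op D T \<inter> X\<^sub>0 \<subseteq> F")
    case True
    then show ?thesis using Suc.prems fin by blast
  next
    case False
    then obtain v where v: "v \<in> D" "T v = 0" "v \<in> X\<^sub>0" "v \<notin> F" by (auto simp: ker_op_def)
    consider x where "x \<in> X\<^sub>0" "x \<notin> F" "S x \<in> F" | u where "u \<in> X\<^sub>0" "v - S u \<in> F"
      using preimage_mod[OF S(1) Suc.prems(3) fin v(4) X0(1) S(2) v(3)] by blast
    then show ?thesis
    proof cases
      case 1
      then show ?thesis using next_step Suc.prems by blast
    next
      case 2
      have u: "u \<notin> F"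
      proof
        assume "u \<in> F"
        then have "S u + (v - S u) \<in> F" using inv 2 cvec.subspace_add[OF Suc.prems(3)] by blast
        then show False using v(4) by simp
      qed
      obtain \<phi> where \<phi>: "cfunctional \<phi>" "\<phi> u = 1" "\<And>f. f \<in> F \<Longrightarrow> \<phi> f = 0"
        using separating_functional[OF Suc.prems(3,4) fin u] by blast
      obtain S' where S': "valid S'" "\<And>x. S' x = S x - \<phi> x *\<^sub>C v"
        using valid_perturb[OF Suc.prems(2) \<phi>(1) v(1)] v by blast
      have "no_char_values r S F = no_char_values r S' F"
        by (rule no_char_values_cong) (simp add: S'(2) \<phi>(3))
      then have "no_char_values r S' F" using Suc.prems(6) by simp
      moreover have "- 1 *\<^sub>C (v - S u) \<in> F" using 2(2) Suc.prems(3) cvec.subspace_scale by blast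
      then have "S' u \<in> F" by (simp add: S'(2) \<phi>(2) scaleC_one)
      ultimately show ?thesis using next_step S'(1) 2(1) u by blast
    qed
  qed
qed

text \<open>A vector \<open>x = z S x\<close> outside \<open>H \<supseteq> ran T\<close> is made an element of the kernel by subtracting from \<open>S\<close>
  an operator of rank one that vanishes on \<open>H\<close>.\<close>

lemma remove_char_values:
  assumes E: "cvec.subspace E" and H: "cvec.subspace H" "closed H" "finite_ccodim H" "T ` D \<subseteq> H"
    and EH: "E \<subseteq> X\<^sub>0 \<or> X\<^sub>0 \<subseteq> H"
    and hyp: "\<And>S z x. valid S \<Longrightarrow> cmod z \<le> r \<Longrightarrow> x \<in> E \<Longrightarrow> x = z *\<^sub>C S x \<Longrightarrow> x \<in> H \<Longrightarrow> x \<in> F0"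
  shows "codim_le F n \<Longrightarrow> valid S \<Longrightarrow> S ` E \<subseteq> E \<Longrightarrow> cvec.subspace F \<Longrightarrow> closed F \<Longrightarrow> F0 \<subseteq> F \<Longrightarrow> F \<subseteq> E \<Longrightarrow>
    no_char_values r S F \<Longrightarrow> \<exists>S'. valid S' \<and> S' ` E \<subseteq> E \<and> no_char_values r S' E"
proof (induction n arbitrary: S F)
  case 0
  then have "F = E" using codim_le_0 by blast
  then show ?case using 0 by blast
next
  case (Suc n)
  have fin: "finite_ccodim F" using Suc.prems(1) finite_ccodim_iff by blast
  have S: "S \<in> cblinfuns" using validD[OF Suc.prems(2)] by auto
  have next_step: ?case
    if h: "valid S'" "S' ` E \<subseteq> E" "u \<in> E" "u \<notin> F" "no_char_values r S' (add_line F u)" for S' u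
  proof (rule Suc.IH[of "add_line F u" S'])
    show "codim_le (add_line F u) n" using codim_le_add_line Suc.prems h by blast
    show "cvec.subspace (add_line F u)" "closed (add_line F u)"
      using Suc.prems by (auto intro: subspace_add_line closed_add_line)
    show "add_line F u \<subseteq> E" using add_line_subset[OF E] Suc.prems h by blast
    show "F0 \<subseteq> add_line F u" using Suc.prems(6) add_line_superset by blast
  qed (use h in auto)
  show ?case
  proof (cases "F = E")
    case True
    then show ?thesis using Suc.prems by blast
  next
    case False
    then obtain y where y: "y \<in> E" "y \<notin> F" using Suc.prems(7) by blast
    obtain x a where x: "x \<in> E" "x \<notin> F" "S x - a *\<^sub>C x \<in> F"
      using eigenvector_mod[OF S Suc.prems(4) fin y(2) E Suc.prems(3) y(1)] .
    show ?thesis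
    proof (cases "\<forall>z. cmod z \<le> r \<longrightarrow> 1 - z * a \<noteq> 0")
      case True
      then have "no_char_values r S (add_line F x)"
        by (intro no_char_values_add_line[OF S Suc.prems(4,8) x(2,3)]) blast
      then show ?thesis using next_step Suc.prems x by blast
    next
      case False
      \<comment> \<open>The eigenvalue \<open>a = 1/z\<close> is too large. Solving
        \<open>f - z S f = x - z S x\<close> inside \<open>F\<close> turns the eigenvector modulo
        \<open>F\<close> into a true solution \<open>w = x - f\<close> of
        \<open>w = z S w\<close>.\<close>
      then obtain z where z: "cmod z \<le> r" "z * a = 1" by auto
      have "(- z) *\<^sub>C (S x - a *\<^sub>C x) \<in> F" using x(3) Suc.prems(4) cvec.subspace_scale by blast
      then have "x - z *\<^sub>C S x \<in> F"
        using z(2) by (simp add: cvec.scale_right_diff_distrib scaleC_scaleC scaleC_one)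
      then obtain f where f: "f \<in> F" "f - z *\<^sub>C S f = x - z *\<^sub>C S x"
        using Suc.prems(8) z(1) unfolding no_char_values_def by blast
      define w where "w = x - f"
      have w: "w \<in> E" "w \<notin> F"
        using x f E Suc.prems(4,7) cvec.subspace_diff cvec.subspace_add[OF Suc.prems(4), of w f]
        unfolding w_def by auto
      have eq: "w = z *\<^sub>C S w"
        using f(2) by (simp add: w_def blinfun.diff_right cvec.scale_right_diff_distrib algebra_simps)
      have "w \<notin> H" using hyp[OF Suc.prems(2) z(1) w(1) eq] w(2) Suc.prems(6) by blast
      then obtain \<psi> where \<psi>: "cfunctional \<psi>" "\<psi> w = 1" "\<And>f. f \<in> H \<Longrightarrow> \<psi> f = 0"
        using separating_functional[OF H(1-3)] by blast
      have "z *\<^sub>C S w \<in> D" using validD(2)[OF Suc.prems(2)] cvec.subspace_scale[OF D_sub] by blast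
      then have "w \<in> D" using eq by simp
      then have aw: "a *\<^sub>C w \<in> D" using cvec.subspace_scale[OF D_sub] by blast
      \<comment> \<open>If \<open>E\<close> is contained in \<open>X\<^sub>0\<close>, as in the
        first pass, the vector lies in \<open>X\<^sub>0\<close>; in the second pass \<open>H\<close>
        contains \<open>X\<^sub>0\<close> and the functional vanishes there.\<close>
      have aw0: "a *\<^sub>C w \<in> X\<^sub>0 \<or> (\<forall>x\<in>X\<^sub>0. \<psi> x = 0)"
        using EH w(1) \<psi>(3) cvec.subspace_scale[OF X0(1)] by blast
      have "\<forall>x\<in>D. \<psi> (T x) = 0" using \<psi>(3) H(4) by blast
      then obtain S' where S': "valid S'" "\<And>x. S' x = S x - \<psi> x *\<^sub>C a *\<^sub>C w"
        using valid_perturb[OF Suc.prems(2) \<psi>(1) aw aw0] by blast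
      have "S w = (a * z) *\<^sub>C S w" using z(2) by (simp add: scaleC_one mult.commute)
      also have "\<dots> = a *\<^sub>C w" using eq by (metis scaleC_scaleC)
      finally have "S' w = 0" by (simp add: S'(2) \<psi>(2) scaleC_one)
      then have "no_char_values r S' (add_line F w)"
        by (intro no_char_values_add_kernel[OF validD(1)[OF S'(1)] Suc.prems(4,8) w(2),
              where \<psi> = "\<lambda>f. - (\<psi> f * a)"])
          (simp_all add: S'(2) scaleC_scaleC)
      moreover have "S' ` E \<subseteq> E"
        using Suc.prems(3) w(1) E by (auto simp: S'(2) intro!: cvec.subspace_diff cvec.subspace_scale)
      ultimately show ?thesis using next_step S'(1) w by blast
    qed
  qed
qed

end

section \<open>Generalized inverses with small spectral radius\<close>

lemma inverse_mult_less_half: "0 \<le> a \<Longrightarrow> inverse (2 * (a + 1)) * a < (1/2 :: real)"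
  by (simp add: field_simps)

context kato_operator
begin

lemma shift_add: "x \<in> D \<Longrightarrow> y \<in> D \<Longrightarrow> op_shift T z (x + y) = op_shift T z x + op_shift T z y"
  and shift_diff: "x \<in> D \<Longrightarrow> y \<in> D \<Longrightarrow> op_shift T z (x - y) = op_shift T z x - op_shift T z y"
  and shift_scale: "x \<in> D \<Longrightarrow> op_shift T z (c *\<^sub>C x) = c *\<^sub>C op_shift T z x"
  by (simp_all add: op_shift_def T_add T_diff T_scale scaleC_add_right cvec.scale_right_diff_distrib
      scaleC_scaleC mult.commute)

definition inner_inverse :: "complex \<Rightarrow> ('a \<Rightarrow>\<^sub>L 'a) \<Rightarrow> bool" where
  "inner_inverse z R \<longleftrightarrow> R \<in> cblinfuns \<and> range (blinfun_apply R) \<subseteq> D \<and>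
     (\<forall>x\<in>D. op_shift T z (R (op_shift T z x)) = op_shift T z x)"

lemma inner_inverseD:
  assumes "inner_inverse z R"
  shows "R \<in> cblinfuns" "R x \<in> D" "x \<in> D \<Longrightarrow> op_shift T z (R (op_shift T z x)) = op_shift T z x"
  using assms unfolding inner_inverse_def by auto

lemma op_shift_0: "op_shift T 0 = T"
  by (simp add: op_shift_def)

lemma valid_inner_inverse: "valid S \<Longrightarrow> inner_inverse 0 S"
  by (simp add: valid_def inner_inverse_def op_shift_0)

lemma reg_setD:
  assumes "z \<in> reg_set D T"
  obtains e M where "e > 0" "\<And>w. dist z w < e \<Longrightarrow> \<exists>R. inner_inverse w R \<and> norm R \<le> M"
proof -
  obtain V R where V: "open V" "z \<in> V" "op_analytic_on R V"
    "\<And>w. w \<in> V \<Longrightarrow> gen_inverse UNIV D (op_shift T w) (blinfun_apply (R w))"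
    using assms unfolding reg_set_def by blast
  obtain R' where "(R has_derivative R') (at z)" using V(2,3) unfolding op_analytic_on_def by blast
  then have "isCont R z" by (rule has_derivative_continuous)
  then have "(\<lambda>w. norm (R w)) \<midarrow>z\<rightarrow> norm (R z)" unfolding isCont_def by (rule tendsto_norm)
  then have "\<forall>\<^sub>F w in at z. norm (R w) < norm (R z) + 1" by (rule order_tendstoD) simp
  then obtain e1 where e1: "e1 > 0" "\<And>w. w \<noteq> z \<Longrightarrow> dist w z < e1 \<Longrightarrow> norm (R w) < norm (R z) + 1"
    unfolding eventually_at by blast
  obtain e2 where e2: "e2 > 0" "ball z e2 \<subseteq> V" using V(1,2) open_contains_ball by blast
  show thesis
  proof (rule that[of "min e1 e2" "norm (R z) + 1"])
    show "min e1 e2 > 0" using e1 e2 by simp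
    fix w assume w: "dist z w < min e1 e2"
    then have "w \<in> V" using e2(2) by (auto simp: subset_iff)
    then have "R w \<in> cblinfuns" "gen_inverse UNIV D (op_shift T w) (blinfun_apply (R w))"
      using V(3,4) unfolding op_analytic_on_def by blast+
    then have "inner_inverse w (R w)" unfolding inner_inverse_def gen_inverse_def by simp
    moreover have "norm (R w) \<le> norm (R z) + 1"
      using w e1(2)[of w] by (cases "w = z") (auto simp: dist_commute)
    ultimately show "\<exists>Q. inner_inverse w Q \<and> norm Q \<le> norm (R z) + 1" by blast
  qed
qed

definition fred :: "complex \<Rightarrow> bool" where
  "fred z \<longleftrightarrow> finite_cdim (ker_op D (op_shift T z)) \<and> finite_ccodim (op_shift T z ` D)"

text \<open>\<open>y - (T - z) R y\<close> is linear in \<open>y\<close> and vanishes on the range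
  of \<open>T - z\<close>, so its values are spanned by those at representatives of the
  cokernel.\<close>

lemma inner_inverse_cokernel:
  assumes R: "inner_inverse z R" and "finite_ccodim (op_shift T z ` D)"
  obtains C where "finite C" "\<And>y. y - op_shift T z (R y) \<in> cvec.span C"
proof -
  let ?Q = "\<lambda>y. y - op_shift T z (R y)"
  obtain B where B: "finite B" "\<And>x. \<exists>y\<in>op_shift T z ` D. x - y \<in> cvec.span B"
    using assms(2) unfolding finite_ccodim_def by blast
  have Q_add: "?Q (x + y) = ?Q x + ?Q y" for x y
    using inner_inverseD(2)[OF R] by (simp add: blinfun.add_right shift_add)
  have Q_scale: "?Q (c *\<^sub>C x) = c *\<^sub>C ?Q x" for x c
    using inner_inverseD(1,2)[OF R] by (simp add: cblinfuns_scaleC shift_scale cvec.scale_right_diff_distrib)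
  have span: "?Q s \<in> cvec.span (?Q ` B)" if "s \<in> cvec.span B" for s
    using that
  proof (induction rule: cvec.span_induct_alt)
    case base
    have "?Q 0 = 0" using Q_scale[of 0 0] by simp
    then show ?case by (simp only: cvec.span_zero)
  next
    case (step c b y)
    then show ?case unfolding Q_add Q_scale
      by (intro cvec.span_add cvec.span_scale) (auto intro: cvec.span_base)
  qed
  have "?Q y \<in> cvec.span (?Q ` B)" for y
  proof -
    obtain u where u: "u \<in> D" "y - op_shift T z u \<in> cvec.span B" using B(2) by blast
    have "?Q y = ?Q (op_shift T z u) + ?Q (y - op_shift T z u)" using Q_add[of "op_shift T z u" "y - op_shift T z u"] by simp
    also have "\<dots> = ?Q (y - op_shift T z u)" using inner_inverseD(3)[OF R u(1)] by simp
    finally show ?thesis using span[OF u(2)] by (simp only:)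
  qed
  then show thesis using B(1) that by blast
qed

text \<open>Let \<open>B\<close> be the inverse of \<open>1 - (w - z) R\<close>. A vector
  \<open>x\<close> in the kernel of \<open>T - w\<close> is \<open>B\<close> applied to
  \<open>x - R (T - z) x\<close>, which lies in the kernel of \<open>T - z\<close>. For the
  cokernel, \<open>x - (T - w) R B x = B x - (T - z) R B x\<close> stays in a fixed
  finite-dimensional space.\<close>

lemma fred_transfer:
  assumes R: "inner_inverse z R" and close: "cmod (w - z) * norm R < 1" and "fred z"
  shows "fred w"
proof -
  let ?U = "(w - z) *\<^sub>C R"
  have Rc: "R \<in> cblinfuns" and RD: "R x \<in> D" for x using inner_inverseD[OF R] by auto
  obtain B where B: "B \<in> cblinfuns" "(id_blinfun - ?U) o\<^sub>L B = id_blinfun" "B o\<^sub>L (id_blinfun - ?U) = id_blinfun"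
    using neumann[of ?U] Rc close by (auto simp: norm_scaleC)
  have B1: "B x - (w - z) *\<^sub>C R (B x) = x" for x
    using arg_cong[OF B(2), of "\<lambda>F. blinfun_apply F x"] by (simp add: blinfun.diff_left)
  have B2: "B (x - (w - z) *\<^sub>C R x) = x" for x
    using arg_cong[OF B(3), of "\<lambda>F. blinfun_apply F x"] by (simp add: blinfun.diff_left)
  have shift: "op_shift T w x = op_shift T z x - (w - z) *\<^sub>C x" for x
    by (simp add: op_shift_def cvec.scale_left_diff_distrib)
  have "ker_op D (op_shift T w) \<subseteq> B ` ker_op D (op_shift T z)"
  proof
    fix x assume "x \<in> ker_op D (op_shift T w)"
    then have x: "x \<in> D" "op_shift T z x = (w - z) *\<^sub>C x" by (auto simp: ker_op_def shift)
    let ?y = "x - (w - z) *\<^sub>C R x"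
    have y: "?y = x - R (op_shift T z x)" using x(2) by (simp add: cblinfuns_scaleC[OF Rc])
    have "op_shift T z ?y = 0" unfolding y using x(1) RD inner_inverseD(3)[OF R x(1)] by (simp add: shift_diff)
    moreover have "?y \<in> D" unfolding y using x(1) RD D_sub by (simp add: cvec.subspace_diff)
    ultimately have "?y \<in> ker_op D (op_shift T z)" by (simp add: ker_op_def)
    then show "x \<in> B ` ker_op D (op_shift T z)" using B2[of x] by (metis image_eqI)
  qed
  then have 1: "finite_cdim (ker_op D (op_shift T w))"
    using \<open>fred z\<close> finite_cdim_subset finite_cdim_image[OF B(1)] unfolding fred_def by blast
  obtain C where C: "finite C" "\<And>y. y - op_shift T z (R y) \<in> cvec.span C"
    using inner_inverse_cokernel[OF R] \<open>fred z\<close> unfolding fred_def by blast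
  have "\<exists>y\<in>op_shift T w ` D. x - y \<in> cvec.span C" for x
  proof -
    have "x - op_shift T w (R (B x)) = B x - op_shift T z (R (B x))"
      using B1[of x] by (simp add: shift algebra_simps)
    then show ?thesis using C(2)[of "B x"] RD by (metis image_eqI)
  qed
  then have 2: "finite_ccodim (op_shift T w ` D)" unfolding finite_ccodim_def using C(1) by blast
  show ?thesis using 1 2 by (simp add: fred_def)
qed

lemma fred_0: "fred 0"
  using ker_cdim ran_ccodim by (simp add: fred_def op_shift_0)

end

section \<open>The punctured disc of regular points\<close>

locale kato_disc = kato_operator +
  fixes d :: real
  assumes reg: "\<And>z. z \<noteq> 0 \<Longrightarrow> cmod z < d \<Longrightarrow> z \<in> reg_set D T"
begin

text \<open>A valid \<open>S\<close> carries the Fredholm property from 0 to a nearby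
  \<open>t > 0\<close>; from there locally bounded inner inverses spread it over the punctured
  disc.\<close>

lemma fred_disc:
  assumes "cmod z < d" shows "fred z"
proof (cases "z = 0")
  case True
  then show ?thesis using fred_0 by simp
next
  case False
  obtain S where S: "valid S" using valid_exists by blast
  define t where "t = min (d / 2) (inverse (2 * (norm S + 1)))"
  have d: "d > 0" using assms norm_ge_zero[of z] by linarith
  have "0 < 2 * (norm S + 1)" by (simp add: add_nonneg_pos)
  then have t: "t > 0" "t < d" using d unfolding t_def by (auto simp: min_less_iff_disj)
  have "t * norm S < 1"
  proof -
    have "t * norm S \<le> inverse (2 * (norm S + 1)) * norm S" unfolding t_def by (intro mult_right_mono) auto
    also have "\<dots> < 1" using inverse_mult_less_half[of "norm S"] by simp
    finally show ?thesis .
  qed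
  then have start: "fred (of_real t)"
    using fred_transfer[OF valid_inner_inverse[OF S] _ fred_0, of "of_real t"] t by simp
  have conn: "connected (ball 0 d - {0 :: complex})" by (rule connected_punctured_ball) simp
  show ?thesis
  proof (rule connected_induction_simple[OF conn, of "of_real t" z fred])
    show "of_real t \<in> ball 0 d - {0 :: complex}" "z \<in> ball 0 d - {0}" using t False assms by auto
    show "fred (of_real t)" by (rule start)
    fix a :: complex assume a: "a \<in> ball 0 d - {0}"
    then have "a \<in> reg_set D T" by (intro reg) auto
    then obtain e M where e: "e > 0" "\<And>w. dist a w < e \<Longrightarrow> \<exists>R. inner_inverse w R \<and> norm R \<le> M"
      using reg_setD by blast
    \<comment> \<open>Two points of the ball are less than \<open>2 * e'\<close> apart, and with
      this radius the product with the local bound \<open>M\<close> stays below 1.\<close>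
    define e' where "e' = min e (inverse (2 * (\<bar>M\<bar> + 1)))"
    have e': "e' > 0" "e' \<le> e" "2 * e' * \<bar>M\<bar> < 1"
    proof -
      show "e' > 0" "e' \<le> e" using e(1) by (auto simp: e'_def add_nonneg_pos)
      have "2 * e' * \<bar>M\<bar> \<le> 2 * inverse (2 * (\<bar>M\<bar> + 1)) * \<bar>M\<bar>"
        unfolding e'_def by (intro mult_right_mono mult_left_mono) auto
      also have "\<dots> < 1" using inverse_mult_less_half[of "\<bar>M\<bar>"] by simp
      finally show "2 * e' * \<bar>M\<bar> < 1" .
    qed
    show "\<exists>U. openin (top_of_set (ball 0 d - {0})) U \<and> a \<in> U \<and> (\<forall>x\<in>U. \<forall>y\<in>U. fred x \<longrightarrow> fred y)"
    proof (intro exI[of _ "(ball 0 d - {0}) \<inter> ball a e'"] conjI ballI impI)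
      show "openin (top_of_set (ball 0 d - {0})) ((ball 0 d - {0}) \<inter> ball a e')" by (rule openin_open_Int) simp
      show "a \<in> (ball 0 d - {0}) \<inter> ball a e'" using a e'(1) by auto
      fix x y assume x: "x \<in> (ball 0 d - {0}) \<inter> ball a e'" and y: "y \<in> (ball 0 d - {0}) \<inter> ball a e'" and "fred x"
      obtain R where R: "inner_inverse x R" "norm R \<le> M" using e(2)[of x] x e'(2) by auto
      have "dist x y \<le> dist a x + dist a y" by (rule dist_triangle3)
      then have "cmod (y - x) \<le> 2 * e'" using x y by (simp add: dist_norm norm_minus_commute)
      then have "cmod (y - x) * norm R \<le> 2 * e' * \<bar>M\<bar>" using R(2) e'(1) by (intro mult_mono) auto
      then have "cmod (y - x) * norm R < 1" using e'(3) by simp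
      then show "fred y" by (rule fred_transfer[OF R(1) _ \<open>fred x\<close>])
    qed
  qed
qed

text \<open>For \<open>z \<noteq> 0\<close> take \<open>B = 1 + z R\<close>. Then
  \<open>(1 - z S) B - 1 = z (R - S T R) + z S ((T - z) R - 1)\<close> has its first term in
  \<open>ker T\<close>, and \<open>B (1 - z S) - 1 = z R (1 - T S) + z (R (T - z) S - S)\<close> has
  its second in \<open>ker (T - z)\<close>. The other terms factor through finite-dimensional
  cokernels.\<close>

lemma parametrix_exists:
  assumes S: "valid S" and z: "cmod z < d"
  shows "\<exists>B\<in>cblinfuns. finite_rank (((id_blinfun - z *\<^sub>C S) o\<^sub>L B) - id_blinfun) \<and>
    finite_rank ((B o\<^sub>L (id_blinfun - z *\<^sub>C S)) - id_blinfun)"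
proof (cases "z = 0")
  case True
  have "(((id_blinfun - z *\<^sub>C S) o\<^sub>L id_blinfun) - id_blinfun) = 0"
    "((id_blinfun o\<^sub>L (id_blinfun - z *\<^sub>C S)) - id_blinfun) = 0"
    using True by (auto intro!: blinfun_eqI simp: blinfun.diff_left)
  then show ?thesis using finite_rank_zero by (intro bexI[of _ id_blinfun]) auto
next
  case False
  then have "z \<in> reg_set D T" using z by (rule reg)
  then obtain R where R: "inner_inverse z R" using reg_setD by (metis dist_self)
  have Rc: "R \<in> cblinfuns" and RD: "R x \<in> D" for x using inner_inverseD[OF R] by auto
  have Sc: "S \<in> cblinfuns" and SD: "S x \<in> D" for x using validD[OF S] by auto
  have fr: "fred z" by (rule fred_disc[OF z])
  obtain C where C: "finite C" "\<And>y. y - op_shift T z (R y) \<in> cvec.span C"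
    using inner_inverse_cokernel[OF R] fr unfolding fred_def by blast
  obtain C0 where C0: "finite C0" "\<And>y. y - T (S y) \<in> cvec.span C0"
    using inner_inverse_cokernel[OF valid_inner_inverse[OF S]] fred_0 unfolding fred_def op_shift_0 by blast
  let ?A = "id_blinfun - z *\<^sub>C S" and ?B = "id_blinfun + z *\<^sub>C R"
  have fin: "finite_cdim (cvec.span C)" "finite_cdim (cvec.span C0)"
    using C(1) C0(1) unfolding finite_cdim_def by blast+
  have kz: "finite_cdim (ker_op D (op_shift T z))" using fr by (simp add: fred_def)
  have shift: "op_shift T z x = T x - z *\<^sub>C x" for x by (simp add: op_shift_def)
  have "finite_rank ((?A o\<^sub>L ?B) - id_blinfun)"
  proof (rule finite_rankI[OF _ ker_cdim finite_cdim_image[OF Sc fin(1)]])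
    show "(?A o\<^sub>L ?B) - id_blinfun \<in> cblinfuns" using Rc Sc by auto
    fix x
    let ?m = "z *\<^sub>C (R x - S (T (R x)))" and ?q = "op_shift T z (R x) - x"
    have "((?A o\<^sub>L ?B) - id_blinfun) x = ?m + S (z *\<^sub>C ?q)"
      by (simp add: blinfun.bilinear_simps cblinfuns_scaleC[OF Sc] shift
          cvec.scale_right_diff_distrib scaleC_scaleC algebra_simps)
    moreover have "?m \<in> ker_op D T"
      using RD SD D_sub validD(3)[OF S RD]
      by (simp add: ker_op_def T_scale T_diff cvec.subspace_scale cvec.subspace_diff)
    moreover have "(- z) *\<^sub>C (x - op_shift T z (R x)) \<in> cvec.span C" using C(2) by (rule cvec.span_scale)
    then have "z *\<^sub>C ?q \<in> cvec.span C" by (simp add: cvec.scale_right_diff_distrib)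
    ultimately show "\<exists>m\<in>ker_op D T. \<exists>n\<in>S ` cvec.span C. ((?A o\<^sub>L ?B) - id_blinfun) x = m + n" by blast
  qed
  moreover have "finite_rank ((?B o\<^sub>L ?A) - id_blinfun)"
  proof (rule finite_rankI[OF _ finite_cdim_image[OF Rc fin(2)] kz])
    show "(?B o\<^sub>L ?A) - id_blinfun \<in> cblinfuns" using Rc Sc by auto
    fix x
    let ?n = "z *\<^sub>C (R (op_shift T z (S x)) - S x)"
    have "((?B o\<^sub>L ?A) - id_blinfun) x = R (z *\<^sub>C (x - T (S x))) + ?n"
      by (simp add: blinfun.bilinear_simps cblinfuns_scaleC[OF Rc] shift
          cvec.scale_right_diff_distrib scaleC_scaleC algebra_simps)
    moreover have "?n \<in> ker_op D (op_shift T z)"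
      using RD SD D_sub inner_inverseD(3)[OF R SD]
      by (simp add: ker_op_def shift_scale shift_diff cvec.subspace_scale cvec.subspace_diff)
    moreover have "z *\<^sub>C (x - T (S x)) \<in> cvec.span C0" using C0(2) by (rule cvec.span_scale)
    ultimately show "\<exists>m\<in>R ` cvec.span C0. \<exists>n\<in>ker_op D (op_shift T z). ((?B o\<^sub>L ?A) - id_blinfun) x = m + n"
      by blast
  qed
  moreover have "?B \<in> cblinfuns" using Rc by auto
  ultimately show ?thesis by blast
qed

text \<open>The eigenspaces of \<open>T\<close> are lower semicontinuous on the punctured disc, and all but finitely many of
  them lie in \<open>F\<close> because their elements outside \<open>F\<close> are eigenvectors of \<open>S\<close> modulo \<open>F\<close>.\<close>

lemma eigenvectors_absorbed:
  assumes S: "valid S" and F: "cvec.subspace F" "closed F" "finite_ccodim F" "S ` F \<subseteq> F"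
    and ker: "ker_op D T \<inter> X\<^sub>0 \<subseteq> F" and z: "z \<noteq> 0" "cmod z < d" and x: "x \<in> D" "T x = z *\<^sub>C x"
  shows "x \<in> F"
proof -
  let ?\<Lambda> = "{z. z \<noteq> 0 \<and> (\<exists>w. w \<notin> F \<and> w - z *\<^sub>C S w \<in> F)}"
  have fin: "finite ?\<Lambda>" by (rule eigenvalues_mod_finite[OF validD(1)[OF S] F(1,3,4)])
  \<comment> \<open>\<open>y - w S y = y - S (T y)\<close> lies in
    \<open>ker T \<inter> X\<^sub>0\<close>, hence in \<open>F\<close>; for \<open>w\<close> outside
    the finite set this forces \<open>y\<close> itself into \<open>F\<close>.\<close>
  have good: "y \<in> F" if y: "y \<in> D" "T y = w *\<^sub>C y" "w \<noteq> 0" "w \<notin> ?\<Lambda>" for y w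
  proof -
    have yX: "y \<in> X\<^sub>0" by (rule eigenvector_X0[OF y(1-3)])
    have eq: "y - w *\<^sub>C S y = y - S (T y)" using y(2) by (simp add: cblinfuns_scaleC[OF validD(1)[OF S]])
    have "y - S (T y) \<in> ker_op D T"
      using y(1) validD(2,3)[OF S] D_sub by (simp add: ker_op_def T_diff cvec.subspace_diff)
    moreover have "y - S (T y) \<in> X\<^sub>0"
      using yX validD(4)[OF S T_X0[OF y(1) yX]] X0(1) by (simp add: cvec.subspace_diff)
    ultimately have "y - w *\<^sub>C S y \<in> F" using ker eq by auto
    then show ?thesis using y(3,4) by blast
  qed
  obtain e M where e: "e > 0" "\<And>w. dist z w < e \<Longrightarrow> \<exists>R. inner_inverse w R \<and> norm R \<le> M"
    using reg_setD[OF reg[OF z]] by blast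
  then obtain R where R: "\<And>w. dist z w < e \<Longrightarrow> inner_inverse w (R w)" "\<And>w. dist z w < e \<Longrightarrow> norm (R w) \<le> M"
    by metis
  \<comment> \<open>Equivalently \<open>f w = x - R w ((T - w) x)\<close>, a vector in the kernel of
    \<open>T - w\<close>; it tends to \<open>x\<close> as \<open>w\<close> tends to \<open>z\<close>
    because \<open>R\<close> is locally bounded.\<close>
  define f where "f w = x - (z - w) *\<^sub>C R w x" for w
  have f: "f w \<in> D \<and> T (f w) = w *\<^sub>C f w" if "dist z w < e" for w
  proof -
    have Rw: "inner_inverse w (R w)" by (rule R(1)[OF that])
    have shift: "op_shift T w x = (z - w) *\<^sub>C x" using x(2) by (simp add: op_shift_def cvec.scale_left_diff_distrib)
    have eq: "f w = x - R w (op_shift T w x)"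
      unfolding f_def shift by (simp add: cblinfuns_scaleC[OF inner_inverseD(1)[OF Rw]])
    have fD: "f w \<in> D" unfolding eq using x(1) inner_inverseD(2)[OF Rw] D_sub by (simp add: cvec.subspace_diff)
    have "op_shift T w (f w) = 0"
      unfolding eq using x(1) inner_inverseD(2,3)[OF Rw] by (simp add: shift_diff)
    then show ?thesis using fD by (simp add: op_shift_def)
  qed
  have ev: "\<forall>\<^sub>F w in at z. dist z w < e" using e(1) by (auto simp: eventually_at dist_commute)
  have "(f \<longlongrightarrow> x) (at z)"
  proof (rule Lim_null[THEN iffD2, OF tendsto_norm_zero_cancel], rule tendsto_sandwich[OF _ _ tendsto_const])
    show "\<forall>\<^sub>F w in at z. 0 \<le> norm (f w - x)" by simp
    show "\<forall>\<^sub>F w in at z. norm (f w - x) \<le> cmod (z - w) * (\<bar>M\<bar> * norm x)"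
      using ev
    proof eventually_elim
      case (elim w)
      have "norm (R w x) \<le> \<bar>M\<bar> * norm x"
        using R(2)[OF elim] by (intro order_trans[OF norm_blinfun mult_right_mono]) auto
      then show ?case by (simp add: f_def norm_scaleC mult_left_mono)
    qed
    have "((\<lambda>w. cmod (z - w) * (\<bar>M\<bar> * norm x)) \<longlongrightarrow> cmod (z - z) * (\<bar>M\<bar> * norm x)) (at z)"
      by (intro tendsto_intros)
    then show "((\<lambda>w. cmod (z - w) * (\<bar>M\<bar> * norm x)) \<longlongrightarrow> 0) (at z)" by simp
  qed
  moreover have "\<forall>\<^sub>F w in at z. f w \<in> F"
  proof -
    have "open (- (?\<Lambda> - {z}))" using fin by (intro open_Compl finite_imp_closed) auto
    then have "\<forall>\<^sub>F w in at z. w \<in> - (?\<Lambda> - {z})" by (intro eventually_at_in_open') auto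
    moreover have "\<forall>\<^sub>F w in at z. w \<noteq> 0" using z(1) by (intro tendsto_imp_eventually_ne[OF tendsto_ident_at])
    moreover have "\<forall>\<^sub>F w in at z. w \<noteq> z" by (simp add: eventually_at_filter)
    ultimately show ?thesis using ev
    proof eventually_elim
      case (elim w)
      then show ?case using f[of w] good[of "f w" w] by blast
    qed
  qed
  ultimately show ?thesis using Lim_in_closed_set[OF F(2) _ trivial_limit_at] by blast
qed

theorem exists_valid_invertible:
  assumes r: "0 \<le> r" "r < d"
  obtains S where "valid S" "\<And>z. cmod z \<le> r \<Longrightarrow>
    \<exists>C\<in>cblinfuns. (id_blinfun - z *\<^sub>C S) o\<^sub>L C = id_blinfun \<and> C o\<^sub>L (id_blinfun - z *\<^sub>C S) = id_blinfun"
proof -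
  obtain S where S: "valid S" using valid_exists by blast
  have Sc: "S \<in> cblinfuns" by (rule validD(1)[OF S])
  \<comment> \<open>The spectral radius formula gives decay only strictly inside a closed disc of
    invertibility, so a radius between \<open>r\<close> and \<open>d\<close> is inserted.\<close>
  obtain r1 where r1: "r < r1" "r1 < d" using dense[OF r(2)] by blast
  interpret ess: op_seminorm "ess_norm :: ('a \<Rightarrow>\<^sub>L 'a) \<Rightarrow> real" by (rule op_seminorm_ess)
  have inv: "\<exists>b. ess.inv_mod S z b" if "cmod z \<le> r1" for z
  proof -
    have "cmod z < d" using that r1 by simp
    then show ?thesis
      using parametrix_exists[OF S] ess_norm_finite_rank unfolding ess.inv_mod_def by blast
  qed
  have lim: "(\<lambda>m. r ^ 2 ^ m * ess_norm (ess.iter_sq S m)) \<longlonglongrightarrow> 0"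
    by (rule ess.spectral_radius_formula[OF Sc inv r(1) r1(1)])
  have "\<forall>\<^sub>F m in sequentially. r ^ 2 ^ m * ess_norm (ess.iter_sq S m) < 1/4"
    using order_tendstoD(2)[OF lim, of "1/4"] by simp
  then obtain m where m: "r ^ 2 ^ m * ess_norm (ess.iter_sq S m) < 1/4"
    using eventually_happens'[OF sequentially_bot] by blast
  let ?P = "ess.iter_sq S m"
  have "\<exists>K. finite_rank K \<and> r ^ 2 ^ m * norm (?P - K) < 1/4"
  proof (cases "r = 0")
    case True
    then show ?thesis using finite_rank_zero by (intro exI[of _ 0]) (auto simp: power_0_left)
  next
    case False
    then have p: "r ^ 2 ^ m > 0" using r(1) by simp
    then have "ess_norm ?P < 1/4 / r ^ 2 ^ m" using m by (simp add: field_simps)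
    then obtain K where "finite_rank K" "norm (?P - K) < 1/4 / r ^ 2 ^ m" using ess_norm_less by blast
    then show ?thesis using p by (intro exI[of _ K]) (simp add: field_simps)
  qed
  then obtain K where K: "finite_rank K" "r ^ 2 ^ m * norm (?P - K) < 1/4" by blast
  interpret riesz: riesz_operator S ?P K "2 ^ m" r
  proof
    fix z assume "cmod z \<le> r"
    then have "cmod z < d" using r by simp
    then show "\<exists>B\<in>cblinfuns. finite_rank (((id_blinfun - z *\<^sub>C S) o\<^sub>L B) - id_blinfun)"
      using parametrix_exists[OF S] by blast
  qed (use Sc K r in \<open>simp_all add: ess.iter_sq_apply\<close>)
  have "riesz.admissible X\<^sub>0"
    unfolding riesz.admissible_def using X0 X0_ccodim validD(4)[OF S] by blast
  then obtain F where F: "riesz.admissible F" "F \<subseteq> X\<^sub>0"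
      "\<And>z. cmod z \<le> r \<Longrightarrow> (id_blinfun - z *\<^sub>C S) ` F = F"
    using riesz.admissible_surjective by blast
  have F': "cvec.subspace F" "closed F" "finite_ccodim F" "S ` F \<subseteq> F"
    using F(1) unfolding riesz.admissible_def by auto
  have "no_char_values r S F"
    unfolding no_char_values_def
  proof (intro conjI allI impI ballI)
    show "S ` F \<subseteq> F" by (rule F'(4))
    fix z :: complex assume z: "cmod z \<le> r"
    have inj: "inj_on (id_blinfun - z *\<^sub>C S) F" by (rule riesz.surjective_imp_injective[OF F(1) z F(3)[OF z]])
    show "f = 0" if "f \<in> F" "f - z *\<^sub>C S f = 0" for f
      using inj_onD[OF inj, of f 0] that cvec.subspace_0[OF F'(1)]
      by (simp add: blinfun.diff_left blinfun.zero_right)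
    show "\<exists>f\<in>F. f - z *\<^sub>C S f = g" if "g \<in> F" for g
    proof -
      have "g \<in> (id_blinfun - z *\<^sub>C S) ` F" using F(3)[OF z] that by simp
      then show ?thesis by (auto simp: blinfun.diff_left)
    qed
  qed
  moreover obtain n where "codim_le F n" using F'(3) finite_ccodim_iff by blast
  ultimately obtain S1 F1 where 1: "valid S1" "cvec.subspace F1" "closed F1" "finite_ccodim F1" "F1 \<subseteq> X\<^sub>0"
      "no_char_values r S1 F1" "ker_op D T \<inter> X\<^sub>0 \<subseteq> F1"
    using absorb_kernel[OF _ S F'(1,2) F(2)] by blast
  have inv1: "S1 ` F1 \<subseteq> F1" using 1(6) by (simp add: no_char_values_def)
  have eig: "x \<in> F1" if "x \<in> D" "T x = z *\<^sub>C x" "z \<noteq> 0" "cmod z \<le> r" for x z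
    using eigenvectors_absorbed[OF 1(1-4) inv1 1(7) that(3) _ that(1,2)] that(4) r by simp
  \<comment> \<open>First pass, with \<open>H = ran T\<close>. If \<open>x = z S' x\<close> and
    \<open>x = T u\<close>, then \<open>T x = z T S' T u = z x\<close>, so \<open>x\<close> lies in
    \<open>F1\<close> for every valid \<open>S'\<close>, not just for \<open>S1\<close>.\<close>
  have "\<exists>S'. valid S' \<and> S' ` X\<^sub>0 \<subseteq> X\<^sub>0 \<and> no_char_values r S' X\<^sub>0"
  proof -
    obtain n where "codim_le F1 n" using 1(4) finite_ccodim_iff by blast
    moreover have "S1 ` X\<^sub>0 \<subseteq> X\<^sub>0" using validD(4)[OF 1(1)] by blast
    moreover have "x \<in> F1" if h: "valid S'" "cmod z \<le> r" "x \<in> X\<^sub>0" "x = z *\<^sub>C S' x" "x \<in> T ` D" for S' z x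
    proof (cases "z = 0")
      case True
      then show ?thesis using h(4) cvec.subspace_0[OF 1(2)] by simp
    next
      case False
      obtain u where u: "u \<in> D" "x = T u" using h(5) by blast
      have "z *\<^sub>C S' x \<in> D" using validD(2)[OF h(1)] cvec.subspace_scale[OF D_sub] by blast
      then have "x \<in> D" using h(4) by simp
      moreover have "T (z *\<^sub>C S' x) = z *\<^sub>C T (S' x)" by (rule T_scale[OF validD(2)[OF h(1)]])
      then have "T x = z *\<^sub>C x" using h(4) validD(3)[OF h(1) u(1)] u(2) by simp
      ultimately show ?thesis using eig False h(2) by blast
    qed
    ultimately show ?thesis
      using remove_char_values[OF X0(1) ran_sub ran_closed ran_ccodim order_refl, of r F1 F1 n S1] 1 by blast
  qed
  then obtain S2 where 2: "valid S2" "no_char_values r S2 X\<^sub>0" by blast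
  \<comment> \<open>Second pass: functionals that vanish on \<open>ran T + X\<^sub>0\<close> leave
    the operator unchanged on \<open>X\<^sub>0\<close>, so the outcome of the first pass
    survives.\<close>
  define H where "H = {u + w | u w. u \<in> T ` D \<and> w \<in> X\<^sub>0}"
  have H: "cvec.subspace H" unfolding H_def by (rule cvec.subspace_sums[OF ran_sub X0(1)])
  have RH: "T ` D \<subseteq> H" and XH: "X\<^sub>0 \<subseteq> H"
    unfolding H_def using cvec.subspace_0[OF ran_sub] cvec.subspace_0[OF X0(1)]
    by (force simp del: T_zero)+
  have H': "closed H" "finite_ccodim H"
    using closed_supspace[OF X0 X0_ccodim H XH] finite_ccodim_mono[OF X0_ccodim XH] by auto
  have "\<exists>S'. valid S' \<and> S' ` UNIV \<subseteq> UNIV \<and> no_char_values r S' UNIV"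
  proof -
    obtain n where n: "codim_le X\<^sub>0 n" using X0_ccodim finite_ccodim_iff by blast
    have "x \<in> X\<^sub>0" if h: "valid S'" "cmod z \<le> r" "x = z *\<^sub>C S' x" "x \<in> H" for S' z x
    proof (cases "z = 0")
      case True
      then show ?thesis using h(3) cvec.subspace_0[OF X0(1)] by simp
    next
      case False
      obtain u w where u: "u \<in> D" "w \<in> X\<^sub>0" "x = T u + w" using h(4) unfolding H_def by blast
      have SD: "S' y \<in> D" for y by (rule validD(2)[OF h(1)])
      have "z *\<^sub>C S' x \<in> D" using SD cvec.subspace_scale[OF D_sub] by blast
      then have xD: "x \<in> D" using h(3) by simp
      obtain x0 x1 where d: "x0 \<in> D" "x0 \<in> X\<^sub>0" "x1 \<in> D" "x1 \<in> X\<^sub>1" "x = x0 + x1" "T x = T x0 + T x1"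
        using decompose_D[OF xD] .
      have "T (S' x) = T u + T (S' w)"
        unfolding u(3) using SD validD(3)[OF h(1) u(1)] by (simp add: blinfun.add_right T_add)
      then have TS: "T (S' x) = x + (T (S' w) - w)" using u(3) by simp
      define w' where "w' = T (S' w) - w"
      have w': "w' \<in> X\<^sub>0"
        unfolding w'_def using T_X0[OF SD validD(4)[OF h(1) u(2)]] u(2) X0(1) by (simp add: cvec.subspace_diff)
      have "T (z *\<^sub>C S' x) = z *\<^sub>C T (S' x)" by (rule T_scale[OF SD])
      then have "T x = z *\<^sub>C (x + w')" using h(3) TS w'_def by simp
      then have "T x0 + T x1 = z *\<^sub>C (x0 + w') + z *\<^sub>C x1"
        using d(5,6) by (simp add: scaleC_add_right algebra_simps)
      \<comment> \<open>Comparing \<open>X\<^sub>1\<close> components removes \<open>w'\<close> and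
        leaves an eigenvector equation for the nilpotent part.\<close>
      then have "T x1 = z *\<^sub>C x1"
        using d w' X0(1) X1(1)
        by (intro decompose_unique(2)[of "T x0" "T x1" "z *\<^sub>C (x0 + w')" "z *\<^sub>C x1"])
          (auto intro: T_X0 T_X1 cvec.subspace_scale cvec.subspace_add)
      then have "x1 \<in> X\<^sub>0" using eigenvector_X0 d(3) False by blast
      then show ?thesis using d(2,5) X0(1) by (simp add: cvec.subspace_add)
    qed
    then show ?thesis
      using remove_char_values[OF cvec.subspace_UNIV H H' RH, of r X\<^sub>0 X\<^sub>0 n S2] XH n 2 X0 by blast
  qed
  then obtain S3 where 3: "valid S3" "no_char_values r S3 UNIV" by blast
  show thesis
  proof (rule that[OF 3(1)])
    fix z assume z: "cmod z \<le> r"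
    let ?A = "id_blinfun - z *\<^sub>C S3"
    obtain B where B: "B \<in> cblinfuns" "finite_rank ((B o\<^sub>L ?A) - id_blinfun)"
      using parametrix_exists[OF 3(1), of z] z r by auto
    have A: "?A \<in> cblinfuns" using validD(1)[OF 3(1)] by auto
    show "\<exists>C\<in>cblinfuns. ?A o\<^sub>L C = id_blinfun \<and> C o\<^sub>L ?A = id_blinfun"
    proof (rule bounded_inverse_of_parametrix[OF A B])
      show "x = 0" if "?A x = 0" for x
        using 3(2) z that unfolding no_char_values_def by (simp add: blinfun.diff_left)
      show "\<exists>x. ?A x = y" for y
        using 3(2) z unfolding no_char_values_def by (simp add: blinfun.diff_left)
    qed
  qed
qed

end

section \<open>Analytic families of generalized inverses\<close>

text \<open>The resolvent identity alone gives differentiability: it bounds \<open>F v\<close> by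
  twice \<open>norm (F w)\<close> near \<open>w\<close>, and applied once more it makes the
  remainder quadratic. It serves with \<open>N = S\<close> for the inverse of \<open>1 - w S\<close>
  and with \<open>N = 1\<close> for that of \<open>J - w\<close>.\<close>

lemma resolvent_has_derivative:
  fixes F :: "complex \<Rightarrow> 'a::complex_normed_vector \<Rightarrow>\<^sub>L 'a"
  assumes V: "open V" "w \<in> V"
    and F: "\<And>u v. u \<in> V \<Longrightarrow> v \<in> V \<Longrightarrow> F v - F u = (v - u) *\<^sub>C (F v o\<^sub>L (N o\<^sub>L F u))"
    and Fc: "\<And>v. v \<in> V \<Longrightarrow> F v \<in> cblinfuns"
  shows "(F has_derivative (\<lambda>h. h *\<^sub>C (F w o\<^sub>L (N o\<^sub>L F w)))) (at w)"
proof -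
  let ?G = "N o\<^sub>L F w"
  obtain e where e: "e > 0" "ball w e \<subseteq> V" using V open_contains_ball by blast
  define c where "c = inverse (2 * (norm ?G + 1))"
  have c: "c > 0" by (simp add: c_def add_nonneg_pos)
  have cG: "c * norm ?G < 1/2" unfolding c_def by (rule inverse_mult_less_half) simp
  have bound: "norm (F v) \<le> 2 * norm (F w)" if v: "v \<in> V" "cmod (v - w) < c" for v
  proof -
    have "norm (F v - F w) = cmod (v - w) * norm (F v o\<^sub>L ?G)"
      unfolding F[OF V(2) v(1)] by (rule norm_scaleC)
    also have "\<dots> \<le> cmod (v - w) * (norm (F v) * norm ?G)"
      by (intro mult_left_mono norm_blinfun_compose) simp
    also have "\<dots> \<le> c * (norm (F v) * norm ?G)"
      using v(2) by (intro mult_right_mono) auto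
    also have "\<dots> = (c * norm ?G) * norm (F v)" by simp
    also have "\<dots> \<le> 1/2 * norm (F v)" using cG by (intro mult_right_mono) auto
    finally have "norm (F v - F w) \<le> 1/2 * norm (F v)" .
    moreover have "norm (F v) \<le> norm (F w) + norm (F v - F w)" by (rule norm_triangle_sub)
    ultimately show ?thesis by simp
  qed
  define M where "M = 2 * norm (F w) * norm ?G * norm ?G"
  show ?thesis
  proof (rule has_derivativeI_sandwich[where e = "min e c" and H = "\<lambda>v. cmod (v - w) * M"])
    show "0 < min e c" using e c by simp
    show "bounded_linear (\<lambda>h. h *\<^sub>C (F w o\<^sub>L ?G))"
      by (rule bounded_bilinear.bounded_linear_left[OF bounded_bilinear_scaleC])
    have "((\<lambda>v. cmod (v - w) * M) \<longlongrightarrow> cmod (w - w) * M) (at w)" by (intro tendsto_intros)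
    then show "((\<lambda>v. cmod (v - w) * M) \<longlongrightarrow> 0) (at w)" by simp
    fix v assume "v \<noteq> w" and d: "dist v w < min e c"
    have v: "v \<in> V" "cmod (v - w) < c" using d e(2) by (auto simp: dist_norm dist_commute subset_iff norm_minus_commute)
    have "F v - F w - (v - w) *\<^sub>C (F w o\<^sub>L ?G) = (v - w) *\<^sub>C ((F v - F w) o\<^sub>L ?G)"
      unfolding F[OF V(2) v(1)]
      by (subst F[OF V(2) v(1), symmetric], rule blinfun_eqI)
        (simp add: blinfun.diff_left cvec.scale_right_diff_distrib)
    also have "norm \<dots> = cmod (v - w) * norm ((F v - F w) o\<^sub>L ?G)" by (rule norm_scaleC)
    also have "(F v - F w) o\<^sub>L ?G = (v - w) *\<^sub>C ((F v o\<^sub>L ?G) o\<^sub>L ?G)"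
      unfolding F[OF V(2) v(1)] by (rule blinfun_eqI) simp
    also have "norm \<dots> = cmod (v - w) * norm ((F v o\<^sub>L ?G) o\<^sub>L ?G)" by (rule norm_scaleC)
    also have "norm ((F v o\<^sub>L ?G) o\<^sub>L ?G) \<le> norm (F v) * norm ?G * norm ?G"
      by (rule order_trans[OF norm_blinfun_compose mult_right_mono[OF norm_blinfun_compose]]) simp
    also have "\<dots> \<le> M" unfolding M_def using bound[OF v] by (intro mult_right_mono) auto
    finally have "norm (F v - F w - (v - w) *\<^sub>C (F w o\<^sub>L ?G)) \<le> cmod (v - w) * (cmod (v - w) * M)"
      by (simp add: mult_left_mono)
    then show "norm (F v - F w - (v - w) *\<^sub>C (F w o\<^sub>L ?G)) / norm (v - w) \<le> cmod (v - w) * M"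
      using \<open>v \<noteq> w\<close> by (simp add: pos_divide_le_eq mult_ac)
  qed
qed

lemma geometric_telescope:
  fixes S :: "'a::complex_normed_vector \<Rightarrow>\<^sub>L 'a"
  assumes S: "S \<in> cblinfuns"
  shows "(\<Sum>n<N. z ^ n *\<^sub>C (blinfun_apply S ^^ n) y) - z *\<^sub>C S (\<Sum>n<N. z ^ n *\<^sub>C (blinfun_apply S ^^ n) y)
    = y - z ^ N *\<^sub>C (blinfun_apply S ^^ N) y"
proof (induction N)
  case (Suc N)
  let ?s = "\<Sum>n<N. z ^ n *\<^sub>C (blinfun_apply S ^^ n) y" and ?t = "z ^ N *\<^sub>C (blinfun_apply S ^^ N) y"
  have "(?s + ?t) - z *\<^sub>C S (?s + ?t) = (?s - z *\<^sub>C S ?s) + (?t - z *\<^sub>C S ?t)"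
    by (simp add: blinfun.add_right scaleC_add_right)
  also have "\<dots> = y - z *\<^sub>C S ?t" unfolding Suc by simp
  also have "z *\<^sub>C S ?t = z ^ Suc N *\<^sub>C (blinfun_apply S ^^ Suc N) y"
    by (simp add: cblinfuns_scaleC[OF S] scaleC_scaleC)
  finally show ?case by simp
qed (simp add: blinfun.zero_right scaleC_one)

primrec blinfun_pow :: "('a::complex_normed_vector \<Rightarrow>\<^sub>L 'a) \<Rightarrow> nat \<Rightarrow> 'a \<Rightarrow>\<^sub>L 'a" where
  "blinfun_pow S 0 = id_blinfun"
| "blinfun_pow S (Suc n) = S o\<^sub>L blinfun_pow S n"

lemma blinfun_pow_cblinfuns: "S \<in> cblinfuns \<Longrightarrow> blinfun_pow S n \<in> cblinfuns"
  by (induction n) auto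

lemma blinfun_pow_apply: "blinfun_apply (blinfun_pow S n) = (blinfun_apply S ^^ n)"
  by (induction n) (auto simp: fun_eq_iff)

text \<open>The Neumann series terminates: \<open>E\<close> is the sum of
  \<open>- J^n / w^(n+1)\<close> over \<open>n < N\<close>.\<close>

lemma nilpotent_resolvent:
  fixes J :: "'a::complex_normed_vector \<Rightarrow>\<^sub>L 'a"
  assumes J: "J \<in> cblinfuns" "\<And>x. (blinfun_apply J ^^ N) x = 0" and w: "w \<noteq> 0"
  shows "\<exists>E\<in>cblinfuns. \<forall>x. J (E x) - w *\<^sub>C E x = x \<and> E (J x - w *\<^sub>C x) = x"
proof -
  let ?z = "inverse w"
  let ?C = "\<Sum>n<N. ?z ^ n *\<^sub>C blinfun_pow J n"
  have Cx: "?C x = (\<Sum>n<N. ?z ^ n *\<^sub>C (blinfun_apply J ^^ n) x)" for x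
    by (simp add: blinfun_apply_sum blinfun_pow_apply)
  have C: "?C \<in> cblinfuns" using blinfun_pow_cblinfuns[OF J(1)] by auto
  have 1: "?C x - ?z *\<^sub>C J (?C x) = x" for x
    unfolding Cx geometric_telescope[OF J(1)] using J(2) by simp
  have comm: "?C (J x) = J (?C x)" for x
    unfolding Cx by (simp add: blinfun.sum_right cblinfuns_scaleC[OF J(1)] funpow_swap1)
  define E where "E = (- ?z) *\<^sub>C ?C"
  have Ex: "E x = - (?z *\<^sub>C ?C x)" for x unfolding E_def by (simp add: blinfun.minus_left)
  have "J (E x) - w *\<^sub>C E x = ?C x - ?z *\<^sub>C J (?C x)" for x
    using w by (simp add: Ex blinfun.minus_right cblinfuns_scaleC[OF J(1)] scaleC_scaleC scaleC_one)
  moreover have "E (J x - w *\<^sub>C x) = ?C x - ?z *\<^sub>C J (?C x)" for x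
    using w by (simp add: Ex blinfun.diff_right cblinfuns_scaleC[OF C] comm scaleC_scaleC scaleC_one
        cvec.scale_right_diff_distrib)
  moreover have "E \<in> cblinfuns" using C by (auto simp: E_def)
  ultimately show ?thesis using 1 by (intro bexI[of _ E]) auto
qed

lemma invertible_iff_not_spectrum:
  fixes S :: "'a::complex_normed_vector \<Rightarrow>\<^sub>L 'a"
  assumes w: "w \<noteq> 0" and S: "S \<in> cblinfuns"
  shows "inverse w \<notin> op_spectrum S \<longleftrightarrow>
    (\<exists>C\<in>cblinfuns. (id_blinfun - w *\<^sub>C S) o\<^sub>L C = id_blinfun \<and> C o\<^sub>L (id_blinfun - w *\<^sub>C S) = id_blinfun)"
    (is "?l \<longleftrightarrow> ?r")
proof -
  let ?A = "id_blinfun - w *\<^sub>C S" and ?B = "S - inverse w *\<^sub>C id_blinfun"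
  have 1: "?A o\<^sub>L ((- inverse w) *\<^sub>C B) = ?B o\<^sub>L B" "((- inverse w) *\<^sub>C B) o\<^sub>L ?A = B o\<^sub>L ?B"
    if "B \<in> cblinfuns" for B
    using w by (auto intro!: blinfun_eqI simp: blinfun.bilinear_simps cblinfuns_scaleC[OF that]
        cblinfuns_scaleC[OF S] scaleC_scaleC scaleC_one cvec.scale_right_diff_distrib)
  have 2: "?B o\<^sub>L ((- w) *\<^sub>C C) = ?A o\<^sub>L C" "((- w) *\<^sub>C C) o\<^sub>L ?B = C o\<^sub>L ?A" if "C \<in> cblinfuns" for C
    using w by (auto intro!: blinfun_eqI simp: blinfun.bilinear_simps cblinfuns_scaleC[OF that]
        cblinfuns_scaleC[OF S] scaleC_scaleC scaleC_one cvec.scale_right_diff_distrib)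
  show ?thesis
  proof
    assume ?l
    then obtain B where B: "B \<in> cblinfuns" "?B o\<^sub>L B = id_blinfun" "B o\<^sub>L ?B = id_blinfun"
      unfolding op_spectrum_def by blast
    then show ?r using 1[OF B(1)] by (intro bexI[of _ "(- inverse w) *\<^sub>C B"]) auto
  next
    assume ?r
    then obtain C where C: "C \<in> cblinfuns" "?A o\<^sub>L C = id_blinfun" "C o\<^sub>L ?A = id_blinfun" by blast
    have "(- w) *\<^sub>C C \<in> cblinfuns" using C(1) by (rule cblinfuns_scale)
    then show ?l unfolding op_spectrum_def using 2[OF C(1)] C(2,3) by force
  qed
qed

lemma inverse_antimono_ennreal: "a \<le> b \<Longrightarrow> inverse b \<le> inverse (a :: ennreal)"
proof (cases "a = 0 \<or> b = top")
  case False
  assume "a \<le> b"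
  moreover from False obtain s where s: "b = ennreal s" "0 \<le> s" by (cases b) auto
  moreover from False \<open>a \<le> b\<close> s obtain r where "a = ennreal r" "0 < r"
    by (cases a) (auto simp: top_unique less_le)
  ultimately show ?thesis by (simp add: inverse_ennreal ennreal_leI le_imp_inverse_le)
qed auto

section \<open>From valid operators to analytic families of generalized inverses\<close>

context kato_operator
begin

lemma restriction_X1:
  obtains J N where "J \<in> cblinfuns" "\<And>x. x \<in> X\<^sub>1 \<Longrightarrow> blinfun_apply J x = T x"
    "\<And>x. blinfun_apply J x \<in> X\<^sub>1" "\<And>x. (blinfun_apply J ^^ N) x = 0"
proof -
  obtain B where B: "finite B" "B \<subseteq> X\<^sub>1" "cvec.independent B" "X\<^sub>1 = cvec.span B"
    using X1_basis[OF X1(1) order_refl] by blast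
  obtain J where J: "J \<in> cblinfuns" "range (blinfun_apply J) \<subseteq> cvec.span (T ` B)"
    "\<And>x. x \<in> X\<^sub>0 \<Longrightarrow> blinfun_apply J x = 0" "\<And>b. b \<in> B \<Longrightarrow> blinfun_apply J b = T b"
    using operator_on_X1_basis[OF B(1-3), of T] by blast
  have "T ` B \<subseteq> X\<^sub>1" using B(2) X1_D T_X1 by blast
  then have JX: "J x \<in> X\<^sub>1" for x using J(2) cvec.span_minimal[OF _ X1(1)] by blast
  have "x \<in> D \<and> J x = T x" if "x \<in> X\<^sub>1" for x
    using that unfolding B(4)
  proof (induction rule: cvec.span_induct_alt)
    case (step c b y)
    then have "b \<in> D" "y \<in> D" using B(2) X1_D by auto
    then show ?case
      using step J(4) cvec.subspace_scale[OF D_sub] cvec.subspace_add[OF D_sub]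
      by (simp add: blinfun.add_right cblinfuns_scaleC[OF J(1)] T_add T_scale)
  qed (simp add: blinfun.zero_right cvec.subspace_0[OF D_sub])
  then have JT: "J x = T x" if "x \<in> X\<^sub>1" for x using that by blast
  obtain k where k: "\<And>x. x \<in> X\<^sub>1 \<Longrightarrow> x \<in> D \<and> (T ^^ k) x = 0" using X1_nilpotent by blast
  have pow: "(blinfun_apply J ^^ n) x = (T ^^ n) x \<and> (T ^^ n) x \<in> X\<^sub>1" if "x \<in> X\<^sub>1" for n x
    using that by (induction n) (use JT X1_D T_X1 in auto)
  \<comment> \<open>One extra power, because the first application only brings an arbitrary
    \<open>x\<close> into \<open>X\<^sub>1\<close>.\<close>
  have "(blinfun_apply J ^^ Suc k) x = 0" for x
    unfolding funpow_Suc_right using pow[OF JX] k[OF JX] by simp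
  then show thesis using that J(1) JT JX by blast
qed

lemma bounded_gen_inverse_comp:
  assumes "gen_inverse X\<^sub>0 (D \<inter> X\<^sub>0) T S0"
  obtains K where "\<And>x. x \<in> D \<Longrightarrow> x \<in> X\<^sub>0 \<Longrightarrow> norm (S0 (T x)) \<le> K * norm x"
proof -
  have lin: "\<And>c x. x \<in> X\<^sub>0 \<Longrightarrow> S0 (c *\<^sub>C x) = c *\<^sub>C S0 x"
    and cont: "continuous_on (D \<inter> X\<^sub>0) (\<lambda>x. S0 (T x))"
    using assms unfolding gen_inverse_def bounded_op_def clinear_on_def by auto
  have 0: "(0::'a) \<in> D \<inter> X\<^sub>0" using cvec.subspace_0 D_sub X0(1) by blast
  have "S0 (T 0) = 0" using lin[of 0 0] 0 by simp
  then obtain e where e: "e > 0" "\<And>x. x \<in> D \<inter> X\<^sub>0 \<Longrightarrow> norm x < e \<Longrightarrow> norm (S0 (T x)) < 1"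
    using cont[unfolded continuous_on_iff, rule_format, OF 0, of 1] by (auto simp: dist_norm)
  have "norm (S0 (T x)) \<le> (2 / e) * norm x" if x: "x \<in> D" "x \<in> X\<^sub>0" for x
  proof (cases "x = 0")
    case True
    then show ?thesis using \<open>S0 (T 0) = 0\<close> by simp
  next
    case False
    define t where "t = e / (2 * norm x)"
    have t: "t > 0" "t * norm x < e" using e(1) False by (auto simp: t_def)
    let ?y = "complex_of_real t *\<^sub>C x"
    have "?y \<in> D \<inter> X\<^sub>0" using x D_sub X0(1) by (auto intro: cvec.subspace_scale)
    moreover have "norm ?y < e" using t by (simp add: norm_scaleC)
    ultimately have "norm (S0 (T ?y)) < 1" by (rule e(2))
    moreover have "S0 (T ?y) = complex_of_real t *\<^sub>C S0 (T x)"
      using x by (simp add: T_scale lin T_X0)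
    ultimately have "t * norm (S0 (T x)) < 1" using t(1) by (simp add: norm_scaleC)
    then show ?thesis using e(1) False by (simp add: t_def field_simps)
  qed
  then show thesis by (rule that)
qed

text \<open>By induction \<open>S^n y\<close> lies in the kernel of \<open>T^(n+1)\<close>, hence by
  regularity in the range of \<open>T\<close>, and there \<open>T S\<close> is the identity.\<close>

lemma valid_kernel_chain:
  assumes S: "valid S" and y: "y \<in> ker_op D T" "y \<in> X\<^sub>0"
  shows "T ((blinfun_apply S ^^ Suc n) y) = (blinfun_apply S ^^ n) y"
proof (induction n rule: less_induct)
  case (less n)
  let ?s = "\<lambda>n. (blinfun_apply S ^^ n) y"
  have mem: "?s m \<in> D \<inter> X\<^sub>0" for m
    by (induction m) (use y validD(2,4)[OF S] in \<open>auto simp: ker_op_def\<close>)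
  have pow: "i \<le> n \<Longrightarrow> (T ^^ i) (?s n) = ?s (n - i)" for i
  proof (induction i)
    case (Suc i)
    then have "(T ^^ Suc i) (?s n) = T (?s (Suc (n - Suc i)))" by (simp add: Suc_diff_Suc)
    also have "\<dots> = ?s (n - Suc i)" using Suc.prems by (intro less.IH) simp
    finally show ?case .
  qed simp
  have "?s n \<in> ker_pow X\<^sub>0 (D \<inter> X\<^sub>0) T (Suc n)"
    unfolding ker_pow_def using mem pow y(1) by (auto simp: less_Suc_eq_le ker_op_def)
  then have "?s n \<in> T ` (D \<inter> X\<^sub>0)" using regular_T unfolding regular_op_def by blast
  then obtain u where u: "u \<in> D" "?s n = T u" by blast
  then show ?case using validD(3)[OF S u(1)] by simp
qed

text \<open>On the domain \<open>T S (T - w) = T (1 - w S)\<close>, so on \<open>X\<^sub>0\<close>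
  the operator \<open>S0 T S (T - w) = S0 T (1 - w S)\<close> is continuous. Applying the inverse
  \<open>C w\<close> of \<open>1 - w S\<close> gives the identity up to
  \<open>C w (ker T \<inter> X\<^sub>0)\<close>, which lies in the kernel of
  \<open>T - w\<close>.\<close>

theorem valid_invertible_imp_regular:
  assumes S: "valid S" and inv: "\<And>w. cmod w \<le> r \<Longrightarrow>
      \<exists>C\<in>cblinfuns. (id_blinfun - w *\<^sub>C S) o\<^sub>L C = id_blinfun \<and> C o\<^sub>L (id_blinfun - w *\<^sub>C S) = id_blinfun"
    and z: "z \<noteq> 0" "cmod z < r"
  shows "z \<in> reg_set D T"
proof -
  have Sc: "S \<in> cblinfuns" and SD: "S x \<in> D" and STS: "x \<in> D \<Longrightarrow> T (S (T x)) = T x"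
    and SX: "x \<in> X\<^sub>0 \<Longrightarrow> S x \<in> X\<^sub>0" for x
    using validD[OF S] by auto
  define V where "V = ball 0 r - {0 :: complex}"
  have V: "open V" "z \<in> V" using z by (auto simp: V_def)
  have Vr: "cmod w \<le> r" "cmod w < r" "w \<noteq> 0" if "w \<in> V" for w using that by (auto simp: V_def)
  obtain C where C: "\<And>w. cmod w \<le> r \<Longrightarrow> C w \<in> cblinfuns"
      "\<And>w. cmod w \<le> r \<Longrightarrow> (id_blinfun - w *\<^sub>C S) o\<^sub>L C w = id_blinfun"
      "\<And>w. cmod w \<le> r \<Longrightarrow> C w o\<^sub>L (id_blinfun - w *\<^sub>C S) = id_blinfun"
    using inv by metis
  have AC: "C w x - w *\<^sub>C S (C w x) = x" if "cmod w \<le> r" for w x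
    using arg_cong[OF C(2)[OF that], of "\<lambda>F. blinfun_apply F x"] by (simp add: blinfun.diff_left)
  have CA: "C w (x - w *\<^sub>C S x) = x" if "cmod w \<le> r" for w x
    using arg_cong[OF C(3)[OF that], of "\<lambda>F. blinfun_apply F x"] by (simp add: blinfun.diff_left)
  interpret nrm: op_seminorm "norm :: ('a \<Rightarrow>\<^sub>L 'a) \<Rightarrow> real" by (rule op_seminorm_norm)
  \<comment> \<open>Only the exponents \<open>2 ^ m\<close> are controlled; that is enough, since
    the partial sums below are taken along this subsequence.\<close>
  have null: "(\<lambda>m. w ^ 2 ^ m *\<^sub>C (blinfun_apply S ^^ (2 ^ m)) y) \<longlonglongrightarrow> 0" if "cmod w < r" for w y
  proof (rule tendsto_norm_zero_cancel, rule tendsto_sandwich[OF _ _ tendsto_const])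
    have "\<exists>b. nrm.inv_mod S v b" if "cmod v \<le> r" for v
      using C[OF that] unfolding nrm.inv_mod_def by (intro exI[of _ "C v"]) simp
    then have "(\<lambda>m. cmod w ^ 2 ^ m * norm (nrm.iter_sq S m)) \<longlonglongrightarrow> 0"
      using nrm.spectral_radius_formula[OF Sc _ norm_ge_zero that] by blast
    then show "(\<lambda>m. (cmod w ^ 2 ^ m * norm (nrm.iter_sq S m)) * norm y) \<longlonglongrightarrow> 0"
      by (rule tendsto_mult_left_zero)
    show "\<forall>\<^sub>F m in sequentially. norm (w ^ 2 ^ m *\<^sub>C (blinfun_apply S ^^ (2 ^ m)) y) \<le>
        (cmod w ^ 2 ^ m * norm (nrm.iter_sq S m)) * norm y"
      using norm_blinfun[of "nrm.iter_sq S m" y for m]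
      by (intro always_eventually allI)
        (simp add: norm_scaleC norm_power nrm.iter_sq_apply mult.assoc mult_left_mono)
  qed simp
  define part where "part w y N = (\<Sum>n<N. w ^ n *\<^sub>C (blinfun_apply S ^^ n) y)" for w y and N :: nat
  have part: "(\<lambda>m. part w y (2 ^ m)) \<longlonglongrightarrow> C w y" if w: "cmod w < r" for w y
  proof -
    have eq: "part w y N = C w y - C w (w ^ N *\<^sub>C (blinfun_apply S ^^ N) y)" for N
      using CA[of w "part w y N"] geometric_telescope[OF Sc, of w y N, folded part_def] w
      by (simp add: blinfun.diff_right)
    have "(\<lambda>m. C w y - C w (w ^ 2 ^ m *\<^sub>C (blinfun_apply S ^^ (2 ^ m)) y)) \<longlonglongrightarrow> C w y - C w 0"
      by (intro tendsto_intros blinfun.tendsto null[OF w])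
    then show ?thesis by (simp add: eq blinfun.zero_right)
  qed
  have Spow: "(blinfun_apply S ^^ n) y \<in> X\<^sub>0" if "y \<in> X\<^sub>0" for n y
    using that SX by (induction n) auto
  \<comment> \<open>The inverse of an operator that leaves a subspace invariant need not do so; here
    it does, as a limit of partial sums of the Neumann series in the closed
    \<open>X\<^sub>0\<close>.\<close>
  have CX: "C w y \<in> X\<^sub>0" if "cmod w < r" "y \<in> X\<^sub>0" for w y
  proof (rule closed_sequentially[OF X0(2) _ part[OF that(1)]])
    show "part w y (2 ^ m) \<in> X\<^sub>0" for m
      unfolding part_def using Spow[OF that(2)] X0(1) by (intro cvec.subspace_sum cvec.subspace_scale)
  qed
  have CD: "C w y \<in> D" if "cmod w < r" "y \<in> D" for w y
  proof -
    have "C w y = y + w *\<^sub>C S (C w y)" using AC[of w y] that(1) by (simp add: algebra_simps)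
    moreover have "y + w *\<^sub>C S (C w y) \<in> D"
      using that(2) SD D_sub by (intro cvec.subspace_add cvec.subspace_scale)
    ultimately show ?thesis by simp
  qed
  \<comment> \<open>By the chain relation \<open>T\<close> maps the partial sum of length
    \<open>N + 1\<close> to \<open>w\<close> times that of length \<open>N\<close>. Along the
    subsequence both sums tend to \<open>C w y\<close>, and \<open>T\<close> is closed.\<close>
  have Cker: "C w y \<in> D \<and> T (C w y) = w *\<^sub>C C w y" if w: "cmod w < r" and y: "y \<in> ker_op D T" "y \<in> X\<^sub>0" for w y
  proof (rule T_closed)
    let ?N = "\<lambda>m::nat. (2::nat) ^ m"
    have powD: "(blinfun_apply S ^^ n) y \<in> D" for n
      by (cases n) (use y SD in \<open>auto simp: ker_op_def\<close>)
    show "part w y (Suc (?N m)) \<in> D" for m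
      unfolding part_def using powD D_sub by (intro cvec.subspace_sum cvec.subspace_scale)
    have "(\<lambda>m. part w y (?N m) + w ^ ?N m *\<^sub>C (blinfun_apply S ^^ ?N m) y) \<longlonglongrightarrow> C w y + 0"
      by (intro tendsto_add part[OF w] null[OF w])
    then show "(\<lambda>m. part w y (Suc (?N m))) \<longlonglongrightarrow> C w y" by (simp add: part_def)
    have "T (part w y (Suc N)) = w *\<^sub>C part w y N" for N
    proof (induction N)
      case 0
      then show ?case using y(1) by (simp add: part_def ker_op_def scaleC_one)
    next
      case (Suc N)
      have "part w y (Suc N) \<in> D"
        unfolding part_def using powD D_sub by (intro cvec.subspace_sum cvec.subspace_scale)
      moreover have "part w y (Suc (Suc N)) = part w y (Suc N) + w ^ Suc N *\<^sub>C (blinfun_apply S ^^ Suc N) y"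
        by (simp add: part_def)
      ultimately have "T (part w y (Suc (Suc N))) =
          w *\<^sub>C part w y N + w ^ Suc N *\<^sub>C T ((blinfun_apply S ^^ Suc N) y)"
        using powD[of "Suc N"] Suc D_sub by (simp only: T_add T_scale cvec.subspace_scale)
      also have "\<dots> = w *\<^sub>C part w y (Suc N)"
        unfolding valid_kernel_chain[OF S y] by (simp add: part_def scaleC_add_right scaleC_scaleC)
      finally show ?case .
    qed
    then show "(\<lambda>m. T (part w y (Suc (?N m)))) \<longlonglongrightarrow> w *\<^sub>C C w y"
      by (simp only:) (intro tendsto_scaleC tendsto_const part[OF w])
  qed
  obtain S0 where S0: "gen_inverse X\<^sub>0 (D \<inter> X\<^sub>0) T S0" using regular_T unfolding regular_op_def by blast
  have lin0: "\<And>x y. x \<in> X\<^sub>0 \<Longrightarrow> y \<in> X\<^sub>0 \<Longrightarrow> S0 (x + y) = S0 x + S0 y" "\<And>c x. x \<in> X\<^sub>0 \<Longrightarrow> S0 (c *\<^sub>C x) = c *\<^sub>C S0 x"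
    and ran0: "\<And>x. x \<in> X\<^sub>0 \<Longrightarrow> S0 x \<in> D" "\<And>x. x \<in> X\<^sub>0 \<Longrightarrow> S0 x \<in> X\<^sub>0"
    and inv0: "\<And>x. x \<in> D \<Longrightarrow> x \<in> X\<^sub>0 \<Longrightarrow> T (S0 (T x)) = T x" "\<And>x. x \<in> X\<^sub>0 \<Longrightarrow> S0 (T (S0 x)) = S0 x"
    and cont0: "continuous_on (D \<inter> X\<^sub>0) (\<lambda>x. S0 (T x))"
    using S0 unfolding gen_inverse_def bounded_op_def clinear_on_def by auto
  obtain K where K: "\<And>x. x \<in> D \<Longrightarrow> x \<in> X\<^sub>0 \<Longrightarrow> norm (S0 (T x)) \<le> K * norm x" using bounded_gen_inverse_comp[OF S0] by blast
  obtain P where P: "P \<in> cblinfuns" "\<And>x0 x1. x0 \<in> X\<^sub>0 \<Longrightarrow> x1 \<in> X\<^sub>1 \<Longrightarrow> blinfun_apply P (x0 + x1) = x0"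
    using projection by blast
  have PX: "P x \<in> X\<^sub>0" and QX: "x - P x \<in> X\<^sub>1" for x
  proof -
    obtain x0 x1 where x: "x0 \<in> X\<^sub>0" "x1 \<in> X\<^sub>1" "x = x0 + x1" by (rule decompose)
    then have "P x = x0" using P(2) by simp
    then show "P x \<in> X\<^sub>0" "x - P x \<in> X\<^sub>1" using x by auto
  qed
  have SPD: "S (P x) \<in> D" "S (P x) \<in> X\<^sub>0" "T (S (P x)) \<in> X\<^sub>0" for x
    using SD SX[OF PX] T_X0 by blast+
  obtain U where U: "U \<in> cblinfuns" "blinfun_apply U = (\<lambda>x. S0 (T (S (P x))))"
  proof (rule cblinfun_exists[where f = "\<lambda>x. S0 (T (S (P x)))" and K = "\<bar>K\<bar> * norm (S o\<^sub>L P)"])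
    show "S0 (T (S (P (x + y)))) = S0 (T (S (P x))) + S0 (T (S (P y)))" for x y
      using SPD by (simp add: blinfun.add_right T_add lin0)
    show "S0 (T (S (P (c *\<^sub>C x)))) = c *\<^sub>C S0 (T (S (P x)))" for c x
      using SPD by (simp add: cblinfuns_scaleC[OF P(1)] cblinfuns_scaleC[OF Sc] T_scale lin0)
    show "norm (S0 (T (S (P x)))) \<le> \<bar>K\<bar> * norm (S o\<^sub>L P) * norm x" for x
    proof -
      have "norm (S0 (T (S (P x)))) \<le> \<bar>K\<bar> * norm (S (P x))"
        by (rule order_trans[OF K[OF SPD(1,2)]]) (simp add: mult_right_mono)
      also have "\<dots> \<le> \<bar>K\<bar> * (norm (S o\<^sub>L P) * norm x)"
        using norm_blinfun[of "S o\<^sub>L P" x] by (intro mult_left_mono) auto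
      finally show ?thesis by (simp add: mult.assoc)
    qed
  qed (rule that)
  have UD: "U x \<in> D" and UX: "U x \<in> X\<^sub>0" for x
    using ran0[OF SPD(3)] by (auto simp: U(2))
  obtain J N where J: "J \<in> cblinfuns" "\<And>x. x \<in> X\<^sub>1 \<Longrightarrow> blinfun_apply J x = T x"
    "\<And>x. blinfun_apply J x \<in> X\<^sub>1" "\<And>x. (blinfun_apply J ^^ N) x = 0"
    using restriction_X1 by blast
  have "\<forall>w. \<exists>E. w \<noteq> 0 \<longrightarrow> E \<in> cblinfuns \<and> (\<forall>x. J (E x) - w *\<^sub>C E x = x \<and> E (J x - w *\<^sub>C x) = x)"
    using nilpotent_resolvent[OF J(1,4)] by blast
  then obtain E where E: "\<And>w. w \<noteq> 0 \<Longrightarrow> E w \<in> cblinfuns"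
      "\<And>w x. w \<noteq> 0 \<Longrightarrow> J (E w x) - w *\<^sub>C E w x = x" "\<And>w x. w \<noteq> 0 \<Longrightarrow> E w (J x - w *\<^sub>C x) = x"
    by metis
  have EX: "E w x \<in> X\<^sub>1" if "w \<noteq> 0" "x \<in> X\<^sub>1" for w x
  proof -
    have "inverse w *\<^sub>C (J (E w x) - x) \<in> X\<^sub>1"
      using J(3) that(2) X1(1) by (intro cvec.subspace_scale cvec.subspace_diff)
    moreover have "J (E w x) - x = w *\<^sub>C E w x" using E(2)[OF that(1), of x] by (simp add: algebra_simps)
    ultimately show ?thesis using that(1) by (simp add: scaleC_scaleC scaleC_one)
  qed
  define R where "R w = (C w o\<^sub>L U) + (E w o\<^sub>L (id_blinfun - P))" for w
  have Rx: "R w x = C w (U x) + E w (x - P x)" for w x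
    by (simp add: R_def blinfun.add_left blinfun.diff_left)
  have Rc: "R w \<in> cblinfuns" if "w \<in> V" for w
    using C(1)[OF Vr(1)[OF that]] E(1)[OF Vr(3)[OF that]] U(1) P(1) by (auto simp: R_def)
  have analytic: "op_analytic_on R V"
    unfolding op_analytic_on_def
  proof (intro conjI ballI)
    show "R ` V \<subseteq> cblinfuns" using Rc by blast
    fix w assume w: "w \<in> V"
    have "C v - C u = (v - u) *\<^sub>C (C v o\<^sub>L (S o\<^sub>L C u))" if u: "u \<in> V" and v: "v \<in> V" for u v
    proof (rule blinfun_eqI)
      fix x
      have "C v x = C v (C u x - u *\<^sub>C S (C u x))" using AC[OF Vr(1)[OF u]] by simp
      also have "C u x - u *\<^sub>C S (C u x) = (C u x - v *\<^sub>C S (C u x)) + (v - u) *\<^sub>C S (C u x)"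
        by (simp add: cvec.scale_left_diff_distrib)
      also have "C v \<dots> = C u x + (v - u) *\<^sub>C C v (S (C u x))"
        using CA[OF Vr(1)[OF v]] by (simp add: blinfun.add_right cblinfuns_scaleC[OF C(1)[OF Vr(1)[OF v]]])
      finally show "(C v - C u) x = ((v - u) *\<^sub>C (C v o\<^sub>L (S o\<^sub>L C u))) x"
        by (simp add: blinfun.diff_left)
    qed
    then have dC: "(C has_derivative (\<lambda>h. h *\<^sub>C (C w o\<^sub>L (S o\<^sub>L C w)))) (at w)"
      using C(1) Vr(1) by (intro resolvent_has_derivative[OF V(1) w]) auto
    have "E v - E u = (v - u) *\<^sub>C (E v o\<^sub>L (id_blinfun o\<^sub>L E u))" if u: "u \<in> V" and v: "v \<in> V" for u v
    proof (rule blinfun_eqI)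
      fix x
      have "E v x = E v (J (E u x) - u *\<^sub>C E u x)" using E(2)[OF Vr(3)[OF u]] by simp
      also have "J (E u x) - u *\<^sub>C E u x = (J (E u x) - v *\<^sub>C E u x) + (v - u) *\<^sub>C E u x"
        by (simp add: cvec.scale_left_diff_distrib)
      also have "E v \<dots> = E u x + (v - u) *\<^sub>C E v (E u x)"
        using E(3)[OF Vr(3)[OF v]] by (simp add: blinfun.add_right cblinfuns_scaleC[OF E(1)[OF Vr(3)[OF v]]])
      finally show "(E v - E u) x = ((v - u) *\<^sub>C (E v o\<^sub>L (id_blinfun o\<^sub>L E u))) x"
        by (simp add: blinfun.diff_left)
    qed
    then have dE: "(E has_derivative (\<lambda>h. h *\<^sub>C (E w o\<^sub>L (id_blinfun o\<^sub>L E w)))) (at w)"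
      using E(1) Vr(3) by (intro resolvent_has_derivative[OF V(1) w]) auto
    let ?R' = "((C w o\<^sub>L (S o\<^sub>L C w)) o\<^sub>L U) + ((E w o\<^sub>L (id_blinfun o\<^sub>L E w)) o\<^sub>L (id_blinfun - P))"
    have left: "bounded_linear (\<lambda>F. F o\<^sub>L G)" for G :: "'a \<Rightarrow>\<^sub>L 'a"
      by (rule bounded_bilinear.bounded_linear_left[OF bounded_bilinear_blinfun_compose])
    have "(R has_derivative (\<lambda>h. ((h *\<^sub>C (C w o\<^sub>L (S o\<^sub>L C w))) o\<^sub>L U) +
        ((h *\<^sub>C (E w o\<^sub>L (id_blinfun o\<^sub>L E w))) o\<^sub>L (id_blinfun - P)))) (at w)"
      unfolding R_def
      by (intro has_derivative_add bounded_linear.has_derivative[OF left] dC dE)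
    moreover have "((h *\<^sub>C (C w o\<^sub>L (S o\<^sub>L C w))) o\<^sub>L U) +
        ((h *\<^sub>C (E w o\<^sub>L (id_blinfun o\<^sub>L E w))) o\<^sub>L (id_blinfun - P)) = h *\<^sub>C ?R'" for h
      by (rule blinfun_eqI) (simp add: blinfun.add_left scaleC_add_right)
    ultimately have "(R has_derivative (\<lambda>h. h *\<^sub>C ?R')) (at w)" by simp
    moreover have "?R' \<in> cblinfuns"
      using C(1)[OF Vr(1)[OF w]] E(1)[OF Vr(3)[OF w]] Sc U(1) P(1) by auto
    ultimately show "\<exists>R'\<in>cblinfuns. (R has_derivative (\<lambda>h. h *\<^sub>C R')) (at w)" by blast
  qed
  have gen: "gen_inverse UNIV D (op_shift T w) (blinfun_apply (R w))" if wV: "w \<in> V" for w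
  proof -
    have w: "cmod w \<le> r" "cmod w < r" "w \<noteq> 0" using Vr[OF wV] by auto
    have RD: "R w x \<in> D" for x
      unfolding Rx using CD[OF w(2) UD] EX[OF w(3) QX] X1_D D_sub by (blast intro: cvec.subspace_add)
    have P_D: "P x \<in> D" "x - P x \<in> D" if "x \<in> D" for x
    proof -
      show "x - P x \<in> D" using QX X1_D by blast
      then have "x - (x - P x) \<in> D" using that D_sub cvec.subspace_diff by blast
      then show "P x \<in> D" by simp
    qed
    define A where "A x = P x - w *\<^sub>C S (P x)" for x
    have A: "A x \<in> D" "A x \<in> X\<^sub>0" if "x \<in> D" for x
      unfolding A_def using P_D(1)[OF that] PX SPD D_sub X0(1)
      by (simp_all add: cvec.subspace_diff cvec.subspace_scale)
    have RT: "R w (op_shift T w x) = C w (S0 (T (A x))) + (x - P x)" if x: "x \<in> D" for x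
    proof -
      let ?x0 = "P x" and ?x1 = "x - P x"
      have "op_shift T w x = op_shift T w (?x0 + ?x1)" by simp
      also have "\<dots> = op_shift T w ?x0 + op_shift T w ?x1" by (rule shift_add[OF P_D[OF x]])
      finally have sum: "op_shift T w x = op_shift T w ?x0 + op_shift T w ?x1" .
      have m0: "op_shift T w ?x0 \<in> X\<^sub>0"
        unfolding op_shift_def using T_X0[OF P_D(1)[OF x] PX] PX X0(1)
        by (intro cvec.subspace_diff cvec.subspace_scale)
      have m1: "op_shift T w ?x1 \<in> X\<^sub>1"
        unfolding op_shift_def
        by (rule cvec.subspace_diff[OF X1(1) T_X1[OF P_D(2)[OF x] QX] cvec.subspace_scale[OF X1(1) QX]])
      have P0: "P (op_shift T w x) = op_shift T w ?x0" unfolding sum by (rule P(2)[OF m0 m1])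
      have S1: "S (op_shift T w ?x0) = S (T ?x0) - w *\<^sub>C S ?x0"
        by (simp add: op_shift_def blinfun.diff_right cblinfuns_scaleC[OF Sc])
      have "T (S (op_shift T w ?x0)) = T (S (T ?x0)) - w *\<^sub>C T (S ?x0)"
        unfolding S1 using SD D_sub by (simp add: T_diff T_scale cvec.subspace_scale)
      also have "\<dots> = T (A x)"
        unfolding A_def using STS[OF P_D(1)[OF x]] P_D(1)[OF x] SD D_sub
        by (simp add: T_diff T_scale cvec.subspace_scale)
      finally have 1: "U (op_shift T w x) = S0 (T (A x))" by (simp add: U(2) P0)
      have "op_shift T w x - P (op_shift T w x) = op_shift T w ?x1"
        using P0 sum by (metis add_diff_cancel_left')
      also have "\<dots> = J ?x1 - w *\<^sub>C ?x1" by (simp only: op_shift_def J(2)[OF QX])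
      finally have "op_shift T w x - P (op_shift T w x) = J ?x1 - w *\<^sub>C ?x1" .
      then have 2: "E w (op_shift T w x - P (op_shift T w x)) = ?x1" using E(3)[OF w(3)] by simp
      show ?thesis unfolding Rx 1 2 ..
    qed
    have CAx: "C w (A x) = P x" for x unfolding A_def by (rule CA[OF w(1)])
    show ?thesis
      unfolding gen_inverse_def
    proof (intro conjI ballI)
      show "bounded_op UNIV (blinfun_apply (R w))"
        unfolding bounded_op_def clinear_on_def
        using cblinfuns_scaleC[OF Rc[OF wV]] norm_blinfun[of "R w"] by (auto simp: blinfun.add_right)
      show "range (blinfun_apply (R w)) \<subseteq> D" using RD by blast
      show "op_shift T w (R w (op_shift T w x)) = op_shift T w x" if x: "x \<in> D" for x
      proof -
        \<comment> \<open>The defect of \<open>S0 T\<close> on \<open>A x\<close> lies in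
          \<open>ker T \<inter> X\<^sub>0\<close>. It reaches the result only through
          \<open>C w n\<close>, which \<open>T - w\<close> annihilates.\<close>
        define n where "n = A x - S0 (T (A x))"
        have TA: "T (A x) \<in> X\<^sub>0" by (rule T_X0[OF A[OF x]])
        have n: "n \<in> ker_op D T" "n \<in> X\<^sub>0"
          using A[OF x] ran0[OF TA] inv0(1)[OF A[OF x]] D_sub X0(1)
          by (simp_all add: n_def ker_op_def T_diff cvec.subspace_diff)
        have "R w (op_shift T w x) = x - C w n"
          unfolding RT[OF x] n_def by (simp add: blinfun.diff_right CAx)
        moreover have "op_shift T w (x - C w n) = op_shift T w x"
          using Cker[OF w(2) n] x by (simp add: shift_diff) (simp add: op_shift_def)
        ultimately show ?thesis by simp
      qed
      show "R w (op_shift T w (R w x)) = R w x" for x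
      proof -
        have Px: "P (R w x) = C w (U x)" unfolding Rx by (rule P(2)[OF CX[OF w(2) UX] EX[OF w(3) QX]])
        \<comment> \<open>On the \<open>X\<^sub>0\<close> component \<open>1 - w S\<close> undoes
          \<open>C w\<close>, and by \<open>S0 T S0 = S0\<close> the values of \<open>U\<close> are
          fixed by \<open>S0 T\<close>.\<close>
        have "A (R w x) = U x" unfolding A_def Px by (rule AC[OF w(1)])
        then have "S0 (T (A (R w x))) = U x" using inv0(2)[OF SPD(3)] by (simp add: U(2))
        then show ?thesis unfolding RT[OF RD] Px by simp
      qed
      have "continuous_on D A"
        unfolding A_def
        by (intro continuous_intros linear_continuous_on blinfun.bounded_linear_right
            bounded_linear.continuous_on[OF bounded_bilinear.bounded_linear_right[OF bounded_bilinear_scaleC]])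
      then have "continuous_on D (\<lambda>x. S0 (T (A x)))"
        by (rule continuous_on_compose2[OF cont0]) (use A in auto)
      then have "continuous_on D (\<lambda>x. C w (S0 (T (A x))) + (x - P x))"
        by (intro continuous_on_add continuous_on_diff continuous_on_id
            bounded_linear.continuous_on[OF blinfun.bounded_linear_right])
      then show "continuous_on D (\<lambda>x. R w (op_shift T w x))"
        by (subst continuous_on_cong[OF refl RT])
    qed
  qed
  show ?thesis unfolding reg_set_def using V analytic gen by blast
qed

section \<open>The two inequalities\<close>

lemma spectral_radius_le_dist:
  assumes S: "valid S" shows "1 / op_spectral_radius S \<le> dist_set 0 (gen_spectrum D T - {0})"
  unfolding dist_set_def
proof (rule INF_greatest, rule ccontr)
  fix y assume y: "y \<in> gen_spectrum D T - {0}" and "\<not> 1 / op_spectral_radius S \<le> ennreal (dist 0 y)"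
  then have "ennreal (cmod y) < 1 / op_spectral_radius S" by simp
  \<comment> \<open>Room on both sides: \<open>y\<close> must lie strictly inside a closed disc on
    which \<open>1 - w S\<close> is invertible.\<close>
  then obtain c where c: "ennreal (cmod y) < c" "c < 1 / op_spectral_radius S" using dense by blast
  then obtain r where r: "c = ennreal r" "r \<ge> 0" by (cases c) auto
  have "y \<in> reg_set D T"
  proof (rule valid_invertible_imp_regular[OF S])
    show "y \<noteq> 0" using y by simp
    show "cmod y < r" using c(1) r by (simp add: ennreal_less_iff)
    fix w assume w: "cmod w \<le> r"
    show "\<exists>C\<in>cblinfuns. (id_blinfun - w *\<^sub>C S) o\<^sub>L C = id_blinfun \<and> C o\<^sub>L (id_blinfun - w *\<^sub>C S) = id_blinfun"
    proof (cases "w = 0")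
      case True
      then show ?thesis by (intro bexI[of _ id_blinfun]) (auto intro!: blinfun_eqI)
    next
      case False
      have "inverse w \<notin> op_spectrum S"
      proof
        assume "inverse w \<in> op_spectrum S"
        then have "ennreal (cmod (inverse w)) \<le> op_spectral_radius S"
          unfolding op_spectral_radius_def by (rule SUP_upper)
        then have "inverse (op_spectral_radius S) \<le> inverse (ennreal (cmod (inverse w)))"
          by (simp add: inverse_antimono_ennreal)
        also have "\<dots> = ennreal (cmod w)" using False by (simp add: inverse_ennreal norm_inverse)
        also have "\<dots> \<le> c" using w r by (simp add: ennreal_leI)
        finally show False using c(2) by (simp add: divide_ennreal_def)
      qed
      then show ?thesis using invertible_iff_not_spectrum[OF False validD(1)[OF S]] by blast
    qed
  qed
  then show False using y by (simp add: gen_spectrum_def)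
qed

lemma dist_le_spectral_radius:
  assumes "ennreal r < dist_set 0 (gen_spectrum D T - {0})" "0 \<le> r"
  obtains S where "valid S" "ennreal r \<le> 1 / op_spectral_radius S"
proof -
  \<comment> \<open>The construction reaches only radii strictly below that of the regular punctured
    disc; the intermediate \<open>d\<close> is finite even when the distance is infinite.\<close>
  obtain c where c: "ennreal r < c" "c < dist_set 0 (gen_spectrum D T - {0})" using dense assms(1) by blast
  then obtain d where d: "c = ennreal d" "d \<ge> 0" by (cases c) auto
  have "r < d" using c(1) d assms(2) by (simp add: ennreal_less_iff)
  interpret disc: kato_disc T D X\<^sub>0 X\<^sub>1 d
  proof
    fix z assume z: "z \<noteq> 0" "cmod z < d"
    show "z \<in> reg_set D T"
    proof (rule ccontr)
      assume "z \<notin> reg_set D T"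
      then have "dist_set 0 (gen_spectrum D T - {0}) \<le> ennreal (dist 0 z)"
        unfolding dist_set_def gen_spectrum_def using z(1) by (intro INF_lower) auto
      also have "\<dots> \<le> c" using z(2) d by (simp add: ennreal_leI)
      finally show False using c(2) by simp
    qed
  qed
  obtain S where S: "valid S" "\<And>z. cmod z \<le> r \<Longrightarrow>
    \<exists>C\<in>cblinfuns. (id_blinfun - z *\<^sub>C S) o\<^sub>L C = id_blinfun \<and> C o\<^sub>L (id_blinfun - z *\<^sub>C S) = id_blinfun"
    using disc.exists_valid_invertible[OF assms(2) \<open>r < d\<close>] by blast
  have "ennreal r \<le> 1 / op_spectral_radius S"
  proof (cases "r = 0")
    case False
    then have r: "r > 0" using assms(2) by simp
    have "op_spectral_radius S \<le> ennreal (inverse r)"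
      unfolding op_spectral_radius_def
    proof (rule SUP_least, rule ccontr)
      fix w assume w: "w \<in> op_spectrum S" "\<not> ennreal (cmod w) \<le> ennreal (inverse r)"
      then have "inverse r < cmod w" using r by (simp add: ennreal_le_iff)
      then have w0: "w \<noteq> 0" and "inverse (cmod w) \<le> r"
        using r less_imp_inverse_less[of "inverse r" "cmod w"] by auto
      then have "cmod (inverse w) \<le> r" by (simp add: norm_inverse)
      then have "inverse (inverse w) \<notin> op_spectrum S"
        using S(2) invertible_iff_not_spectrum[OF _ validD(1)[OF S(1)], of "inverse w"] w0 by auto
      then show False using w(1) by simp
    qed
    then have "inverse (ennreal (inverse r)) \<le> inverse (op_spectral_radius S)"
      by (rule inverse_antimono_ennreal)
    then show ?thesis using r by (simp add: inverse_ennreal divide_ennreal_def)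
  qed simp
  then show thesis using that S(1) by blast
qed

end

theorem theorem3p2:
  fixes T :: "'a::complex_banach \<Rightarrow> 'a" and D X\<^sub>0 X\<^sub>1 :: "'a set"
  assumes "closed_op UNIV D T"
    and "0 \<in> rho_e D T"
    and "kato_decomposition D T X\<^sub>0 X\<^sub>1"
  shows "dist_set 0 (gen_spectrum D T - {0}) =
    (SUP S \<in> {S \<in> cblinfuns. range (blinfun_apply S) \<subseteq> D \<and>
                (\<forall>x\<in>D. T (blinfun_apply S (T x)) = T x) \<and> blinfun_apply S ` X\<^sub>0 \<subseteq> X\<^sub>0}.
       1 / op_spectral_radius S)"
proof -
  have "op_shift T 0 = T" by (simp add: op_shift_def)
  then interpret kato_operator T D X\<^sub>0 X\<^sub>1
    using assms by unfold_locales (simp_all add: rho_e_def)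
  have "(SUP S \<in> {S. valid S}. 1 / op_spectral_radius S) = dist_set 0 (gen_spectrum D T - {0})"
  proof (rule antisym)
    show "(SUP S \<in> {S. valid S}. 1 / op_spectral_radius S) \<le> dist_set 0 (gen_spectrum D T - {0})"
      using spectral_radius_le_dist by (intro SUP_least) simp
    show "dist_set 0 (gen_spectrum D T - {0}) \<le> (SUP S \<in> {S. valid S}. 1 / op_spectral_radius S)"
    \<comment> \<open>No single \<open>S\<close> is claimed to attain the supremum; every value
      strictly below the distance is dominated by some valid \<open>S\<close>.\<close>
    proof (rule dense_le)
      fix x assume x: "x < dist_set 0 (gen_spectrum D T - {0})"
      then obtain r where r: "x = ennreal r" "r \<ge> 0" by (cases x) auto
      obtain S where "valid S" "ennreal r \<le> 1 / op_spectral_radius S"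
        using dist_le_spectral_radius x r by blast
      then show "x \<le> (SUP S \<in> {S. valid S}. 1 / op_spectral_radius S)"
        unfolding r(1) by (intro SUP_upper2[of S]) auto
    qed
  qed
  then show ?thesis by (simp add: valid_def)
qed

end
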